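(* Let $n,m\in\mathbb{N}$ be positive integers and $1\le p<\infty$ with $mp<n$, and let $\frac{np}{n-mp}<q<\infty$. Let $\Omega\subset\mathbb{R}^n$ be open and bounded with Lipschitz boundary, let $D\Subset\Omega$ be an open precompact subset with minimally smooth boundary, and let $u\in W^{m,p}(\Omega)\cap L^q(\Omega- D)$. Then there is a sequence of smooth functions $(\varphi_k)_{k=1}^\infty\subset C^\infty(\overline{\Omega})$ such that $$\|u-\varphi_k\|_{m,p;\Omega}+\|u-\varphi_k\|_{q;\Omega-D}\to 0\quad\text{for } k\to\infty.$$
   Context: Functions are real-valued. $\Omega-D$ denotes set difference. $D\Subset\Omega$ means that $\overline{D}$ is compact and contained in $\Omega$. $u\in W^{m,p}(\Omega)\cap L^q(\Omega-D)$ means that $u\in W^{m,p}(\Omega)$ and its restriction to $\Omega-D$ lies in $L^q(\Omega-D)$. $\|\cdot\|_{q;A}$ is the $L^q(A)$-norm with respect to Lebesgue measure, and $\|u\|_{m,p;\Omega}:=\sum_{\nu\in\mathbb{N}_0^n,\,|\nu|\le m}\|\partial^\nu u\|_{p;\Omega}$. $C^\infty(\overline\Omega)$ is the usual space of functions that are smooth up to the boundary of $\Omega$. An open set $G\subset\mathbb{R}^n$ has minimally smooth boundary (in the sense of Stein) if there are $\varepsilon>0$, a covering $(U_i)_{i=1}^\infty$ of $\partial G$ by open sets, an integer $N$ and a real $L>0$ such that: (i) if $x\in\partial G$, then $B_\varepsilon(x)\subset U_i$ for some $i$; (ii) no point of $\mathbb{R}^n$ is contained in more than $N$ of the $U_i$;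 (iii) for each $i$ there are (Cartesian) coordinates $(x_1,\dots,x_n)$ such that $G\cap U_i=\{(x_1,\dots,x_n)\in U_i: x_n<\varphi_i(x_1,\dots,x_{n-1})\}$ with a Lipschitz function $\varphi_i:\mathbb{R}^{n-1}\to\mathbb{R}$ with $\mathrm{Lip}(\varphi_i)\le L$. *)

theory Defs
  imports "HOL-Analysis.Analysis"
begin

section \<open>Classical derivatives and smooth functions\<close>

text \<open>The partial derivative in direction \<open>i\<close>; it is only used for functions that are
  (totally) differentiable at the point in question.\<close>

definition partial_deriv :: "'n::finite \<Rightarrow> (real^'n \<Rightarrow> real) \<Rightarrow> real^'n \<Rightarrow> real" where
  "partial_deriv i f x = frechet_derivative f (at x) (axis i 1)"

fun iterated_partial :: "'n::finite list \<Rightarrow> (real^'n \<Rightarrow> real) \<Rightarrow> real^'n \<Rightarrow> real" where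
  "iterated_partial [] f = f"
| "iterated_partial (j # js) f = partial_deriv j (iterated_partial js f)"

text \<open>Smoothness on an open set \<open>U\<close>: all iterated partial derivatives exist and are
  differentiable, hence continuous, on \<open>U\<close>.\<close>

definition smooth_on :: "(real^'n::finite) set \<Rightarrow> (real^'n \<Rightarrow> real) \<Rightarrow> bool" where
  "smooth_on U f \<longleftrightarrow> (\<forall>js. \<forall>x\<in>U. iterated_partial js f differentiable (at x))"

text \<open>A multi-index \<open>\<nu>\<close> assigns to each coordinate direction the number of derivatives taken.\<close>

definition mi_order :: "('n::finite \<Rightarrow> nat) \<Rightarrow> nat" where
  "mi_order \<nu> = (\<Sum>i\<in>UNIV. \<nu> i)"

text \<open>As the index type carries no order, the order of differentiation is an arbitrary one in
  which direction \<open>i\<close> occurs \<open>\<nu> i\<close> times; for smooth functions it is immaterial.\<close>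

definition mi_deriv :: "('n::finite \<Rightarrow> nat) \<Rightarrow> (real^'n \<Rightarrow> real) \<Rightarrow> real^'n \<Rightarrow> real" where
  "mi_deriv \<nu> f = iterated_partial (SOME js. \<forall>i. count_list js i = \<nu> i) f"

text \<open>Smooth up to the boundary: all derivatives extend continuously to the closure. Only the
  values of \<open>f\<close> on the closure matter.\<close>

definition smooth_closure :: "(real^'n::finite) set \<Rightarrow> (real^'n \<Rightarrow> real) set" where
  "smooth_closure \<Omega> = {f. continuous_on (closure \<Omega>) f \<and> smooth_on \<Omega> f \<and>
     (\<forall>\<nu>. \<exists>g. continuous_on (closure \<Omega>) g \<and> (\<forall>x\<in>\<Omega>. g x = mi_deriv \<nu> f x))}"

definition test_functions :: "(real^'n::finite) set \<Rightarrow> (real^'n \<Rightarrow> real) set" where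
  "test_functions \<Omega> = {\<psi>. smooth_on UNIV \<psi> \<and>
     compact (closure {x. \<psi> x \<noteq> 0}) \<and> closure {x. \<psi> x \<noteq> 0} \<subseteq> \<Omega>}"

section \<open>Lebesgue and Sobolev spaces\<close>

text \<open>Functions on \<open>A\<close> are represented by total functions, of which only the restriction to \<open>A\<close>
  matters; functions agreeing almost everywhere are not identified.\<close>

definition Lp_space :: "real \<Rightarrow> (real^'n::finite) set \<Rightarrow> (real^'n \<Rightarrow> real) set" where
  "Lp_space p A = {f. f \<in> borel_measurable (lebesgue_on A) \<and>
     integrable (lebesgue_on A) (\<lambda>x. \<bar>f x\<bar> powr p)}"

definition Lp_norm :: "real \<Rightarrow> (real^'n::finite) set \<Rightarrow> (real^'n \<Rightarrow> real) \<Rightarrow> real" where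
  "Lp_norm p A f = (integral\<^sup>L (lebesgue_on A) (\<lambda>x. \<bar>f x\<bar> powr p)) powr (1 / p)"

definition locally_integrable_on :: "(real^'n::finite \<Rightarrow> real) \<Rightarrow> (real^'n) set \<Rightarrow> bool" where
  "locally_integrable_on f \<Omega> \<longleftrightarrow> (\<forall>K. compact K \<and> K \<subseteq> \<Omega> \<longrightarrow> integrable (lebesgue_on K) f)"

definition is_weak_deriv ::
  "(real^'n::finite) set \<Rightarrow> ('n \<Rightarrow> nat) \<Rightarrow> (real^'n \<Rightarrow> real) \<Rightarrow> (real^'n \<Rightarrow> real) \<Rightarrow> bool" where
  "is_weak_deriv \<Omega> \<nu> u v \<longleftrightarrow>
     locally_integrable_on u \<Omega> \<and> locally_integrable_on v \<Omega> \<and>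
     (\<forall>\<psi>\<in>test_functions \<Omega>.
        integral\<^sup>L (lebesgue_on \<Omega>) (\<lambda>x. u x * mi_deriv \<nu> \<psi> x) =
        (-1) ^ mi_order \<nu> * integral\<^sup>L (lebesgue_on \<Omega>) (\<lambda>x. v x * \<psi> x))"

text \<open>Some representative of the weak derivative, which is unique almost everywhere on \<open>\<Omega>\<close>.\<close>

definition weak_deriv ::
  "(real^'n::finite) set \<Rightarrow> ('n \<Rightarrow> nat) \<Rightarrow> (real^'n \<Rightarrow> real) \<Rightarrow> (real^'n \<Rightarrow> real)" where
  "weak_deriv \<Omega> \<nu> u = (SOME v. is_weak_deriv \<Omega> \<nu> u v)"

definition sobolev_space :: "nat \<Rightarrow> real \<Rightarrow> (real^'n::finite) set \<Rightarrow> (real^'n \<Rightarrow> real) set" where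
  "sobolev_space m p \<Omega> = {u \<in> Lp_space p \<Omega>.
     \<forall>\<nu>. mi_order \<nu> \<le> m \<longrightarrow> (\<exists>v \<in> Lp_space p \<Omega>. is_weak_deriv \<Omega> \<nu> u v)}"

definition sobolev_norm :: "nat \<Rightarrow> real \<Rightarrow> (real^'n::finite) set \<Rightarrow> (real^'n \<Rightarrow> real) \<Rightarrow> real" where
  "sobolev_norm m p \<Omega> u = (\<Sum>\<nu> | mi_order \<nu> \<le> m. Lp_norm p \<Omega> (weak_deriv \<Omega> \<nu> u))"

section \<open>Domains\<close>

text \<open>In suitable Cartesian coordinates, \<open>G \<inter> U\<close> is the part of \<open>U\<close> below the graph of a Lipschitz
  function with constant \<open>L\<close>. The coordinates of \<open>x\<close> are the components of \<open>T (x - a)\<close>, the one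
  called \<open>k\<close> plays the role of the last coordinate, and the space of the remaining coordinates is
  identified with the hyperplane of vectors with vanishing component \<open>k\<close>.\<close>

definition lipschitz_subgraph_in ::
  "real \<Rightarrow> (real^'n::finite) set \<Rightarrow> (real^'n) set \<Rightarrow> bool" where
  "lipschitz_subgraph_in L G U \<longleftrightarrow>
     (\<exists>(T :: real^'n \<Rightarrow> real^'n) a k \<phi>.
        orthogonal_transformation T \<and> L-lipschitz_on {y :: real^'n. y $ k = 0} \<phi> \<and>
        G \<inter> U = {x \<in> U. T (x - a) $ k < \<phi> (\<chi> j. if j = k then 0 else T (x - a) $ j)})"

definition lipschitz_boundary :: "(real^'n::finite) set \<Rightarrow> bool" where
  "lipschitz_boundary G \<longleftrightarrow>
     (\<forall>x\<in>frontier G. \<exists>U L. open U \<and> x \<in> U \<and> lipschitz_subgraph_in L G U)"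

definition minimally_smooth_boundary :: "(real^'n::finite) set \<Rightarrow> bool" where
  "minimally_smooth_boundary G \<longleftrightarrow>
     (\<exists>(\<epsilon>::real) (U :: nat \<Rightarrow> (real^'n) set) (N::nat) (L::real).
        \<epsilon> > 0 \<and> L > 0 \<and> (\<forall>i. open (U i)) \<and> frontier G \<subseteq> (\<Union>i. U i) \<and>
        (\<forall>x\<in>frontier G. \<exists>i. ball x \<epsilon> \<subseteq> U i) \<and>
        (\<forall>x. finite {i. x \<in> U i} \<and> card {i. x \<in> U i} \<le> N) \<and>
        (\<forall>i. lipschitz_subgraph_in L G (U i)))"

definition compactly_contained :: "(real^'n::finite) set \<Rightarrow> (real^'n) set \<Rightarrow> bool"
    (infix \<open>\<Subset>\<close> 50) where
  "D \<Subset> \<Omega> \<longleftrightarrow> compact (closure D) \<and> closure D \<subseteq> \<Omega>"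

end

theory Submission
  imports Defs
begin

text \<open>
  The approximations are obtained by mollifying \<open>u\<close> with shifted kernels, one shift direction for
  each piece of a partition of unity.

  Around a point of the boundary of \<open>\<Omega>\<close> the set \<open>\<Omega>\<close> lies below a Lipschitz graph. If \<open>e\<close> points
  steeply downwards, then for \<open>x \<in> \<Omega>\<close> the ball around \<open>x + t e\<close> whose radius is a fixed multiple of
  \<open>t\<close> stays in \<open>\<Omega>\<close>. Around a point of the boundary of \<open>D\<close> one uses the opposite direction, which
  moves points outside \<open>D\<close> further away from \<open>D\<close>. At all remaining points of the closure of \<open>\<Omega>\<close>
  the direction \<open>0\<close> will do. So every point of the closure has a neighbourhood, a direction \<open>e\<close> and
  a bound on \<open>t\<close> for which both \<open>\<Omega>\<close> and \<open>\<Omega> - D\<close> absorb these balls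
  (\<open>local_shift_direction\<close>).

  Let \<open>J\<^sub>a\<close> be the mollification at scale \<open>t\<close> with a kernel supported around \<open>t e\<^sub>a\<close>, where
  \<open>e\<^sub>a\<close> is the direction belonging to the point \<open>a\<close>, and extend \<open>u\<close> by \<open>0\<close> outside \<open>\<Omega>\<close>. By
  compactness finitely many of the neighbourhoods suffice. With a smooth partition of unity \<open>\<zeta>\<^sub>a\<close>
  subordinate to them (\<open>smooth_partition_of_unity\<close>) put \<open>\<phi> = (\<Sum>a. \<zeta>\<^sub>a J\<^sub>a u)\<close>, a smooth function on
  the whole space.

  Let \<open>t\<close> be small. Outside \<open>D\<close>, the value of \<open>J\<^sub>a u\<close> at a point of the \<open>a\<close>-th neighbourhood depends only on the
  values of \<open>u\<close> in \<open>\<Omega> - D\<close>. Hence, on \<open>\<Omega> - D\<close>, \<open>u - \<phi>\<close> is the sum of the \<open>\<zeta>\<^sub>a (w - J\<^sub>a w)\<close> for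
  the restriction \<open>w\<close> of \<open>u\<close> to \<open>\<Omega> - D\<close>, which tends to \<open>0\<close> in \<open>L\<^sup>q\<close> since mollifications converge
  in \<open>L\<^sup>q\<close> (\<open>approximate_identity_tendsto_Lp\<close>).

  Likewise, at points of \<open>\<Omega>\<close> in the \<open>a\<close>-th neighbourhood a derivative of \<open>J\<^sub>a u\<close> is \<open>J\<^sub>a\<close> applied to
  the weak derivative, because there the shifted kernel is a test function on \<open>\<Omega>\<close>
  (\<open>iterated_partial_mollify_weak\<close>). By the Leibniz rule, a derivative of \<open>\<phi>\<close> is a sum of terms
  \<open>\<partial>\<^sup>\<alpha>\<zeta>\<^sub>a J\<^sub>a(\<partial>\<^sup>\<beta>u)\<close>, which converge in \<open>L\<^sup>p\<close> to \<open>\<partial>\<^sup>\<alpha>\<zeta>\<^sub>a \<partial>\<^sup>\<beta>u\<close>. Summation over \<open>a\<close>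
  leaves only the terms with \<open>\<alpha> = 0\<close>, as the \<open>\<zeta>\<^sub>a\<close> add up to \<open>1\<close>. So the classical derivatives of
  \<open>\<phi>\<close> tend to the weak derivatives of \<open>u\<close>. That the norm of the statement sees precisely
  these differences is the almost everywhere uniqueness of weak derivatives
  (\<open>is_weak_deriv_unique\<close>), again a consequence of mollification.
\<close>

section \<open>A smooth bump function on the line\<close>

definition flat_exp :: "nat \<Rightarrow> real \<Rightarrow> real" where
  "flat_exp k x = (if x > 0 then exp (- 1 / x) / x ^ k else 0)"

text \<open>The family is closed under differentiation up to linear combinations. At \<open>0\<close> the derivative
  vanishes because \<open>exp (- 1 / x)\<close> decays faster than any power of \<open>x\<close>.\<close>

lemma flat_exp_derivative:
  "(flat_exp k has_real_derivative flat_exp (k + 2) x - real k * flat_exp (k + 1) x) (at x)"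
proof -
  consider "x > 0" | "x < 0" | "x = 0" by linarith
  then show ?thesis
  proof cases
    case 1
    have "((\<lambda>x. exp (- 1 / x) / x ^ k) has_real_derivative
        flat_exp (k + 2) x - real k * flat_exp (k + 1) x) (at x)"
    proof -
      have "x ^ k = x * x ^ (k - 1)" if "k \<noteq> 0"
        using that by (cases k) auto
      then show ?thesis
        using 1 by (cases "k = 0")
          (auto intro!: derivative_eq_intros simp: flat_exp_def field_simps power2_eq_square)
    qed
    then show ?thesis
      by (rule has_field_derivative_transform_within[where d = x])
         (use 1 in \<open>auto simp: flat_exp_def dist_real_def\<close>)
  next
    case 2
    have "((\<lambda>x. 0) has_real_derivative flat_exp (k + 2) x - real k * flat_exp (k + 1) x) (at x)"
      using 2 by (auto simp: flat_exp_def)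
    then show ?thesis
      by (rule has_field_derivative_transform_within[where d = "- x"])
         (use 2 in \<open>auto simp: flat_exp_def dist_real_def\<close>)
  next
    case 3
    have lim: "((\<lambda>y. y ^ (k + 1) / exp y) \<longlongrightarrow> 0) (at_top :: real filter)"
      by (rule tendsto_power_div_exp_0)
    have "((\<lambda>h. (inverse h) ^ (k + 1) / exp (inverse h)) \<longlongrightarrow> 0) (at_right (0::real))"
      by (rule filterlim_compose[OF lim filterlim_inverse_at_top_right])
    then have right: "((\<lambda>h. flat_exp k h / h) \<longlongrightarrow> 0) (at_right 0)"
      by (rule Lim_transform_eventually)
         (auto simp: eventually_at_right_field flat_exp_def field_simps exp_minus
           intro!: exI[of _ 1])
    have left: "((\<lambda>h. flat_exp k h / h) \<longlongrightarrow> 0) (at_left 0)"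
      by (rule Lim_transform_eventually[OF tendsto_const])
         (auto simp: eventually_at_left_field flat_exp_def intro!: exI[of _ "-1"])
    from left right have "((\<lambda>h. flat_exp k h / h) \<longlongrightarrow> 0) (at 0)"
      by (simp add: filterlim_split_at)
    then show ?thesis
      using 3 by (simp add: DERIV_def flat_exp_def)
  qed
qed

text \<open>Linear combinations of these products are closed under differentiation, so that every
  function of the class is smooth; all of them vanish outside the interval from \<open>-1\<close> to \<open>1\<close>.\<close>

inductive_set bump_class :: "(real \<Rightarrow> real) set" where
  prod: "(\<lambda>x. flat_exp j (1 + x) * flat_exp k (1 - x)) \<in> bump_class"
| lin: "f \<in> bump_class \<Longrightarrow> g \<in> bump_class \<Longrightarrow> (\<lambda>x. a * f x + b * g x) \<in> bump_class"

lemma bump_class_derivative: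
  assumes "f \<in> bump_class"
  shows "\<exists>g\<in>bump_class. \<forall>x. (f has_real_derivative g x) (at x)"
  using assms
proof induction
  case (prod j k)
  define P where "P = (\<lambda>j k x. flat_exp j (1 + x) * flat_exp k (1 - x))"
  have P: "P j k \<in> bump_class" for j k
    unfolding P_def by (rule bump_class.prod)
  have [derivative_intros]:
    "((\<lambda>x. flat_exp i (f x)) has_real_derivative
        (flat_exp (i + 2) (f x) - real i * flat_exp (i + 1) (f x)) * D) (at x)"
    if "(f has_real_derivative D) (at x)" for f i D x
    using DERIV_chain2[OF flat_exp_derivative that] .
  let ?g = "\<lambda>x. 1 * (1 * P (j + 2) k x + (- real j) * P (j + 1) k x)
     + (- 1) * (1 * P j (k + 2) x + (- real k) * P j (k + 1) x)"
  have "?g \<in> bump_class"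
    by (intro bump_class.lin P)
  moreover have "((\<lambda>x. flat_exp j (1 + x) * flat_exp k (1 - x)) has_real_derivative ?g x) (at x)" for x
    by (auto intro!: derivative_eq_intros simp: P_def algebra_simps)
  ultimately show ?case by (intro bexI[where x = ?g] allI)
next
  case (lin f g a b)
  then obtain f' g' where fg: "f' \<in> bump_class" "g' \<in> bump_class"
      "\<And>x. (f has_real_derivative f' x) (at x)" "\<And>x. (g has_real_derivative g' x) (at x)"
    by blast
  have "(\<lambda>x. a * f' x + b * g' x) \<in> bump_class"
    using fg by (intro bump_class.lin)
  moreover have "((\<lambda>x. a * f x + b * g x) has_real_derivative a * f' x + b * g' x) (at x)" for x
    by (intro DERIV_add DERIV_cmult fg)
  ultimately show ?case by (intro bexI[where x = "\<lambda>x. a * f' x + b * g' x"] allI)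
qed

definition bump :: "nat \<Rightarrow> real \<Rightarrow> real" where
  "bump k = (deriv ^^ k) (\<lambda>x. flat_exp 0 (1 + x) * flat_exp 0 (1 - x))"

lemma bump_in_class: "bump k \<in> bump_class"
proof (induction k)
  case 0
  show ?case by (simp add: bump_def bump_class.prod)
next
  case (Suc k)
  then obtain g where g: "g \<in> bump_class" "\<And>x. (bump k has_real_derivative g x) (at x)"
    using bump_class_derivative by blast
  have "bump (Suc k) = g"
    using DERIV_imp_deriv[OF g(2)] by (auto simp: bump_def)
  with g show ?case by simp
qed

lemma bump_derivative: "(bump k has_real_derivative bump (Suc k) x) (at x)"
proof -
  obtain g where g: "\<And>x. (bump k has_real_derivative g x) (at x)"
    using bump_class_derivative[OF bump_in_class] by blast
  have "bump (Suc k) x = g x"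
    using DERIV_imp_deriv[OF g] by (simp add: bump_def)
  with g show ?thesis by simp
qed

lemma bump_eq_0: "1 \<le> \<bar>x\<bar> \<Longrightarrow> bump k x = 0"
proof -
  have "1 \<le> \<bar>x\<bar> \<longrightarrow> f x = 0" if "f \<in> bump_class" for f
    using that by induction (auto simp: flat_exp_def)
  then show "1 \<le> \<bar>x\<bar> \<Longrightarrow> bump k x = 0"
    using bump_in_class by blast
qed

lemma bump_0_pos: "\<bar>x\<bar> < 1 \<Longrightarrow> 0 < bump 0 x"
  by (auto simp: bump_def flat_exp_def)

lemma bump_0_nonneg: "0 \<le> bump 0 x"
  by (auto simp: bump_def flat_exp_def)

lemma continuous_on_bump: "continuous_on A (bump k)"
  using bump_derivative DERIV_isCont continuous_at_imp_continuous_on by blast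

lemma bump_bounded: "\<exists>B. \<forall>x. \<bar>bump k x\<bar> \<le> B"
proof -
  have "compact (bump k ` {-1..1})"
    by (intro compact_continuous_image continuous_on_bump) simp
  then obtain B where B: "\<And>x. x \<in> {-1..1} \<Longrightarrow> \<bar>bump k x\<bar> \<le> B"
    using compact_imp_bounded[of "bump k ` {-1..1}"] unfolding bounded_iff by (metis imageI real_norm_def)
  have "\<bar>bump k x\<bar> \<le> B" for x
  proof (cases "x \<in> {-1..1}")
    case False
    then have "bump k x = 0" by (intro bump_eq_0) auto
    moreover have "0 \<le> B" using B[of 0] by auto
    ultimately show ?thesis by simp
  qed (use B in auto)
  then show ?thesis by blast
qed

section \<open>Mollifiers of product form\<close>

text \<open>The partial derivative of multi-index \<open>\<nu>\<close> of the function
  \<open>y \<mapsto> (\<Prod>i. bump 0 (y\<^sub>i / t - e\<^sub>i))\<close>, a bump of width \<open>t\<close> around \<open>t e\<close>. The product form makes all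
  mixed derivatives explicit and independent of the order of differentiation.\<close>

definition bump_product :: "real \<Rightarrow> real^'n \<Rightarrow> ('n::finite \<Rightarrow> nat) \<Rightarrow> real^'n \<Rightarrow> real" where
  "bump_product t e \<nu> y = (\<Prod>i\<in>UNIV. bump (\<nu> i) (y $ i / t - e $ i) / t ^ \<nu> i)"

text \<open>For every \<open>\<nu>\<close> the divisor is the mass of the bump itself, so that \<open>mollifier t e \<nu>\<close> is the partial
  derivative of multi-index \<open>\<nu>\<close> of the probability density \<open>mollifier t e (\<lambda>_. 0)\<close>.\<close>

definition mollifier :: "real \<Rightarrow> real^'n \<Rightarrow> ('n::finite \<Rightarrow> nat) \<Rightarrow> real^'n \<Rightarrow> real" where
  "mollifier t e \<nu> y = bump_product t e \<nu> y / integral\<^sup>L lborel (bump_product t e (\<lambda>_. 0))"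

lemma bump_product_has_derivative:
  fixes e :: "real^'n::finite"
  assumes "0 < t"
  shows "(bump_product t e \<nu> has_derivative
     (\<lambda>h. \<Sum>i\<in>UNIV. h $ i * bump_product t e (\<nu>(i := Suc (\<nu> i))) y)) (at y)"
proof -
  define b where "b = (\<lambda>(i::'n) k (s::real). bump k (s / t - e $ i) / t ^ k)"
  have b: "(b i k has_real_derivative b i (Suc k) s) (at s)" for i k s
  proof -
    have "((\<lambda>s. bump k (s / t - e $ i)) has_real_derivative bump (Suc k) (s / t - e $ i) * (1 / t)) (at s)"
      by (rule DERIV_chain2[OF bump_derivative]) (use assms in \<open>auto intro!: derivative_eq_intros\<close>)
    from DERIV_cdivide[OF this, of "t ^ k"] show ?thesis
      by (simp add: b_def mult.commute)
  qed
  have comp: "((\<lambda>y. b i (\<nu> i) (y $ i)) has_derivative (\<lambda>h. h $ i * b i (Suc (\<nu> i)) (y $ i))) (at y)" for i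
  proof -
    have "((\<lambda>y. b i (\<nu> i) (y $ i)) has_derivative (\<lambda>h. b i (Suc (\<nu> i)) (y $ i) * (h $ i))) (at y)"
      by (rule has_derivative_compose[where g = "b i (\<nu> i)"])
         (use b in \<open>auto simp: has_field_derivative_def intro: bounded_linear_imp_has_derivative bounded_linear_vec_nth\<close>)
    then show ?thesis by (simp add: mult.commute)
  qed
  have eq: "bump_product t e \<mu> y = (\<Prod>i\<in>UNIV. b i (\<mu> i) (y $ i))" for \<mu> y
    by (simp add: bump_product_def b_def)
  have "((\<lambda>y. \<Prod>i\<in>UNIV. b i (\<nu> i) (y $ i)) has_derivative
      (\<lambda>h. \<Sum>i\<in>UNIV. h $ i * b i (Suc (\<nu> i)) (y $ i) * (\<Prod>j\<in>UNIV - {i}. b j (\<nu> j) (y $ j)))) (at y)"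
    by (rule has_derivative_prod) (rule comp)
  moreover have "h $ i * b i (Suc (\<nu> i)) (y $ i) * (\<Prod>j\<in>UNIV - {i}. b j (\<nu> j) (y $ j))
      = h $ i * bump_product t e (\<nu>(i := Suc (\<nu> i))) y" for h :: "real^'n" and i
    unfolding eq by (subst (2) prod.remove[of _ i]) auto
  ultimately show ?thesis
    by (simp add: eq[abs_def])
qed

lemma mollifier_has_derivative:
  assumes "0 < t"
  shows "(mollifier t e \<nu> has_derivative
     (\<lambda>h. \<Sum>i\<in>UNIV. h $ i * mollifier t e (\<nu>(i := Suc (\<nu> i))) y)) (at y)"
proof -
  have "((\<lambda>y. bump_product t e \<nu> y / integral\<^sup>L lborel (bump_product t e (\<lambda>_. 0))) has_derivative
      (\<lambda>h. (\<Sum>i\<in>UNIV. h $ i * bump_product t e (\<nu>(i := Suc (\<nu> i))) y) /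
        integral\<^sup>L lborel (bump_product t e (\<lambda>_. 0)))) (at y)"
    by (rule bounded_linear.has_derivative[OF bounded_linear_divide bump_product_has_derivative[OF assms]])
  then show ?thesis
    by (simp add: mollifier_def[abs_def] sum_divide_distrib)
qed

lemma continuous_on_mollifier: "0 < t \<Longrightarrow> continuous_on A (mollifier t e \<nu>)"
  by (meson mollifier_has_derivative has_derivative_continuous continuous_at_imp_continuous_on)

lemma borel_measurable_mollifier [measurable]:
  assumes "0 < t" shows "mollifier t e \<nu> \<in> borel_measurable borel"
  using assms by (intro borel_measurable_continuous_onI continuous_on_mollifier)

lemma bump_product_nonzeroD:
  assumes "0 < t" "bump_product t e \<nu> y \<noteq> 0"
  shows "\<bar>y $ i - t * e $ i\<bar> \<le> t"
proof -
  have "bump (\<nu> i) (y $ i / t - e $ i) \<noteq> 0"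
    using assms by (auto simp: bump_product_def)
  then have "\<bar>y $ i / t - e $ i\<bar> < 1"
    using bump_eq_0 by (meson not_less)
  moreover have "y $ i - t * e $ i = t * (y $ i / t - e $ i)"
    using assms by (simp add: field_simps)
  ultimately show ?thesis
    using assms by (simp add: abs_mult)
qed

lemma bump_product_support:
  fixes y :: "real^'n::finite"
  assumes "0 < t" "bump_product t e \<nu> y \<noteq> 0"
  shows "norm (y - t *\<^sub>R e) \<le> t * real CARD('n)"
proof -
  have "\<bar>(y - t *\<^sub>R e) $ i\<bar> \<le> t" for i
    using bump_product_nonzeroD[OF assms] by simp
  then have "(\<Sum>i\<in>UNIV. \<bar>(y - t *\<^sub>R e) $ i\<bar>) \<le> real CARD('n) * t"
    using sum_bounded_above[of "UNIV :: 'n set" "\<lambda>i. \<bar>(y - t *\<^sub>R e) $ i\<bar>" t] by simp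
  then show ?thesis
    using norm_le_l1_cart[of "y - t *\<^sub>R e"] by (simp add: mult.commute)
qed

lemma mollifier_support:
  fixes y :: "real^'n::finite"
  assumes "0 < t" "mollifier t e \<nu> y \<noteq> 0"
  shows "norm (y - t *\<^sub>R e) \<le> t * real CARD('n)"
  using assms by (intro bump_product_support) (auto simp: mollifier_def)

lemma mollifier_bounded:
  assumes "0 < t" shows "\<exists>B. \<forall>y. \<bar>mollifier t e \<nu> y\<bar> \<le> B"
proof -
  obtain C where C: "\<And>k x. \<bar>bump k x\<bar> \<le> C k"
    using bump_bounded by metis
  have "\<bar>bump_product t e \<nu> y\<bar> \<le> (\<Prod>i\<in>UNIV. C (\<nu> i) / t ^ \<nu> i)" for y
    unfolding bump_product_def abs_prod
    using assms by (intro prod_mono) (auto simp: C divide_right_mono)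
  then have "\<bar>mollifier t e \<nu> y\<bar> \<le> (\<Prod>i\<in>UNIV. C (\<nu> i) / t ^ \<nu> i) / \<bar>integral\<^sup>L lborel (bump_product t e (\<lambda>_. 0))\<bar>" for y
    by (simp add: mollifier_def divide_right_mono)
  then show ?thesis by blast
qed

lemma bump_product_nonneg: "0 < t \<Longrightarrow> 0 \<le> bump_product t e (\<lambda>_. 0) y"
  by (auto simp: bump_product_def bump_0_nonneg intro!: prod_nonneg)

lemma integrable_continuous_bounded_support:
  fixes f :: "'a::euclidean_space \<Rightarrow> real"
  assumes "continuous_on UNIV f" "\<And>x. f x \<noteq> 0 \<Longrightarrow> norm (x - a) \<le> r"
  shows "integrable lborel f"
proof -
  have "integrable lborel (\<lambda>x. indicator (cball a r) x *\<^sub>R f x)"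
    using borel_integrable_compact[OF compact_cball continuous_on_subset[OF assms(1) subset_UNIV]]
    by simp
  moreover have "(\<lambda>x. indicator (cball a r) x *\<^sub>R f x) = f"
    using assms(2) by (force simp: indicator_def dist_norm norm_minus_commute)
  ultimately show ?thesis by simp
qed

text \<open>The bump is continuous and positive on a ball, so its mass, by which mollifiers are normalised,
  is not zero.\<close>

lemma bump_product_mass_pos:
  fixes e :: "real^'n::finite"
  assumes "0 < t"
  shows "integrable lborel (bump_product t e (\<lambda>_. 0))" "0 < integral\<^sup>L lborel (bump_product t e (\<lambda>_. 0))"
proof -
  let ?f = "bump_product t e (\<lambda>_. 0)"
  have cont: "continuous_on UNIV ?f"
    by (meson assms bump_product_has_derivative has_derivative_continuous continuous_at_imp_continuous_on)
  show int: "integrable lborel ?f"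
    by (rule integrable_continuous_bounded_support[OF cont bump_product_support[OF assms]])
  show "0 < integral\<^sup>L lborel ?f"
  proof (rule ccontr)
    assume "\<not> 0 < integral\<^sup>L lborel ?f"
    moreover have "0 \<le> integral\<^sup>L lborel ?f"
      using assms by (simp add: bump_product_nonneg)
    ultimately have "AE y in lborel. ?f y = 0"
      using integral_nonneg_eq_0_iff_AE[OF int] bump_product_nonneg[OF assms] by auto
    moreover have "?f y \<noteq> 0" if "y \<in> ball (t *\<^sub>R e) t" for y
    proof -
      have "bump 0 (y $ i / t - e $ i) > 0" for i
      proof (rule bump_0_pos)
        have "\<bar>(y - t *\<^sub>R e) $ i\<bar> < t"
          using component_le_norm_cart[of "y - t *\<^sub>R e" i] that by (simp add: dist_norm norm_minus_commute)
        moreover have "(y - t *\<^sub>R e) $ i = t * (y $ i / t - e $ i)"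
          using assms by (simp add: field_simps)
        ultimately show "\<bar>y $ i / t - e $ i\<bar> < 1"
          using assms by (simp add: abs_mult)
      qed
      then show ?thesis by (simp add: bump_product_def less_imp_neq[symmetric])
    qed
    ultimately have "AE y in lborel. y \<notin> ball (t *\<^sub>R e) t"
      by (auto elim: eventually_mono)
    then have "emeasure lborel (ball (t *\<^sub>R e) t) = 0"
      by (subst (asm) AE_iff_measurable[OF _ refl]) (auto simp: ball_def)
    then have "negligible (ball (t *\<^sub>R e) t)"
      by (simp add: negligible_iff_emeasure0)
    then show False
      using assms using open_not_negligible[of "ball (t *\<^sub>R e) t"] by simp
  qed
qed

lemma mollifier_nonneg: "0 < t \<Longrightarrow> 0 \<le> mollifier t e (\<lambda>_. 0) y"
  using bump_product_mass_pos(2)[of t e] by (simp add: mollifier_def bump_product_nonneg)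

lemma integral_mollifier: "0 < t \<Longrightarrow> integral\<^sup>L lborel (mollifier t e (\<lambda>_. 0)) = 1"
  using bump_product_mass_pos[of t e] by (simp add: mollifier_def[abs_def])

lemma integrable_mollifier: "0 < t \<Longrightarrow> integrable lborel (mollifier t e \<nu>)"
  by (rule integrable_continuous_bounded_support[OF continuous_on_mollifier mollifier_support])

section \<open>Mollification converges in \<open>L\<^sup>p\<close>\<close>

text \<open>The \<open>p\<close>-th power of the \<open>L\<^sup>p\<close> norm on the whole space. As an extended nonnegative number it
  needs no integrability side conditions; functions on a subset are extended by \<open>0\<close>.\<close>

definition Lp_int :: "real \<Rightarrow> ('a::euclidean_space \<Rightarrow> real) \<Rightarrow> ennreal" where
  "Lp_int p f = (\<integral>\<^sup>+x. ennreal (\<bar>f x\<bar> powr p) \<partial>lborel)"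

text \<open>Convexity of the power function, obtained from Young's inequality
  \<open>a\<^sup>1\<^sup>/\<^sup>p b\<^sup>1\<^sup>-\<^sup>1\<^sup>/\<^sup>p \<le> a / p + (1 - 1 / p) b\<close> for \<open>a = x\<^sup>p\<close> and \<open>b = c\<^sup>p\<close>.\<close>

lemma powr_above_tangent:
  fixes p c x :: real
  assumes "1 \<le> p" "0 < c" "0 \<le> x"
  shows "c powr p + p * c powr (p - 1) * (x - c) \<le> x powr p"
proof (cases "x = 0")
  case True
  have "c powr p = c powr (p - 1) * c"
    using assms by (simp add: powr_mult_base powr_diff)
  then show ?thesis
    using True assms by (simp add: algebra_simps)
next
  case False
  then have x: "0 < x" using assms by simp
  have "(x powr p) powr (1 / p) * (c powr p) powr (1 - 1 / p) \<le> 1 / p * (x powr p) + (1 - 1 / p) * (c powr p)"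
    using assms x by (intro Youngs_inequality_0) auto
  moreover have "(x powr p) powr (1 / p) * (c powr p) powr (1 - 1 / p) = x * c powr (p - 1)"
    using assms x by (simp add: powr_powr right_diff_distrib)
  ultimately have "x * c powr (p - 1) \<le> 1 / p * (x powr p) + (1 - 1 / p) * (c powr p)"
    by simp
  from mult_left_mono[OF this, of p]
  have "p * (x * c powr (p - 1)) \<le> x powr p + (p - 1) * (c powr p)"
    using assms by (simp add: distrib_left right_diff_distrib left_diff_distrib)
  moreover have "c powr p = c powr (p - 1) * c"
    using assms by (simp add: powr_diff)
  ultimately show ?thesis
    by (simp add: algebra_simps)
qed

text \<open>Jensen's inequality for the probability density \<open>k\<close>: integrate the tangent inequality at the
  point \<open>c = \<bar>\<integral> g k\<bar>\<close>. If \<open>g k\<close> is not integrable, then the left-hand side is \<open>0\<close> by the convention for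
  undefined integrals.\<close>

lemma Jensen_powr_weighted:
  fixes g k :: "'a \<Rightarrow> real"
  assumes p: "1 \<le> p" and [measurable]: "g \<in> borel_measurable M" "k \<in> borel_measurable M"
    and k: "\<And>y. 0 \<le> k y" "integrable M k" "integral\<^sup>L M k = 1"
  shows "ennreal (\<bar>\<integral>y. g y * k y \<partial>M\<bar> powr p) \<le> (\<integral>\<^sup>+y. ennreal (\<bar>g y\<bar> powr p) * ennreal (k y) \<partial>M)"
proof -
  define c where "c = \<bar>\<integral>y. g y * k y \<partial>M\<bar>"
  have eq: "(\<integral>\<^sup>+y. ennreal (\<bar>g y\<bar> powr p) * ennreal (k y) \<partial>M) = (\<integral>\<^sup>+y. ennreal (\<bar>g y\<bar> powr p * k y) \<partial>M)"
    using k by (simp add: ennreal_mult)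
  show ?thesis
  proof (cases "c = 0 \<or> (\<integral>\<^sup>+y. ennreal (\<bar>g y\<bar> powr p * k y) \<partial>M) = \<infinity>")
    case True
    then show ?thesis by (auto simp: eq c_def)
  next
    case False
    then have c: "0 < c" and fin: "(\<integral>\<^sup>+y. ennreal (\<bar>g y\<bar> powr p * k y) \<partial>M) < \<infinity>"
      by (auto simp: c_def less_top)
    have int_p: "integrable M (\<lambda>y. \<bar>g y\<bar> powr p * k y)"
      by (rule integrableI_bounded) (use fin k in auto)
    have int: "integrable M (\<lambda>y. g y * k y)"
      using c not_integrable_integral_eq by (force simp: c_def)
    then have int': "integrable M (\<lambda>y. \<bar>g y\<bar> * k y)"
      using integrable_abs[OF int] k by (simp add: abs_mult)
    have "c \<le> (\<integral>y. \<bar>g y\<bar> * k y \<partial>M)"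
      using integral_abs_bound[of M "\<lambda>y. g y * k y"] k by (simp add: c_def abs_mult)
    then have "c powr p \<le> c powr p + p * c powr (p - 1) * ((\<integral>y. \<bar>g y\<bar> * k y \<partial>M) - c)"
      using p c by simp
    also have "\<dots> = (\<integral>y. c powr p * k y + p * c powr (p - 1) * (\<bar>g y\<bar> * k y - c * k y) \<partial>M)"
      using int' k by simp
    also have "\<dots> \<le> (\<integral>y. \<bar>g y\<bar> powr p * k y \<partial>M)"
    proof (rule integral_mono)
      show "integrable M (\<lambda>y. c powr p * k y + p * c powr (p - 1) * (\<bar>g y\<bar> * k y - c * k y))"
        using int' k by simp
      show "c powr p * k y + p * c powr (p - 1) * (\<bar>g y\<bar> * k y - c * k y) \<le> \<bar>g y\<bar> powr p * k y" for y
        using mult_right_mono[OF powr_above_tangent[OF p c, of "\<bar>g y\<bar>"] k(1)[of y]]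
        by (simp add: algebra_simps)
    qed (rule int_p)
    finally have "ennreal (c powr p) \<le> ennreal (\<integral>y. \<bar>g y\<bar> powr p * k y \<partial>M)"
      by (rule ennreal_leI)
    also have "\<dots> = (\<integral>\<^sup>+y. ennreal (\<bar>g y\<bar> powr p * k y) \<partial>M)"
      using k by (intro nn_integral_eq_integral[symmetric] int_p) auto
    finally show ?thesis
      by (simp add: eq c_def)
  qed
qed

lemma nn_integral_lborel_translate:
  fixes f :: "'a::euclidean_space \<Rightarrow> ennreal"
  assumes [measurable]: "f \<in> borel_measurable borel"
  shows "(\<integral>\<^sup>+x. f (x + y) \<partial>lborel) = (\<integral>\<^sup>+x. f x \<partial>lborel)"
proof -
  have "(\<integral>\<^sup>+x. f x \<partial>lborel) = (\<integral>\<^sup>+x. f x \<partial>distr lborel borel ((+) y))"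
    by (simp add: lborel_distr_plus)
  also have "\<dots> = (\<integral>\<^sup>+x. f (x + y) \<partial>lborel)"
    by (subst nn_integral_distr) (auto simp: add.commute)
  finally show ?thesis by simp
qed

lemma integrable_lborel_translate:
  fixes f :: "'a::euclidean_space \<Rightarrow> real"
  assumes "integrable lborel f"
  shows "integrable lborel (\<lambda>x. f (x + y))" "(\<integral>x. f (x + y) \<partial>lborel) = (\<integral>x. f x \<partial>lborel)"
proof -
  have [measurable]: "f \<in> borel_measurable borel"
    using assms by auto
  have "integrable (distr lborel borel ((+) y)) f"
    using assms by (simp add: lborel_distr_plus)
  then show "integrable lborel (\<lambda>x. f (x + y))"
    by (subst (asm) integrable_distr_eq) (auto simp: add.commute)
  have "(\<integral>x. f x \<partial>lborel) = (\<integral>x. f x \<partial>distr lborel borel ((+) y))"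
    by (simp add: lborel_distr_plus)
  also have "\<dots> = (\<integral>x. f (x + y) \<partial>lborel)"
    by (subst integral_distr) (auto simp: add.commute)
  finally show "(\<integral>x. f (x + y) \<partial>lborel) = (\<integral>x. f x \<partial>lborel)" by simp
qed

text \<open>Averaging translates of \<open>f\<close> does not increase the norm: Jensen's inequality, Tonelli's theorem
  and the translation invariance of Lebesgue measure.\<close>

lemma Lp_int_mollify_le:
  fixes f k :: "'a::euclidean_space \<Rightarrow> real"
  assumes p: "1 \<le> p" and [measurable]: "f \<in> borel_measurable borel" "k \<in> borel_measurable borel"
    and k: "\<And>y. 0 \<le> k y" "integrable lborel k" "integral\<^sup>L lborel k = 1"
  shows "Lp_int p (\<lambda>x. \<integral>y. f (x + y) * k y \<partial>lborel) \<le> Lp_int p f"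
proof -
  have "Lp_int p (\<lambda>x. \<integral>y. f (x + y) * k y \<partial>lborel)
      \<le> (\<integral>\<^sup>+x. \<integral>\<^sup>+y. ennreal (\<bar>f (x + y)\<bar> powr p) * ennreal (k y) \<partial>lborel \<partial>lborel)"
    unfolding Lp_int_def by (intro nn_integral_mono Jensen_powr_weighted p k) auto
  also have "\<dots> = (\<integral>\<^sup>+y. \<integral>\<^sup>+x. ennreal (\<bar>f (x + y)\<bar> powr p) * ennreal (k y) \<partial>lborel \<partial>lborel)"
    by (rule lborel_pair.Fubini') measurable
  also have "\<dots> = (\<integral>\<^sup>+y. Lp_int p f * ennreal (k y) \<partial>lborel)"
    using nn_integral_lborel_translate[of "\<lambda>x. ennreal (\<bar>f x\<bar> powr p)"]
    by (simp add: nn_integral_multc Lp_int_def)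
  also have "\<dots> = Lp_int p f * ennreal (integral\<^sup>L lborel k)"
    using k by (simp add: nn_integral_cmult nn_integral_eq_integral)
  finally show ?thesis
    using k by simp
qed

lemma abs_add_powr_le:
  fixes a b :: real
  assumes "1 \<le> p"
  shows "\<bar>a + b\<bar> powr p \<le> 2 powr p * (\<bar>a\<bar> powr p + \<bar>b\<bar> powr p)"
proof -
  have "\<bar>a + b\<bar> powr p \<le> (2 * max \<bar>a\<bar> \<bar>b\<bar>) powr p"
    using assms by (intro powr_mono2) auto
  also have "\<dots> = 2 powr p * max \<bar>a\<bar> \<bar>b\<bar> powr p"
    by (simp add: powr_mult)
  also have "\<dots> \<le> 2 powr p * (\<bar>a\<bar> powr p + \<bar>b\<bar> powr p)"
    by (intro mult_left_mono) (auto simp: max_def)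
  finally show ?thesis .
qed

lemma Lp_int_add_le:
  fixes f g :: "'a::euclidean_space \<Rightarrow> real"
  assumes "1 \<le> p" and [measurable]: "f \<in> borel_measurable borel" "g \<in> borel_measurable borel"
  shows "Lp_int p (\<lambda>x. f x + g x) \<le> ennreal (2 powr p) * (Lp_int p f + Lp_int p g)"
proof -
  have "Lp_int p (\<lambda>x. f x + g x)
     \<le> (\<integral>\<^sup>+x. ennreal (2 powr p) * (ennreal (\<bar>f x\<bar> powr p) + ennreal (\<bar>g x\<bar> powr p)) \<partial>lborel)"
    unfolding Lp_int_def
    using abs_add_powr_le[OF assms(1)]
    by (intro nn_integral_mono)
       (auto simp flip: ennreal_plus ennreal_mult intro!: ennreal_leI)
  also have "\<dots> = ennreal (2 powr p) * (Lp_int p f + Lp_int p g)"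
    by (simp add: nn_integral_cmult nn_integral_add Lp_int_def)
  finally show ?thesis .
qed

lemma Lp_int_mult_le:
  fixes f g :: "'a::euclidean_space \<Rightarrow> real"
  assumes "0 \<le> p" and [measurable]: "f \<in> borel_measurable borel" and "\<And>x. \<bar>g x\<bar> \<le> B * \<bar>f x\<bar>" "0 \<le> B"
  shows "Lp_int p g \<le> ennreal (B powr p) * Lp_int p f"
proof -
  have "Lp_int p g \<le> (\<integral>\<^sup>+x. ennreal (B powr p) * ennreal (\<bar>f x\<bar> powr p) \<partial>lborel)"
    unfolding Lp_int_def
  proof (intro nn_integral_mono)
    fix x
    have "\<bar>g x\<bar> powr p \<le> (B * \<bar>f x\<bar>) powr p"
      using assms by (intro powr_mono2) auto
    then show "ennreal (\<bar>g x\<bar> powr p) \<le> ennreal (B powr p) * ennreal (\<bar>f x\<bar> powr p)"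
      using assms by (simp add: powr_mult ennreal_leI flip: ennreal_mult)
  qed
  also have "\<dots> = ennreal (B powr p) * Lp_int p f"
    by (simp add: nn_integral_cmult Lp_int_def)
  finally show ?thesis .
qed

lemma Lp_int_dominated_tendsto_0:
  fixes f :: "nat \<Rightarrow> 'a::euclidean_space \<Rightarrow> real"
  assumes p: "1 \<le> p" and [measurable]: "\<And>k. f k \<in> borel_measurable borel" "w \<in> borel_measurable borel"
    and bound: "\<And>k x. \<bar>f k x\<bar> \<le> w x" and fin: "Lp_int p w < \<infinity>"
    and lim: "AE x in lborel. (\<lambda>k. f k x) \<longlonglongrightarrow> 0"
  shows "(\<lambda>k. Lp_int p (f k)) \<longlonglongrightarrow> 0"
proof -
  have "(\<lambda>k. \<integral>\<^sup>+x. ennreal (\<bar>f k x\<bar> powr p) \<partial>lborel) \<longlonglongrightarrow> (\<integral>\<^sup>+x. 0 \<partial>(lborel :: 'a measure))"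
  proof (rule nn_integral_dominated_convergence[where w = "\<lambda>x. ennreal (\<bar>w x\<bar> powr p)"])
    show "AE x in lborel. ennreal (\<bar>f k x\<bar> powr p) \<le> ennreal (\<bar>w x\<bar> powr p)" for k
      using p bound[of k] by (intro AE_I2 ennreal_leI powr_mono2) (auto intro: order_trans[OF _ abs_ge_self])
    show "AE x in lborel. (\<lambda>k. ennreal (\<bar>f k x\<bar> powr p)) \<longlonglongrightarrow> 0"
      using lim
    proof (rule AE_mp, intro AE_I2 impI)
      fix x assume "(\<lambda>k. f k x) \<longlonglongrightarrow> 0"
      then have "(\<lambda>k. \<bar>f k x\<bar>) \<longlonglongrightarrow> 0"
        by (rule tendsto_rabs_zero)
      then have "(\<lambda>k. \<bar>f k x\<bar> powr p) \<longlonglongrightarrow> 0 powr p"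
        using p by (intro tendsto_powr' tendsto_const) auto
      then show "(\<lambda>k. ennreal (\<bar>f k x\<bar> powr p)) \<longlonglongrightarrow> 0"
        using tendsto_ennrealI[of "\<lambda>k. \<bar>f k x\<bar> powr p" 0] p by simp
    qed
    show "(\<integral>\<^sup>+x. ennreal (\<bar>w x\<bar> powr p) \<partial>lborel) < \<infinity>"
      using fin by (simp add: Lp_int_def)
  qed auto
  then show ?thesis
    by (simp add: Lp_int_def)
qed

lemma Lp_int_bounded_support_finite:
  assumes "0 \<le> p"
  shows "Lp_int p (\<lambda>x. B * indicator (cball (0::'a::euclidean_space) R) x) < \<infinity>"
proof -
  have "Lp_int p (\<lambda>x. B * indicator (cball (0::'a) R) x)
      \<le> (\<integral>\<^sup>+x. ennreal (\<bar>B\<bar> powr p) * indicator (cball (0::'a) R) x \<partial>lborel)"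
    unfolding Lp_int_def by (intro nn_integral_mono) (auto simp: indicator_def)
  also have "\<dots> < \<infinity>"
    using emeasure_compact_finite[OF compact_cball[of "0::'a" R]]
    by (subst nn_integral_cmult_indicator) (auto simp: ennreal_mult_less_top)
  finally show ?thesis .
qed

text \<open>Truncating \<open>f\<close> in height and support costs little by dominated convergence. The truncation is
  the almost everywhere limit of continuous functions, and once these are clipped to the same height
  and multiplied with a continuous cutoff, they converge in \<open>L\<^sup>p\<close> by dominated convergence again.\<close>

lemma continuous_compact_support_dense_Lp:
  fixes f :: "'a::euclidean_space \<Rightarrow> real"
  assumes p: "1 \<le> p" and [measurable]: "f \<in> borel_measurable borel" and fin: "Lp_int p f < \<infinity>" and "0 < \<epsilon>"
  obtains g R where "continuous_on UNIV g" "\<And>x. g x \<noteq> 0 \<Longrightarrow> norm x \<le> R" "Lp_int p (\<lambda>x. f x - g x) < \<epsilon>"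
proof -
  define \<epsilon>' where "\<epsilon>' = \<epsilon> / 2 / ennreal (2 powr p)"
  define F where "F = (\<lambda>(n::nat) x. if \<bar>f x\<bar> \<le> n \<and> norm x \<le> n then f x else 0)"
  have e': "0 < min 1 \<epsilon>'"
    using \<open>0 < \<epsilon>\<close> by (auto simp: \<epsilon>'_def ennreal_zero_less_divide)
  have [measurable]: "F n \<in> borel_measurable borel" for n
    unfolding F_def by measurable
  have "(\<lambda>n. Lp_int p (\<lambda>x. f x - F n x)) \<longlonglongrightarrow> 0"
  proof (rule Lp_int_dominated_tendsto_0[where w = "\<lambda>x. \<bar>f x\<bar>", OF p])
    show "\<bar>f x - F n x\<bar> \<le> \<bar>f x\<bar>" for n x
      by (simp add: F_def)
    show "Lp_int p (\<lambda>x. \<bar>f x\<bar>) < \<infinity>"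
      using fin by (simp add: Lp_int_def)
    show "AE x in lborel. (\<lambda>n. f x - F n x) \<longlonglongrightarrow> 0"
    proof (intro AE_I2)
      fix x
      have "\<forall>\<^sub>F n in sequentially. real n \<ge> max \<bar>f x\<bar> (norm x)"
        using filterlim_real_sequentially unfolding filterlim_at_top by blast
      then have "\<forall>\<^sub>F n in sequentially. 0 = f x - F n x"
        by (rule eventually_mono) (simp add: F_def)
      then show "(\<lambda>n. f x - F n x) \<longlonglongrightarrow> 0"
        by (rule Lim_transform_eventually[OF tendsto_const])
    qed
  qed auto
  from order_tendstoD(2)[OF this e'] obtain N where N: "Lp_int p (\<lambda>x. f x - F N x) < min 1 \<epsilon>'"
    by (auto simp: eventually_sequentially)
  have "F N measurable_on UNIV"
    by (rule lebesgue_measurable_imp_measurable_on_real) (auto intro: measurable_completion)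
  then obtain Z g where Z: "negligible Z" and g: "\<And>n. continuous_on UNIV (g n)"
      "\<And>x. x \<notin> Z \<Longrightarrow> (\<lambda>n. g n x) \<longlonglongrightarrow> F N x"
    by (auto simp: measurable_on_def)
  define G where "G = (\<lambda>n x. max (- real N) (min N (g n x)) * max 0 (min 1 (N + 1 - norm x)))"
  have cont: "continuous_on UNIV (G n)" for n
    unfolding G_def by (intro continuous_intros g)
  have supp: "norm x \<le> N + 1" if "G n x \<noteq> 0" for n x
    using that by (auto simp: G_def)
  have Gb: "\<bar>G n x\<bar> \<le> N" for n x
  proof -
    have "\<bar>G n x\<bar> \<le> real N * 1"
      unfolding G_def abs_mult by (intro mult_mono) auto
    then show ?thesis by simp
  qed
  have [measurable]: "G n \<in> borel_measurable borel" for n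
    by (rule borel_measurable_continuous_onI[OF cont])
  have "(\<lambda>n. Lp_int p (\<lambda>x. F N x - G n x)) \<longlonglongrightarrow> 0"
  proof (rule Lp_int_dominated_tendsto_0[where w = "\<lambda>x. 2 * real N * indicator (cball 0 (real N + 1)) x", OF p])
    show "\<bar>F N x - G n x\<bar> \<le> 2 * real N * indicator (cball 0 (real N + 1)) x" for n x
    proof (cases "norm x \<le> N + 1")
      case True
      then show ?thesis
        using Gb[of n x] by (auto simp: F_def)
    next
      case False
      then have "G n x = 0" "F N x = 0"
        using supp[of n x] by (auto simp: F_def)
      then show ?thesis by simp
    qed
    show "Lp_int p (\<lambda>x. 2 * real N * indicator (cball (0::'a) (real N + 1)) x) < \<infinity>"
      using p by (intro Lp_int_bounded_support_finite) auto
    have "Z \<in> null_sets (completion lborel)"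
      using Z by (simp add: negligible_iff_null_sets)
    then have "AE x in lborel. x \<notin> Z"
      by (metis AE_not_in AE_completion_iff)
    then show "AE x in lborel. (\<lambda>n. F N x - G n x) \<longlonglongrightarrow> 0"
    proof (rule AE_mp, intro AE_I2 impI)
      fix x assume "x \<notin> Z"
      have "(\<lambda>n. F N x - G n x) \<longlonglongrightarrow> F N x - max (- real N) (min N (F N x)) * max 0 (min 1 (N + 1 - norm x))"
        unfolding G_def by (intro tendsto_intros g \<open>x \<notin> Z\<close>)
      moreover have "max (- real N) (min N (F N x)) * max 0 (min 1 (N + 1 - norm x)) = F N x"
        by (auto simp: F_def)
      ultimately show "(\<lambda>n. F N x - G n x) \<longlonglongrightarrow> 0" by simp
    qed
    show "(\<lambda>x. 2 * real N * indicator (cball (0::'a) (real N + 1)) x) \<in> borel_measurable borel"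
      by (intro borel_measurable_times borel_measurable_const borel_measurable_indicator) simp
  qed auto
  from order_tendstoD(2)[OF this e'] obtain n where n: "Lp_int p (\<lambda>x. F N x - G n x) < min 1 \<epsilon>'"
    by (auto simp: eventually_sequentially)
  have "Lp_int p (\<lambda>x. f x - G n x) \<le> ennreal (2 powr p) * (Lp_int p (\<lambda>x. f x - F N x) + Lp_int p (\<lambda>x. F N x - G n x))"
    using Lp_int_add_le[OF p, of "\<lambda>x. f x - F N x" "\<lambda>x. F N x - G n x"] by simp
  also have "\<dots> < ennreal (2 powr p) * (\<epsilon>' + \<epsilon>')"
    using N n by (intro ennreal_mult_strict_left_mono add_strict_mono) auto
  also have "\<dots> = \<epsilon>"
    unfolding \<epsilon>'_def
    by (simp add: ennreal_times_divide ennreal_mult_divide_eq mult.commute flip: mult_2)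
  finally show thesis
    using that[of "G n" "real (N + 1)"] cont supp by blast
qed


lemma convolution_tendsto_pointwise:
  fixes g :: "'a::euclidean_space \<Rightarrow> real" and k :: "nat \<Rightarrow> 'a \<Rightarrow> real"
  assumes cont: "continuous_on UNIV g" and gB: "\<And>x. \<bar>g x\<bar> \<le> B"
    and k: "\<And>n y. 0 \<le> k n y" "\<And>n. integrable lborel (k n)" "\<And>n. integral\<^sup>L lborel (k n) = 1"
    and supp: "\<And>n y. k n y \<noteq> 0 \<Longrightarrow> norm y \<le> r n" and r: "r \<longlonglongrightarrow> 0"
  shows "(\<lambda>n. \<integral>y. g (x + y) * k n y \<partial>lborel) \<longlonglongrightarrow> g x"
proof (rule LIMSEQ_I)
  fix \<epsilon> :: real assume "0 < \<epsilon>"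
  have [measurable]: "g \<in> borel_measurable borel"
    by (rule borel_measurable_continuous_onI[OF cont])
  have [measurable]: "k n \<in> borel_measurable borel" for n
    using k(2)[of n] by auto
  have int: "integrable lborel (\<lambda>y. g (x + y) * k n y)" for n
  proof (rule Bochner_Integration.integrable_bound)
    show "integrable lborel (\<lambda>y. B * k n y)"
      using k by simp
    have "\<bar>g (x + y) * k n y\<bar> \<le> \<bar>B * k n y\<bar>" for y
      using gB[of "x + y"] k(1)[of n y] by (auto simp: abs_mult intro!: mult_right_mono)
    then show "AE y in lborel. norm (g (x + y) * k n y) \<le> norm (B * k n y)"
      by simp
  qed auto
  obtain d where d: "0 < d" "\<And>y. norm (y - x) < d \<Longrightarrow> \<bar>g y - g x\<bar> < \<epsilon> / 2"
    using cont \<open>0 < \<epsilon>\<close> unfolding continuous_on_iff dist_norm real_norm_def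
    by (metis UNIV_I half_gt_zero)
  obtain N where N: "\<And>n. n \<ge> N \<Longrightarrow> r n < d"
    using order_tendstoD(2)[OF r \<open>0 < d\<close>] by (auto simp: eventually_sequentially)
  have "norm ((\<integral>y. g (x + y) * k n y \<partial>lborel) - g x) < \<epsilon>" if "n \<ge> N" for n
  proof -
    have "(\<integral>y. g (x + y) * k n y \<partial>lborel) - g x = (\<integral>y. g (x + y) * k n y - g x * k n y \<partial>lborel)"
      using int k by simp
    also have "\<bar>\<dots>\<bar> \<le> (\<integral>y. \<bar>g (x + y) * k n y - g x * k n y\<bar> \<partial>lborel)"
      by (rule integral_abs_bound)
    also have "\<dots> \<le> (\<integral>y. \<epsilon> / 2 * k n y \<partial>lborel)"
    proof (rule integral_mono)
      fix y
      show "\<bar>g (x + y) * k n y - g x * k n y\<bar> \<le> \<epsilon> / 2 * k n y"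
      proof (cases "k n y = 0")
        case False
        then have "norm ((x + y) - x) < d"
          using supp N[OF that] by fastforce
        from d(2)[OF this] have "\<bar>g (x + y) - g x\<bar> * k n y \<le> \<epsilon> / 2 * k n y"
          using k(1) by (intro mult_right_mono) auto
        then show ?thesis
          using k(1)[of n y] by (simp add: abs_mult flip: left_diff_distrib)
      qed simp
    qed (use int k in auto)
    also have "\<dots> = \<epsilon> / 2"
      using k by simp
    finally show ?thesis
      using \<open>0 < \<epsilon>\<close> by simp
  qed
  then show "\<exists>N. \<forall>n\<ge>N. norm ((\<integral>y. g (x + y) * k n y \<partial>lborel) - g x) < \<epsilon>"
    by blast
qed

text \<open>Convolutions with \<open>k n\<close> contract the norm, uniformly in \<open>n\<close>, so it suffices to
  consider a dense set of functions; for continuous functions with compact support the convergence is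
  pointwise and dominated.\<close>

lemma approximate_identity_tendsto_Lp:
  fixes f :: "'a::euclidean_space \<Rightarrow> real" and k :: "nat \<Rightarrow> 'a \<Rightarrow> real"
  assumes p: "1 \<le> p" and f: "integrable lborel f" "Lp_int p f < \<infinity>"
    and k: "\<And>n y. 0 \<le> k n y" "\<And>n. integrable lborel (k n)" "\<And>n. integral\<^sup>L lborel (k n) = 1"
    and kB: "\<And>n y. k n y \<le> C n"
    and supp: "\<And>n y. k n y \<noteq> 0 \<Longrightarrow> norm y \<le> r n" and r: "r \<longlonglongrightarrow> 0"
  shows "(\<lambda>n. Lp_int p (\<lambda>x. (\<integral>y. f (x + y) * k n y \<partial>lborel) - f x)) \<longlonglongrightarrow> 0"
proof -
  define J where "J = (\<lambda>n f x. \<integral>y. f (x + y) * k n y \<partial>lborel)"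
  have [measurable]: "f \<in> borel_measurable borel"
    using f by auto
  have [measurable]: "k n \<in> borel_measurable borel" for n
    using k(2)[of n] by auto
  have [measurable]: "J n h \<in> borel_measurable borel" if [measurable]: "h \<in> borel_measurable borel" for n h
    unfolding J_def by measurable
  have int: "integrable lborel (\<lambda>y. h (x + y) * k n y)" if h: "integrable lborel h" for n h x
  proof (rule Bochner_Integration.integrable_bound)
    have [measurable]: "h \<in> borel_measurable borel"
      using h by auto
    show "integrable lborel (\<lambda>y. C n * h (y + x))"
      using integrable_lborel_translate(1)[OF h] by simp
    have "\<bar>h (x + y) * k n y\<bar> \<le> \<bar>C n * h (y + x)\<bar>" for y
      using kB[of n y] k(1)[of n y] by (auto simp: abs_mult add.commute mult.commute intro!: mult_right_mono)
    then show "AE y in lborel. norm (h (x + y) * k n y) \<le> norm (C n * h (y + x))"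
      by simp
    show "(\<lambda>y. h (x + y) * k n y) \<in> borel_measurable lborel"
      by measurable
  qed
  obtain R where R: "\<And>n. \<bar>r n\<bar> \<le> R"
    using convergent_imp_Bseq[OF convergentI[OF r]] by (auto simp: Bseq_def)
  show ?thesis
  proof (rule tendsto_zero_ennreal)
    fix \<delta> :: real assume "0 < \<delta>"
    define c where "c = ennreal (2 powr p)"
    \<comment> \<open>Two applications of the quasi-triangle inequality to three errors below \<open>\<epsilon>\<close> give less than
      \<open>c (2 c \<epsilon> + 2 c \<epsilon>) = \<delta>\<close>.\<close>
    define \<epsilon> where "\<epsilon> = ennreal \<delta> / 4 / (c * c)"
    have c: "c \<noteq> 0" "0 < c" "c < top"
      by (auto simp: c_def)
    have \<epsilon>: "0 < \<epsilon>"
      using \<open>0 < \<delta>\<close> c by (auto simp: \<epsilon>_def ennreal_zero_less_divide ennreal_mult_eq_top_iff ennreal_mult_less_top)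
    obtain g S where g: "continuous_on UNIV g" "\<And>x. g x \<noteq> 0 \<Longrightarrow> norm x \<le> S"
        and fg: "Lp_int p (\<lambda>x. f x - g x) < \<epsilon>"
      using continuous_compact_support_dense_Lp[OF p _ f(2) \<epsilon>] by auto
    have [measurable]: "g \<in> borel_measurable borel"
      by (rule borel_measurable_continuous_onI[OF g(1)])
    have int_g: "integrable lborel g"
      using g by (intro integrable_continuous_bounded_support[of g 0 S]) auto
    have "compact (g ` cball 0 S)"
      by (intro compact_continuous_image continuous_on_subset[OF g(1)]) auto
    then obtain B where B: "\<And>x. x \<in> cball 0 S \<Longrightarrow> \<bar>g x\<bar> \<le> B"
      using compact_imp_bounded[of "g ` cball 0 S"] unfolding bounded_iff by (metis imageI real_norm_def)
    have gB: "\<bar>g x\<bar> \<le> \<bar>B\<bar>" for x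
      using B[of x] g(2)[of x] by (cases "g x = 0") auto
    have JB: "\<bar>J n g x\<bar> \<le> \<bar>B\<bar>" for n x
    proof -
      have "\<bar>J n g x\<bar> \<le> (\<integral>y. \<bar>g (x + y) * k n y\<bar> \<partial>lborel)"
        unfolding J_def by (rule integral_abs_bound)
      also have "\<dots> \<le> (\<integral>y. \<bar>B\<bar> * k n y \<partial>lborel)"
        using k gB
        by (intro integral_mono integrable_abs int[OF int_g]) (auto simp: abs_mult intro!: mult_right_mono)
      finally show ?thesis using k by simp
    qed
    have J0: "J n g x = 0" if "S + R < norm x" for n x
    proof -
      have "g (x + y) * k n y = 0" for y
      proof (rule ccontr)
        assume "g (x + y) * k n y \<noteq> 0"
        then have "norm (x + y) \<le> S" "norm y \<le> r n"
          using g(2) supp by auto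
        then show False
          using that R[of n] norm_triangle_ineq4[of "x + y" y] by simp
      qed
      then have "(\<lambda>y. g (x + y) * k n y) = (\<lambda>y. 0)"
        by (intro ext)
      then show ?thesis by (simp only: J_def integral_zero)
    qed
    have "(\<lambda>n. Lp_int p (\<lambda>x. J n g x - g x)) \<longlonglongrightarrow> 0"
    proof (rule Lp_int_dominated_tendsto_0[where w = "\<lambda>x. 2 * \<bar>B\<bar> * indicator (cball 0 (S + R)) x", OF p])
      show "\<bar>J n g x - g x\<bar> \<le> 2 * \<bar>B\<bar> * indicator (cball 0 (S + R)) x" for n x
      proof (cases "norm x \<le> S + R")
        case True
        then show ?thesis
          using JB[of n x] gB[of x] by auto
      next
        case False
        then have "g x = 0"
          using g(2)[of x] R[of n] by force
        then show ?thesis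
          using J0[of x n] False by simp
      qed
      show "Lp_int p (\<lambda>x. 2 * \<bar>B\<bar> * indicator (cball (0::'a) (S + R)) x) < \<infinity>"
        using p by (intro Lp_int_bounded_support_finite) auto
      show "(\<lambda>x. 2 * \<bar>B\<bar> * indicator (cball (0::'a) (S + R)) x) \<in> borel_measurable borel"
        by (intro borel_measurable_times borel_measurable_const borel_measurable_indicator) simp
      show "AE x in lborel. (\<lambda>n. J n g x - g x) \<longlonglongrightarrow> 0"
        using convolution_tendsto_pointwise[OF g(1) gB k supp r]
        by (intro AE_I2) (simp add: J_def LIM_zero)
    qed auto
    from order_tendstoD(2)[OF this \<epsilon>]
    have "\<forall>\<^sub>F n in sequentially. Lp_int p (\<lambda>x. J n g x - g x) < \<epsilon>" .
    then show "\<forall>\<^sub>F n in sequentially. Lp_int p (\<lambda>x. (\<integral>y. f (x + y) * k n y \<partial>lborel) - f x) < ennreal \<delta>"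
    proof (rule eventually_mono)
      fix n assume n: "Lp_int p (\<lambda>x. J n g x - g x) < \<epsilon>"
      have diff: "J n (\<lambda>x. f x - g x) = (\<lambda>x. J n f x - J n g x)"
        unfolding J_def using int[OF f(1)] int[OF int_g] by (simp add: left_diff_distrib)
      have "Lp_int p (J n (\<lambda>x. f x - g x)) \<le> Lp_int p (\<lambda>x. f x - g x)"
        unfolding J_def by (intro Lp_int_mollify_le p k) measurable
      then have 1: "Lp_int p (\<lambda>x. J n f x - J n g x) < \<epsilon>"
        using fg by (simp add: diff)
      have swap: "Lp_int p (\<lambda>x. g x - f x) = Lp_int p (\<lambda>x. f x - g x)"
        by (simp add: Lp_int_def abs_minus_commute)
      have "Lp_int p (\<lambda>x. J n g x - f x) \<le> c * (Lp_int p (\<lambda>x. J n g x - g x) + Lp_int p (\<lambda>x. g x - f x))"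
        using Lp_int_add_le[OF p, of "\<lambda>x. J n g x - g x" "\<lambda>x. g x - f x"] by (simp add: c_def)
      also have "\<dots> < c * (\<epsilon> + \<epsilon>)"
        using n fg c by (intro ennreal_mult_strict_left_mono add_strict_mono) (auto simp: swap)
      finally have 2: "Lp_int p (\<lambda>x. J n g x - f x) < c * (\<epsilon> + \<epsilon>)" .
      have "1 \<le> c"
        using p by (auto simp: c_def ge_one_powr_ge_zero)
      then have "\<epsilon> \<le> c * (\<epsilon> + \<epsilon>)"
        using mult_mono[of 1 c \<epsilon> "\<epsilon> + \<epsilon>"] by simp
      with 1 have 3: "Lp_int p (\<lambda>x. J n f x - J n g x) < c * (\<epsilon> + \<epsilon>)"
        by simp
      have "Lp_int p (\<lambda>x. J n f x - f x) \<le> c * (Lp_int p (\<lambda>x. J n f x - J n g x) + Lp_int p (\<lambda>x. J n g x - f x))"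
        using Lp_int_add_le[OF p, of "\<lambda>x. J n f x - J n g x" "\<lambda>x. J n g x - f x"] by (simp add: c_def)
      also have "\<dots> < c * (c * (\<epsilon> + \<epsilon>) + c * (\<epsilon> + \<epsilon>))"
        using 2 3 c by (intro ennreal_mult_strict_left_mono add_strict_mono) auto
      also have "\<dots> = 4 * (c * c) * \<epsilon>"
        by (simp add: algebra_simps mult_2 flip: mult_2)
      also have "\<dots> = ennreal \<delta>"
        unfolding \<epsilon>_def c_def using \<open>0 < \<delta>\<close>
        by (simp add: divide_ennreal ennreal_mult[symmetric] ennreal_numeral[symmetric] del: ennreal_numeral)
      finally show "Lp_int p (\<lambda>x. (\<integral>y. f (x + y) * k n y \<partial>lborel) - f x) < ennreal \<delta>"
        by (simp add: J_def)
    qed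
  qed
qed

section \<open>Calculus of iterated partial derivatives\<close>

lemma partial_deriv_eqI:
  "(f has_derivative f') (at x) \<Longrightarrow> partial_deriv i f x = f' (axis i 1)"
  unfolding partial_deriv_def using frechet_derivative_at[of f f' x] by simp

lemma iterated_partial_append:
  "iterated_partial (is @ js) f = iterated_partial is (iterated_partial js f)"
  by (induction "is") auto

lemma smooth_on_iterated_partial: "smooth_on U f \<Longrightarrow> smooth_on U (iterated_partial js f)"
  by (simp add: smooth_on_def flip: iterated_partial_append)

lemma smooth_onD: "smooth_on U f \<Longrightarrow> x \<in> U \<Longrightarrow> iterated_partial js f differentiable (at x)"
  by (simp add: smooth_on_def)

lemma continuous_on_iterated_partial: "smooth_on UNIV f \<Longrightarrow> continuous_on A (iterated_partial js f)"
  by (meson UNIV_I smooth_onD differentiable_imp_continuous_within continuous_at_imp_continuous_on)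

lemma smooth_on_UNIV_imp_continuous_on: "smooth_on UNIV f \<Longrightarrow> continuous_on A f"
  using continuous_on_iterated_partial[of f A "[]"] by simp

lemma partial_deriv_add:
  assumes "f differentiable (at x)" "g differentiable (at x)"
  shows "partial_deriv i (\<lambda>x. f x + g x) x = partial_deriv i f x + partial_deriv i g x"
proof -
  have "((\<lambda>x. f x + g x) has_derivative (\<lambda>h. frechet_derivative f (at x) h + frechet_derivative g (at x) h)) (at x)"
    using assms by (intro has_derivative_add) (simp_all add: frechet_derivative_works)
  from partial_deriv_eqI[OF this] show ?thesis
    by (simp add: partial_deriv_def)
qed

lemma partial_deriv_mult:
  assumes "f differentiable (at x)" "g differentiable (at x)"
  shows "partial_deriv i (\<lambda>x. f x * g x) x = partial_deriv i f x * g x + f x * partial_deriv i g x"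
proof -
  have "((\<lambda>x. f x * g x) has_derivative (\<lambda>h. f x * frechet_derivative g (at x) h + frechet_derivative f (at x) h * g x)) (at x)"
    using assms by (intro has_derivative_mult) (simp_all add: frechet_derivative_works)
  from partial_deriv_eqI[OF this] show ?thesis
    by (simp add: partial_deriv_def)
qed

lemma partial_deriv_cmult:
  assumes "f differentiable (at x)"
  shows "partial_deriv i (\<lambda>x. c * f x) x = c * partial_deriv i f x"
proof -
  have "((\<lambda>x. c * f x) has_derivative (\<lambda>h. c * frechet_derivative f (at x) h)) (at x)"
    using assms by (intro has_derivative_mult_right) (simp_all add: frechet_derivative_works)
  from partial_deriv_eqI[OF this] show ?thesis
    by (simp add: partial_deriv_def)
qed

lemma partial_deriv_const: "partial_deriv i (\<lambda>x. c) x = 0"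
  by (rule partial_deriv_eqI[OF has_derivative_const, THEN trans]) simp

lemma partial_deriv_sum_list:
  assumes "\<And>s. s \<in> set xs \<Longrightarrow> F s differentiable (at x)"
  shows "partial_deriv i (\<lambda>x. \<Sum>s\<leftarrow>xs. F s x) x = (\<Sum>s\<leftarrow>xs. partial_deriv i (F s) x) \<and>
    (\<lambda>x. \<Sum>s\<leftarrow>xs. F s x) differentiable (at x)"
  using assms by (induction xs) (auto simp: partial_deriv_const partial_deriv_add)

lemma iterated_partial_sum:
  assumes "finite I" "\<And>j. j \<in> I \<Longrightarrow> smooth_on UNIV (F j)"
  shows "iterated_partial js (\<lambda>x. \<Sum>j\<in>I. F j x) = (\<lambda>x. \<Sum>j\<in>I. iterated_partial js (F j) x)"
proof (induction js)
  case (Cons i js)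
  have "partial_deriv i (\<lambda>x. \<Sum>j\<in>J. iterated_partial js (F j) x) x = (\<Sum>j\<in>J. partial_deriv i (iterated_partial js (F j)) x)"
    if "J \<subseteq> I" for x J
    using finite_subset[OF that assms(1)] that
  proof (induction J)
    case (insert j J)
    then have "partial_deriv i (\<lambda>x. iterated_partial js (F j) x + (\<Sum>j\<in>J. iterated_partial js (F j) x)) x
        = partial_deriv i (iterated_partial js (F j)) x + partial_deriv i (\<lambda>x. \<Sum>j\<in>J. iterated_partial js (F j) x) x"
      using assms(2) by (intro partial_deriv_add differentiable_sum) (auto intro: smooth_onD)
    then show ?case
      using insert by simp
  qed (simp add: partial_deriv_const)
  from this[OF order_refl] show ?case
    by (simp add: Cons.IH fun_eq_iff)
qed simp

lemma smooth_on_sum: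
  assumes "finite I" "\<And>j. j \<in> I \<Longrightarrow> smooth_on UNIV (F j)"
  shows "smooth_on UNIV (\<lambda>x. \<Sum>j\<in>I. F j x)"
  unfolding smooth_on_def
proof (intro allI ballI)
  fix js x
  show "iterated_partial js (\<lambda>x. \<Sum>j\<in>I. F j x) differentiable (at x)"
    using assms smooth_onD[OF assms(2)]
    by (subst iterated_partial_sum) (auto intro: differentiable_sum)
qed

lemma iterated_partial_const: "js \<noteq> [] \<Longrightarrow> iterated_partial js (\<lambda>x. c) = (\<lambda>x. 0)"
proof (induction js)
  case (Cons j js)
  then show ?case
    by (cases "js = []") (auto simp: partial_deriv_const)
qed simp

lemma partial_deriv_local:
  assumes "open S" "x \<in> S" "\<And>y. y \<in> S \<Longrightarrow> f y = g y"
  shows "partial_deriv i f x = partial_deriv i g x"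
proof -
  have "(f has_derivative f') (at x) \<longleftrightarrow> (g has_derivative f') (at x)" for f'
  proof
    assume "(f has_derivative f') (at x)"
    then show "(g has_derivative f') (at x)"
      by (rule has_derivative_transform_within_open[OF _ assms])
  next
    assume "(g has_derivative f') (at x)"
    then show "(f has_derivative f') (at x)"
      by (rule has_derivative_transform_within_open[OF _ assms(1,2)]) (simp add: assms(3))
  qed
  then show ?thesis
    by (simp add: partial_deriv_def frechet_derivative_def)
qed

lemma iterated_partial_local:
  assumes "open S" "\<And>y. y \<in> S \<Longrightarrow> f y = g y" "x \<in> S"
  shows "iterated_partial js f x = iterated_partial js g x"
  using assms(3)
proof (induction js arbitrary: x)
  case (Cons j js)
  show ?case
    unfolding iterated_partial.simps
    by (rule partial_deriv_local[OF assms(1) Cons.prems Cons.IH])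
qed (use assms in auto)

text \<open>All ways to distribute a list of differentiations over the two factors of a product. Lists in
  place of multi-indices make binomial coefficients superfluous.\<close>

fun splits :: "'a list \<Rightarrow> ('a list \<times> 'a list) list" where
  "splits [] = [([], [])]"
| "splits (j # js) = map (\<lambda>(as, bs). (j # as, bs)) (splits js) @ map (\<lambda>(as, bs). (as, j # bs)) (splits js)"

lemma splits_length: "(as, bs) \<in> set (splits js) \<Longrightarrow> length as + length bs = length js"
  by (induction js arbitrary: as bs) auto

text \<open>Exactly one way of distributing the differentiations puts all of them on the second factor.\<close>

lemma sum_splits_Nil:
  fixes h :: "'a list \<Rightarrow> real"
  shows "(\<Sum>(as, bs)\<leftarrow>splits js. if as = [] then h bs else 0) = h js"
proof (induction js arbitrary: h)
  case (Cons j js)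
  have "(\<Sum>(as, bs)\<leftarrow>map (\<lambda>(as, bs). (j # as, bs)) (splits js). if as = [] then h bs else 0) = (\<Sum>s\<leftarrow>splits js. 0)"
    unfolding map_map by (intro arg_cong[where f = sum_list] map_cong) auto
  moreover have "(\<Sum>(as, bs)\<leftarrow>map (\<lambda>(as, bs). (as, j # bs)) (splits js). if as = [] then h bs else 0)
      = (\<Sum>(as, bs)\<leftarrow>splits js. if as = [] then h (j # bs) else 0)"
    unfolding map_map by (intro arg_cong[where f = sum_list] map_cong) auto
  ultimately show ?case
    using Cons.IH[of "\<lambda>bs. h (j # bs)"] by (simp add: sum_list_0)
qed simp

text \<open>The Leibniz rule.\<close>

lemma iterated_partial_mult:
  assumes f: "smooth_on UNIV f" and g: "smooth_on UNIV g"
  shows "iterated_partial js (\<lambda>x. f x * g x) =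
    (\<lambda>x. \<Sum>(as, bs)\<leftarrow>splits js. iterated_partial as f x * iterated_partial bs g x)"
proof (induction js)
  case (Cons j js)
  define T where "T = (\<lambda>s x. iterated_partial (fst s) f x * iterated_partial (snd s) g x)"
  have diff: "T s differentiable (at x)" for s x
    unfolding T_def using f g by (intro differentiable_mult smooth_onD) auto
  have "partial_deriv j (T s) x = T (j # fst s, snd s) x + T (fst s, j # snd s) x" for s x
    unfolding T_def using f g by (subst partial_deriv_mult) (auto intro: smooth_onD)
  then have "iterated_partial (j # js) (\<lambda>x. f x * g x) x
     = (\<Sum>s\<leftarrow>splits js. T (j # fst s, snd s) x + T (fst s, j # snd s) x)" for x
    using partial_deriv_sum_list[of "splits js" T x j] diff Cons.IH
    by (simp add: case_prod_unfold T_def)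
  then show ?case
    by (simp add: fun_eq_iff sum_list_addf case_prod_unfold T_def comp_def)
qed simp

lemma smooth_on_mult:
  assumes f: "smooth_on UNIV f" and g: "smooth_on UNIV g"
  shows "smooth_on UNIV (\<lambda>x. f x * g x)"
  unfolding smooth_on_def iterated_partial_mult[OF assms]
proof (intro allI ballI)
  fix js x
  have "(\<lambda>x. iterated_partial (fst s) f x * iterated_partial (snd s) g x) differentiable (at x)" for s
    using f g by (intro differentiable_mult smooth_onD) auto
  then show "(\<lambda>x. \<Sum>(as, bs)\<leftarrow>splits js. iterated_partial as f x * iterated_partial bs g x) differentiable (at x)"
    using partial_deriv_sum_list[of "splits js" "\<lambda>s x. iterated_partial (fst s) f x * iterated_partial (snd s) g x" x]
    by (simp add: case_prod_unfold)
qed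

section \<open>Derivatives of mollifications\<close>

text \<open>Differentiation under the integral sign: the difference quotients of \<open>K\<close> are bounded by its
  Lipschitz constant, so that \<open>\<bar>f\<bar>\<close>, up to a constant factor, dominates.\<close>

lemma has_derivative_convolution:
  fixes f K :: "'a::euclidean_space \<Rightarrow> real"
  assumes f: "integrable lborel f"
    and K: "\<And>y. (K has_derivative K' y) (at y)" "\<And>y. \<bar>K y\<bar> \<le> C"
    and K': "\<And>y h. \<bar>K' y h\<bar> \<le> B * norm h" "\<And>h. (\<lambda>y. K' y h) \<in> borel_measurable borel"
  shows "((\<lambda>x. \<integral>y. f y * K (y - x) \<partial>lborel) has_derivative (\<lambda>h. - (\<integral>y. f y * K' (y - x) h \<partial>lborel))) (at x)"
proof -
  note K'(2)[measurable]
  have [measurable]: "f \<in> borel_measurable borel"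
    using f by auto
  have [measurable]: "K \<in> borel_measurable borel"
    using K(1) by (intro borel_measurable_continuous_onI continuous_at_imp_continuous_on ballI)
      (rule has_derivative_continuous)
  have lin: "linear (K' y)" for y
    using has_derivative_bounded_linear[OF K(1)] bounded_linear.linear by blast
  have bounded_int: "integrable lborel (\<lambda>y. f y * G y)"
    if "\<And>y. \<bar>G y\<bar> \<le> D" and [measurable]: "G \<in> borel_measurable borel" for G D
  proof (rule Bochner_Integration.integrable_bound)
    show "integrable lborel (\<lambda>y. D * f y)" using f by simp
    show "AE y in lborel. norm (f y * G y) \<le> norm (D * f y)"
      using that(1) by (intro AE_I2) (auto simp: abs_mult mult.commute intro!: mult_right_mono order_trans[OF that(1) abs_ge_self])
  qed measurable
  have int': "integrable lborel (\<lambda>y. f y * K' (y - z) h)" for h z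
    using K'(1) by (intro bounded_int[of _ "B * norm h"]) auto
  have int: "integrable lborel (\<lambda>y. f y * K (y - z))" for z
    using K(2) by (intro bounded_int[of _ C]) auto
  have lip: "\<bar>K u - K v\<bar> \<le> B * norm (u - v)" for u v
  proof -
    have "norm (K u - K v) \<le> B * norm (u - v)"
    proof (rule differentiable_bound[of UNIV])
      show "onorm (K' y) \<le> B" for y
        by (rule onorm_le) (use K'(1) in auto)
    qed (use K(1) in auto)
    then show ?thesis by simp
  qed
  define F where "F = (\<lambda>x. \<integral>y. f y * K (y - x) \<partial>lborel)"
  define F' where "F' = (\<lambda>h. - (\<integral>y. f y * K' (y - x) h \<partial>lborel))"
  have "bounded_linear F'"
  proof (rule bounded_linear_intro)
    show "F' (h + h') = F' h + F' h'" for h h'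
      unfolding F'_def using int' by (simp add: linear_add[OF lin] distrib_left)
    show "F' (r *\<^sub>R h) = r *\<^sub>R F' h" for r h
      unfolding F'_def by (simp add: linear_scale[OF lin] mult.left_commute[of _ r])
    show "norm (F' h) \<le> norm h * (\<integral>y. B * \<bar>f y\<bar> \<partial>lborel)" for h
    proof -
      have "norm (F' h) \<le> (\<integral>y. \<bar>f y * K' (y - x) h\<bar> \<partial>lborel)"
        unfolding F'_def using integral_abs_bound[of lborel "\<lambda>y. f y * K' (y - x) h"] by simp
      also have "\<dots> \<le> (\<integral>y. norm h * (B * \<bar>f y\<bar>) \<partial>lborel)"
      proof (rule integral_mono)
        show "\<bar>f y * K' (y - x) h\<bar> \<le> norm h * (B * \<bar>f y\<bar>)" for y
          using mult_left_mono[OF K'(1)[of "y - x" h], of "\<bar>f y\<bar>"] by (simp add: abs_mult mult_ac)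
      qed (use f int' in \<open>auto intro: integrable_abs\<close>)
      also have "\<dots> = norm h * (\<integral>y. B * \<bar>f y\<bar> \<partial>lborel)"
        by simp
      finally show ?thesis .
    qed
  qed
  moreover have "(\<lambda>h. norm (F (x + h) - F x - F' h) / norm h) \<midarrow>0\<rightarrow> 0"
    unfolding tendsto_at_iff_sequentially
  proof (intro allI impI)
    fix X :: "nat \<Rightarrow> 'a"
    assume X0: "\<forall>i. X i \<in> UNIV - {0}" and X: "X \<longlonglongrightarrow> 0"
    define q where "q = (\<lambda>n y. f y * ((K (y - x - X n) - K (y - x) + K' (y - x) (X n)) / norm (X n)))"
    have "(\<lambda>n. \<integral>y. q n y \<partial>lborel) \<longlonglongrightarrow> (\<integral>y. 0 \<partial>(lborel :: 'a measure))"
    proof (rule integral_dominated_convergence[where w = "\<lambda>y. 2 * B * \<bar>f y\<bar>"])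
      show "AE y in lborel. (\<lambda>n. q n y) \<longlonglongrightarrow> 0"
      proof (intro AE_I2)
        fix y
        have "(\<lambda>h. norm (K (y - x + h) - K (y - x) - K' (y - x) h) / norm h) \<midarrow>0\<rightarrow> 0"
          using K(1)[of "y - x"] unfolding has_derivative_at by blast
        moreover have "filterlim (\<lambda>n. - X n) (at 0) sequentially"
          unfolding filterlim_at using tendsto_minus[OF X] X0 by auto
        ultimately have "(\<lambda>n. norm (K (y - x + - X n) - K (y - x) - K' (y - x) (- X n)) / norm (- X n)) \<longlonglongrightarrow> 0"
          by (rule filterlim_compose)
        then have "(\<lambda>n. (K (y - x - X n) - K (y - x) + K' (y - x) (X n)) / norm (X n)) \<longlonglongrightarrow> 0"
          by (subst tendsto_rabs_zero_iff[symmetric]) (simp add: linear_neg[OF lin])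
        then show "(\<lambda>n. q n y) \<longlonglongrightarrow> 0"
          unfolding q_def by (rule tendsto_mult_right_zero)
      qed
      show "AE y in lborel. norm (q n y) \<le> 2 * B * \<bar>f y\<bar>" for n
      proof (intro AE_I2)
        fix y
        have "norm (X n) > 0" using X0 by auto
        have "\<bar>K (y - x - X n) - K (y - x) + K' (y - x) (X n)\<bar> \<le> 2 * B * norm (X n)"
          using lip[of "y - x - X n" "y - x"] K'(1)[of "y - x" "X n"] by simp
        then have "\<bar>K (y - x - X n) - K (y - x) + K' (y - x) (X n)\<bar> / norm (X n) \<le> 2 * B"
          using \<open>norm (X n) > 0\<close> by (simp add: field_simps)
        from mult_left_mono[OF this, of "\<bar>f y\<bar>"]
        show "norm (q n y) \<le> 2 * B * \<bar>f y\<bar>"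
          by (simp add: q_def abs_mult mult.commute)
      qed
      show "integrable lborel (\<lambda>y. 2 * B * \<bar>f y\<bar>)"
        using f by auto
    qed (auto simp: q_def)
    then have lim: "(\<lambda>n. \<bar>\<integral>y. q n y \<partial>lborel\<bar>) \<longlonglongrightarrow> 0"
      by (simp add: tendsto_rabs_zero)
    have "\<bar>\<integral>y. q n y \<partial>lborel\<bar> = norm (F (x + X n) - F x - F' (X n)) / norm (X n)" for n
    proof -
      have "q n y = (f y * K (y - (x + X n)) - f y * K (y - x) + f y * K' (y - x) (X n)) / norm (X n)" for y
        by (simp add: q_def algebra_simps add_divide_distrib diff_divide_distrib)
      then have "(\<integral>y. q n y \<partial>lborel) = (F (x + X n) - F x - F' (X n)) / norm (X n)"
        using int int' by (simp add: F_def F'_def)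
      then show ?thesis by simp
    qed
    with lim show "((\<lambda>h. norm (F (x + h) - F x - F' h) / norm h) \<circ> X) \<longlonglongrightarrow> 0"
      by (simp add: comp_def)
  qed
  ultimately show ?thesis
    unfolding has_derivative_at F_def F'_def by blast
qed

text \<open>Since \<open>mollifier t e \<nu>\<close> is supported around \<open>t e\<close>, only the values of \<open>f\<close> close to
  \<open>x + t e\<close> enter; for \<open>\<nu> = 0\<close> this is a weighted average of them.\<close>

definition mollify :: "real \<Rightarrow> real^'n \<Rightarrow> ('n::finite \<Rightarrow> nat) \<Rightarrow> (real^'n \<Rightarrow> real) \<Rightarrow> real^'n \<Rightarrow> real" where
  "mollify t e \<nu> f x = (\<integral>y. f y * mollifier t e \<nu> (y - x) \<partial>lborel)"

lemma sum_axis_mult: "(\<Sum>i\<in>UNIV. axis j (1::real) $ i * c i) = c (j::'n::finite)"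
proof -
  have "(\<Sum>i\<in>UNIV. axis j (1::real) $ i * c i) = (\<Sum>i\<in>UNIV. if i = j then c i else 0)"
    by (intro sum.cong) (auto simp: axis_def)
  then show ?thesis by simp
qed

lemma mollify_derivative:
  assumes t: "0 < t" and f: "integrable lborel f"
  shows "mollify t e \<nu> f differentiable (at x)"
    and "partial_deriv j (mollify t e \<nu> f) x = - mollify t e (\<nu>(j := Suc (\<nu> j))) f x"
proof -
  define K' where "K' = (\<lambda>y h. \<Sum>i\<in>UNIV. h $ i * mollifier t e (\<nu>(i := Suc (\<nu> i))) y)"
  obtain C where C: "\<And>y. \<bar>mollifier t e \<nu> y\<bar> \<le> C"
    using mollifier_bounded[OF t] by blast
  have "\<forall>\<mu>. \<exists>B. \<forall>y. \<bar>mollifier t e \<mu> y\<bar> \<le> B"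
    using mollifier_bounded[OF t] by blast
  then obtain b where b: "\<And>\<mu> y. \<bar>mollifier t e \<mu> y\<bar> \<le> b \<mu>"
    by metis
  have bound: "\<bar>K' y h\<bar> \<le> (\<Sum>i\<in>UNIV. b (\<nu>(i := Suc (\<nu> i)))) * norm h" for y h
  proof -
    have "\<bar>K' y h\<bar> \<le> (\<Sum>i\<in>UNIV. \<bar>h $ i * mollifier t e (\<nu>(i := Suc (\<nu> i))) y\<bar>)"
      unfolding K'_def by (rule sum_abs)
    also have "\<dots> \<le> (\<Sum>i\<in>UNIV. norm h * b (\<nu>(i := Suc (\<nu> i))))"
      unfolding abs_mult by (intro sum_mono mult_mono b component_le_norm_cart) auto
    finally show ?thesis
      by (simp add: sum_distrib_left mult.commute)
  qed
  have "((\<lambda>x. \<integral>y. f y * mollifier t e \<nu> (y - x) \<partial>lborel) has_derivative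
      (\<lambda>h. - (\<integral>y. f y * K' (y - x) h \<partial>lborel))) (at x)"
  proof (rule has_derivative_convolution[OF f _ C bound])
    show "(mollifier t e \<nu> has_derivative K' y) (at y)" for y
      unfolding K'_def by (rule mollifier_has_derivative[OF t])
    show "(\<lambda>y. K' y h) \<in> borel_measurable borel" for h
      unfolding K'_def using borel_measurable_mollifier[OF t] by measurable
  qed
  then have D: "(mollify t e \<nu> f has_derivative (\<lambda>h. - (\<integral>y. f y * K' (y - x) h \<partial>lborel))) (at x)"
    by (simp add: mollify_def[abs_def])
  then show "mollify t e \<nu> f differentiable (at x)"
    by (auto simp: differentiable_def)
  show "partial_deriv j (mollify t e \<nu> f) x = - mollify t e (\<nu>(j := Suc (\<nu> j))) f x"
    using partial_deriv_eqI[OF D] by (simp add: K'_def sum_axis_mult mollify_def)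
qed

lemma iterated_partial_mollify:
  assumes t: "0 < t" and f: "integrable lborel f"
  shows "iterated_partial js (mollify t e \<nu> f) =
    (\<lambda>x. (-1) ^ length js * mollify t e (\<lambda>i. \<nu> i + count_list js i) f x)"
proof (induction js)
  case (Cons j js)
  have "(\<lambda>i. \<nu> i + count_list js i)(j := Suc (\<nu> j + count_list js j)) = (\<lambda>i. \<nu> i + count_list (j # js) i)"
    by auto
  then show ?case
    unfolding iterated_partial.simps Cons.IH
    by (simp only: partial_deriv_cmult[OF mollify_derivative(1)[OF assms]]
          mollify_derivative(2)[OF assms] list.size) simp
qed simp

lemma smooth_on_mollify:
  assumes t: "0 < t" and f: "integrable lborel f"
  shows "smooth_on UNIV (mollify t e \<nu> f)"
  unfolding smooth_on_def iterated_partial_mollify[OF assms]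
  by (auto intro!: differentiable_mult mollify_derivative assms)

lemma iterated_partial_mollifier_translate:
  assumes t: "0 < t"
  shows "iterated_partial js (\<lambda>y. mollifier t e \<nu> (y - x)) = (\<lambda>y. mollifier t e (\<lambda>i. \<nu> i + count_list js i) (y - x))"
    and "(\<lambda>y. mollifier t e \<nu> (y - x)) differentiable (at y)"
proof -
  have D: "((\<lambda>y. mollifier t e \<mu> (y - x)) has_derivative
      (\<lambda>h. \<Sum>i\<in>UNIV. h $ i * mollifier t e (\<mu>(i := Suc (\<mu> i))) (y - x))) (at y)" for \<mu> y
  proof -
    have "((\<lambda>y. y - x) has_derivative (\<lambda>h. h)) (at y)"
      by (auto intro!: derivative_eq_intros)
    from has_derivative_compose[OF this mollifier_has_derivative[OF t]] show ?thesis .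
  qed
  then show "(\<lambda>y. mollifier t e \<nu> (y - x)) differentiable (at y)"
    by (auto simp: differentiable_def)
  show "iterated_partial js (\<lambda>y. mollifier t e \<nu> (y - x)) = (\<lambda>y. mollifier t e (\<lambda>i. \<nu> i + count_list js i) (y - x))"
  proof (induction js)
    case (Cons j js)
    have "(\<lambda>i. \<nu> i + count_list js i)(j := Suc (\<nu> j + count_list js j)) = (\<lambda>i. \<nu> i + count_list (j # js) i)"
      by auto
    then show ?case
      unfolding iterated_partial.simps Cons.IH
      using partial_deriv_eqI[OF D, of j] by (simp only: sum_axis_mult)
  qed simp
qed

lemma mollify_bounded:
  assumes t: "0 < t" and f: "integrable lborel f"
  shows "\<exists>B. \<forall>x. \<bar>mollify t e \<nu> f x\<bar> \<le> B"
proof -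
  obtain C where C: "\<And>y. \<bar>mollifier t e \<nu> y\<bar> \<le> C"
    using mollifier_bounded[OF t] by blast
  note borel_measurable_mollifier[OF t, measurable]
  have [measurable]: "f \<in> borel_measurable borel"
    using f by auto
  have "\<bar>mollify t e \<nu> f x\<bar> \<le> (\<integral>y. C * \<bar>f y\<bar> \<partial>lborel)" for x
  proof -
    have le: "\<bar>f y * mollifier t e \<nu> (y - x)\<bar> \<le> C * \<bar>f y\<bar>" for y
      using mult_right_mono[OF C, of "\<bar>f y\<bar>" "y - x"] by (simp add: abs_mult mult.commute)
    have "integrable lborel (\<lambda>y. C * \<bar>f y\<bar>)"
      using f by simp
    moreover from this have "integrable lborel (\<lambda>y. f y * mollifier t e \<nu> (y - x))"
      by (rule Bochner_Integration.integrable_bound)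
         (use le in \<open>auto intro: order_trans[OF _ abs_ge_self]\<close>)
    ultimately have "(\<integral>y. \<bar>f y * mollifier t e \<nu> (y - x)\<bar> \<partial>lborel) \<le> (\<integral>y. C * \<bar>f y\<bar> \<partial>lborel)"
      using le by (intro integral_mono integrable_abs)
    then show ?thesis
      unfolding mollify_def by (rule order_trans[OF integral_abs_bound])
  qed
  then show ?thesis by blast
qed

section \<open>Integration by parts\<close>

text \<open>By translation invariance, the difference quotients of \<open>g\<close> in direction \<open>j\<close> have integral \<open>0\<close>;
  they converge to the derivative, dominated by a bound for the derivative on a large ball.\<close>

lemma integral_partial_deriv_eq_0:
  fixes g :: "real^'n::finite \<Rightarrow> real"
  assumes g: "\<And>x. g differentiable (at x)" and cont: "continuous_on UNIV (partial_deriv j g)"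
    and supp: "\<And>x. g x \<noteq> 0 \<Longrightarrow> norm x \<le> R"
  shows "integral\<^sup>L lborel (partial_deriv j g) = 0"
proof -
  define g' where "g' = partial_deriv j g"
  define h where "h = (\<lambda>n. 1 / real (Suc n))"
  have h: "0 < h n" "h n \<le> 1" for n
    by (auto simp: h_def)
  have g0: "g x = 0" if "R < norm x" for x
    using supp[of x] that by force
  have g'0: "g' x = 0" if "R < norm x" for x
  proof -
    have "partial_deriv j g x = partial_deriv j (\<lambda>x. 0) x"
      by (rule partial_deriv_local[of "- cball 0 R"]) (use that g0 in auto)
    then show ?thesis by (simp add: g'_def partial_deriv_const)
  qed
  have "compact (g' ` cball 0 R)"
    unfolding g'_def by (intro compact_continuous_image continuous_on_subset[OF cont]) auto
  then obtain M where M: "\<And>x. x \<in> cball 0 R \<Longrightarrow> \<bar>g' x\<bar> \<le> M"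
    using compact_imp_bounded[of "g' ` cball 0 R"] unfolding bounded_iff by (metis imageI real_norm_def)
  have gM: "\<bar>g' x\<bar> \<le> \<bar>M\<bar>" for x
    using M[of x] g'0[of x] by (cases "norm x \<le> R") auto
  have line: "((\<lambda>s. g (x + s *\<^sub>R axis j 1)) has_real_derivative g' (x + s *\<^sub>R axis j 1)) (at s)" for x s
  proof -
    have "((\<lambda>s. x + s *\<^sub>R axis j 1) has_derivative (\<lambda>s. s *\<^sub>R axis j 1)) (at s)"
      by (auto intro!: derivative_eq_intros)
    moreover have D: "(g has_derivative frechet_derivative g (at (x + s *\<^sub>R axis j 1))) (at (x + s *\<^sub>R axis j 1))"
      using g by (simp flip: frechet_derivative_works)
    ultimately have "((\<lambda>s. g (x + s *\<^sub>R axis j 1)) has_derivative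
        (\<lambda>r. frechet_derivative g (at (x + s *\<^sub>R axis j 1)) (r *\<^sub>R axis j 1))) (at s)"
      by (rule has_derivative_compose)
    moreover have "frechet_derivative g (at (x + s *\<^sub>R axis j 1)) (r *\<^sub>R axis j 1) = g' (x + s *\<^sub>R axis j 1) * r" for r
      using linear_scale[OF bounded_linear.linear[OF has_derivative_bounded_linear[OF D]]]
      by (simp add: g'_def partial_deriv_def)
    ultimately show ?thesis
      by (simp add: has_field_derivative_def)
  qed
  have lip: "\<bar>g (x + r *\<^sub>R axis j 1) - g x\<bar> \<le> \<bar>M\<bar> * r" if "0 < r" for x r
  proof -
    from MVT2[OF that line] obtain z
      where "g (x + r *\<^sub>R axis j 1) - g (x + 0 *\<^sub>R axis j 1) = (r - 0) * g' (x + z *\<^sub>R axis j 1)"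
      by blast
    then show ?thesis
      using gM that by (simp add: abs_mult mult.commute)
  qed
  have contg: "continuous_on UNIV g"
    using g differentiable_imp_continuous_within continuous_at_imp_continuous_on by blast
  have [measurable]: "g \<in> borel_measurable borel" "g' \<in> borel_measurable borel"
    using contg cont by (auto simp: g'_def intro: borel_measurable_continuous_onI)
  have int_g: "integrable lborel g"
    using supp contg by (intro integrable_continuous_bounded_support[of g 0 R]) auto
  define q where "q = (\<lambda>n x. (g (x + h n *\<^sub>R axis j 1) - g x) / h n)"
  have "(\<lambda>n. integral\<^sup>L lborel (q n)) \<longlonglongrightarrow> integral\<^sup>L lborel g'"
  proof (rule integral_dominated_convergence[where w = "\<lambda>x. indicator (cball 0 (R + 1)) x *\<^sub>R \<bar>M\<bar>"])
    show "integrable lborel (\<lambda>x. indicator (cball (0::real^'n) (R + 1)) x *\<^sub>R \<bar>M\<bar>)"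
      using borel_integrable_compact[of "cball (0::real^'n) (R + 1)" "\<lambda>_. \<bar>M\<bar>"] by simp
    show "AE x in lborel. norm (q n x) \<le> indicator (cball 0 (R + 1)) x *\<^sub>R \<bar>M\<bar>" for n
    proof (intro AE_I2)
      fix x :: "real^'n"
      show "norm (q n x) \<le> indicator (cball 0 (R + 1)) x *\<^sub>R \<bar>M\<bar>"
      proof (cases "norm x \<le> R + 1")
        case True
        then show ?thesis
          using lip[OF h(1)[of n], of x] h(1)[of n] by (simp add: q_def field_simps)
      next
        case False
        have "norm x \<le> norm (x + h n *\<^sub>R axis j 1) + h n * 1"
          using norm_triangle_ineq4[of "x + h n *\<^sub>R axis j 1" "h n *\<^sub>R axis j (1::real)"] h(1)[of n]
          by simp
        then have "R < norm (x + h n *\<^sub>R axis j 1)"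
          using False h(2)[of n] by simp
        then show ?thesis
          using False g0 by (simp add: q_def)
      qed
    qed
    show "AE x in lborel. (\<lambda>n. q n x) \<longlonglongrightarrow> g' x"
    proof (intro AE_I2)
      fix x
      have "(\<lambda>s. (g (x + (0 + s) *\<^sub>R axis j 1) - g (x + 0 *\<^sub>R axis j 1)) / s) \<midarrow>0\<rightarrow> g' (x + 0 *\<^sub>R axis j 1)"
        using line[of x 0] unfolding DERIV_def by simp
      moreover have "filterlim h (at 0) sequentially"
        unfolding filterlim_at h_def using LIMSEQ_inverse_real_of_nat by (auto simp: inverse_eq_divide)
      ultimately have "(\<lambda>n. (g (x + (0 + h n) *\<^sub>R axis j 1) - g (x + 0 *\<^sub>R axis j 1)) / h n) \<longlonglongrightarrow> g' (x + 0 *\<^sub>R axis j 1)"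
        by (rule filterlim_compose)
      then show "(\<lambda>n. q n x) \<longlonglongrightarrow> g' x"
        by (simp add: q_def)
    qed
  qed (auto simp: q_def)
  moreover have "integral\<^sup>L lborel (q n) = 0" for n
    using integrable_lborel_translate[OF int_g, of "h n *\<^sub>R axis j 1"] int_g by (simp add: q_def)
  ultimately have "(\<lambda>n. 0) \<longlonglongrightarrow> integral\<^sup>L lborel g'"
    by simp
  then show ?thesis
    by (simp add: LIMSEQ_const_iff g'_def)
qed

lemma iterated_partial_eq_0_outside:
  assumes "\<And>x. x \<notin> C \<Longrightarrow> f x = 0" "closed C" "x \<notin> C"
  shows "iterated_partial js f x = 0"
proof -
  have "iterated_partial js f x = iterated_partial js (\<lambda>x. 0) x"
    by (rule iterated_partial_local[of "- C"]) (use assms in auto)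
  also have "\<dots> = 0"
    by (cases "js = []") (auto simp: iterated_partial_const)
  finally show ?thesis .
qed

text \<open>The derivatives are moved to \<open>\<phi>\<close> one at a time, the outermost first, which reverses their
  order.\<close>

lemma integral_by_parts_iterated_partial:
  fixes \<phi> \<psi> :: "real^'n::finite \<Rightarrow> real"
  assumes \<psi>: "smooth_on UNIV \<psi>" "\<And>x. \<psi> x \<noteq> 0 \<Longrightarrow> norm x \<le> R" and \<phi>: "smooth_on UNIV \<phi>"
  shows "(\<integral>x. \<phi> x * iterated_partial js \<psi> x \<partial>lborel)
    = (-1) ^ length js * (\<integral>x. iterated_partial (rev js) \<phi> x * \<psi> x \<partial>lborel)"
  using \<phi>
proof (induction js arbitrary: \<phi>)
  case (Cons j js)
  define G where "G = iterated_partial js \<psi>"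
  have G: "smooth_on UNIV G"
    unfolding G_def by (rule smooth_on_iterated_partial[OF \<psi>(1)])
  have G0: "G x = 0" if "\<not> norm x \<le> R" for x
    unfolding G_def by (rule iterated_partial_eq_0_outside[of "cball 0 R"]) (use \<psi>(2) that in auto)
  have dG: "G differentiable (at x)" "\<phi> differentiable (at x)" for x
    using smooth_onD[OF G, of x "[]"] smooth_onD[OF Cons.prems, of x "[]"] by auto
  have cG: "continuous_on UNIV G" "continuous_on UNIV (partial_deriv j G)"
    "continuous_on UNIV \<phi>" "continuous_on UNIV (partial_deriv j \<phi>)"
    using continuous_on_iterated_partial[OF G, of UNIV "[]"] continuous_on_iterated_partial[OF G, of UNIV "[j]"]
      continuous_on_iterated_partial[OF Cons.prems, of UNIV "[]"] continuous_on_iterated_partial[OF Cons.prems, of UNIV "[j]"]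
    by auto
  have jG0: "partial_deriv j G x = 0" if "\<not> norm x \<le> R" for x
    using iterated_partial_eq_0_outside[of "cball 0 R" G x "[j]"] G0 that by auto
  have int1: "integrable lborel (\<lambda>x. \<phi> x * partial_deriv j G x)"
    using jG0 by (intro integrable_continuous_bounded_support[of _ 0 R] continuous_on_mult cG) force
  have int2: "integrable lborel (\<lambda>x. partial_deriv j \<phi> x * G x)"
    using G0 by (intro integrable_continuous_bounded_support[of _ 0 R] continuous_on_mult cG) force
  have prod: "partial_deriv j (\<lambda>x. \<phi> x * G x) = (\<lambda>x. partial_deriv j \<phi> x * G x + \<phi> x * partial_deriv j G x)"
    by (intro ext partial_deriv_mult dG)
  have "integral\<^sup>L lborel (partial_deriv j (\<lambda>x. \<phi> x * G x)) = 0"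
  proof (rule integral_partial_deriv_eq_0)
    show "continuous_on UNIV (partial_deriv j (\<lambda>x. \<phi> x * G x))"
      unfolding prod by (intro continuous_intros cG)
    show "norm x \<le> R" if "\<phi> x * G x \<noteq> 0" for x
      using that G0 by force
  qed (intro differentiable_mult dG)
  then have "(\<integral>x. \<phi> x * partial_deriv j G x \<partial>lborel) = - (\<integral>x. partial_deriv j \<phi> x * G x \<partial>lborel)"
    using int1 int2 by (simp add: prod)
  also have "\<dots> = - ((-1) ^ length js * (\<integral>x. iterated_partial (rev js) (partial_deriv j \<phi>) x * \<psi> x \<partial>lborel))"
    unfolding G_def using smooth_on_iterated_partial[OF Cons.prems, of "[j]"] by (subst Cons.IH) auto
  finally show ?case
    by (simp add: G_def iterated_partial_append)
qed simp

section \<open>Multi-indices as lists of directions\<close>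

text \<open>The list of directions chosen in the definition of \<open>mi_deriv\<close>.\<close>

definition mi_list :: "('n::finite \<Rightarrow> nat) \<Rightarrow> 'n list" where
  "mi_list \<nu> = (SOME js. \<forall>i. count_list js i = \<nu> i)"

lemma count_list_replicate: "count_list (replicate k x) y = (if x = y then k else 0)"
  by (induction k) auto

lemma count_list_mi_list: "count_list (mi_list \<nu>) = (\<nu> :: 'n::finite \<Rightarrow> nat)"
proof -
  obtain xs :: "'n list" where xs: "set xs = UNIV" "distinct xs"
    using finite_distinct_list[OF finite_class.finite_UNIV] by blast
  have "count_list (concat (map (\<lambda>i. replicate (\<nu> i) i) ys)) i = (if i \<in> set ys then \<nu> i else 0)"
    if "distinct ys" for ys i
    using that by (induction ys) (auto simp: count_list_replicate)
  then have "\<exists>js. \<forall>i. count_list js i = \<nu> i"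
    using xs by (intro exI[of _ "concat (map (\<lambda>i. replicate (\<nu> i) i) xs)"]) auto
  from someI_ex[OF this] show ?thesis
    by (auto simp: mi_list_def)
qed

lemma mi_deriv_eq: "mi_deriv \<nu> f = iterated_partial (mi_list \<nu>) f"
  by (simp add: mi_deriv_def mi_list_def)

lemma mi_order_count_list: "mi_order (count_list js) = length js"
  unfolding mi_order_def by (rule sum_count_set) auto

lemma length_mi_list: "length (mi_list \<nu>) = mi_order \<nu>"
  using mi_order_count_list[of "mi_list \<nu>"] by (simp add: count_list_mi_list)

section \<open>Borel versions of Lebesgue measurable functions\<close>

text \<open>Transfers integrals over \<open>\<Omega>\<close> to Borel functions on the whole space, where translation
  invariance and Tonelli's theorem are available.\<close>

lemma integral_lebesgue_on_eq_lborel: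
  fixes g G :: "'a::euclidean_space \<Rightarrow> real"
  assumes \<Omega>: "\<Omega> \<in> sets lebesgue" and G: "G \<in> borel_measurable borel" "\<And>x. x \<notin> \<Omega> \<Longrightarrow> G x = 0"
    and eq: "AE x in lborel. x \<in> \<Omega> \<longrightarrow> g x = G x"
  shows "integral\<^sup>L (lebesgue_on \<Omega>) g = integral\<^sup>L lborel G"
    and "integrable (lebesgue_on \<Omega>) g \<longleftrightarrow> integrable lborel G"
    and "g \<in> borel_measurable (lebesgue_on \<Omega>)"
proof -
  have Gl: "G \<in> borel_measurable lebesgue"
    using G(1) by (intro measurable_completion) simp
  have AE: "AE x in lebesgue. G x = indicator \<Omega> x *\<^sub>R g x"
    using AE_completion[OF eq] by (rule AE_mp) (use G(2) in \<open>auto simp: indicator_def\<close>)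
  have m: "(\<lambda>x. indicator \<Omega> x *\<^sub>R g x) \<in> borel_measurable lebesgue"
    by (rule borel_measurable_AE[OF Gl AE])
  have "integral\<^sup>L (lebesgue_on \<Omega>) g = integral\<^sup>L lebesgue (\<lambda>x. indicator \<Omega> x *\<^sub>R g x)"
    using \<Omega> by (intro integral_restrict_space) simp
  also have "\<dots> = integral\<^sup>L lebesgue G"
    using AE by (intro integral_cong_AE m Gl) (auto elim: eventually_mono)
  also have "\<dots> = integral\<^sup>L lborel G"
    using G by (intro integral_completion) simp
  finally show "integral\<^sup>L (lebesgue_on \<Omega>) g = integral\<^sup>L lborel G" .
  have "integrable (lebesgue_on \<Omega>) g \<longleftrightarrow> integrable lebesgue (\<lambda>x. indicator \<Omega> x *\<^sub>R g x)"
    using \<Omega> by (intro integrable_restrict_space) simp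
  also have "\<dots> \<longleftrightarrow> integrable lebesgue G"
    using AE by (intro integrable_cong_AE m Gl) (auto elim: eventually_mono)
  also have "\<dots> \<longleftrightarrow> integrable lborel G"
    using G by (intro integrable_completion) simp
  finally show "integrable (lebesgue_on \<Omega>) g \<longleftrightarrow> integrable lborel G" .
  show "g \<in> borel_measurable (lebesgue_on \<Omega>)"
    using m \<Omega> by (subst borel_measurable_restrict_space_iff) auto
qed

definition borel_version :: "(real^'n::finite) set \<Rightarrow> (real^'n \<Rightarrow> real) \<Rightarrow> (real^'n \<Rightarrow> real) \<Rightarrow> bool" where
  "borel_version \<Omega> f F \<longleftrightarrow> F \<in> borel_measurable borel \<and> (\<forall>x. x \<notin> \<Omega> \<longrightarrow> F x = 0) \<and>
     (AE x in lborel. x \<in> \<Omega> \<longrightarrow> f x = F x)"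

lemma borel_versionD:
  assumes "borel_version \<Omega> f F"
  shows "F \<in> borel_measurable borel" "x \<notin> \<Omega> \<Longrightarrow> F x = 0" "AE x in lborel. x \<in> \<Omega> \<longrightarrow> f x = F x"
  using assms by (auto simp: borel_version_def)

lemma borel_version_exists:
  assumes "f \<in> borel_measurable (lebesgue_on \<Omega>)" "\<Omega> \<in> sets borel"
  shows "\<exists>F. borel_version \<Omega> f F"
proof -
  have "\<Omega> \<in> sets lebesgue"
    using assms(2) by auto
  then have "(\<lambda>x. indicator \<Omega> x *\<^sub>R f x) \<in> borel_measurable lebesgue"
    using assms(1) by (subst (asm) borel_measurable_restrict_space_iff) auto
  from completion_ex_borel_measurable_real[OF this]
  obtain g where g: "g \<in> borel_measurable borel" "AE x in lborel. indicator \<Omega> x *\<^sub>R f x = g x"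
    by auto
  have "AE x in lborel. x \<in> \<Omega> \<longrightarrow> f x = indicator \<Omega> x * g x"
    using g(2) by (rule AE_mp) (auto simp: indicator_def)
  moreover have "(\<lambda>x. indicator \<Omega> x * g x) \<in> borel_measurable borel"
    using g(1) assms(2) by measurable
  ultimately have "borel_version \<Omega> f (\<lambda>x. indicator \<Omega> x * g x)"
    by (auto simp: borel_version_def)
  then show ?thesis by blast
qed

lemma borel_version_mult:
  assumes "borel_version \<Omega> f F" "\<Omega> \<in> sets lebesgue" "H \<in> borel_measurable borel"
  shows "integral\<^sup>L (lebesgue_on \<Omega>) (\<lambda>x. f x * H x) = (\<integral>x. F x * H x \<partial>lborel)"
    and "integrable (lebesgue_on \<Omega>) (\<lambda>x. f x * H x) \<longleftrightarrow> integrable lborel (\<lambda>x. F x * H x)"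
proof -
  note F = borel_versionD[OF assms(1)]
  have 1: "(\<lambda>x. F x * H x) \<in> borel_measurable borel"
    using F(1) assms(3) by measurable
  have 2: "AE x in lborel. x \<in> \<Omega> \<longrightarrow> f x * H x = F x * H x"
    using F(3) by (rule AE_mp) auto
  show "integral\<^sup>L (lebesgue_on \<Omega>) (\<lambda>x. f x * H x) = (\<integral>x. F x * H x \<partial>lborel)"
    "integrable (lebesgue_on \<Omega>) (\<lambda>x. f x * H x) \<longleftrightarrow> integrable lborel (\<lambda>x. F x * H x)"
    using integral_lebesgue_on_eq_lborel[OF assms(2) 1 _ 2] F(2) by auto
qed

lemma borel_version_Lp:
  assumes "borel_version \<Omega> f F" "\<Omega> \<in> sets lebesgue"
  shows "integrable (lebesgue_on \<Omega>) (\<lambda>x. \<bar>f x\<bar> powr p) \<longleftrightarrow> Lp_int p F < \<infinity>"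
    and "Lp_norm p \<Omega> f = enn2real (Lp_int p F) powr (1 / p)"
proof -
  note F = borel_versionD[OF assms(1)]
  note F(1)[measurable]
  have 1: "(\<lambda>x. \<bar>F x\<bar> powr p) \<in> borel_measurable borel"
    by measurable
  have 2: "AE x in lborel. x \<in> \<Omega> \<longrightarrow> \<bar>f x\<bar> powr p = \<bar>F x\<bar> powr p"
    using F(3) by (rule AE_mp) auto
  have 3: "\<bar>F x\<bar> powr p = 0" if "x \<notin> \<Omega>" for x
    using F(2)[OF that] by simp
  have "integrable lborel (\<lambda>x. \<bar>F x\<bar> powr p) \<longleftrightarrow> Lp_int p F < \<infinity>"
    by (simp add: integrable_iff_bounded Lp_int_def)
  then show "integrable (lebesgue_on \<Omega>) (\<lambda>x. \<bar>f x\<bar> powr p) \<longleftrightarrow> Lp_int p F < \<infinity>"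
    using integral_lebesgue_on_eq_lborel(2)[OF assms(2) 1 3 2] by simp
  have "integral\<^sup>L (lebesgue_on \<Omega>) (\<lambda>x. \<bar>f x\<bar> powr p) = integral\<^sup>L lborel (\<lambda>x. \<bar>F x\<bar> powr p)"
    by (rule integral_lebesgue_on_eq_lborel(1)[OF assms(2) 1 3 2])
  also have "\<dots> = enn2real (Lp_int p F)"
    unfolding Lp_int_def by (rule integral_eq_nn_integral) auto
  finally show "Lp_norm p \<Omega> f = enn2real (Lp_int p F) powr (1 / p)"
    by (simp add: Lp_norm_def)
qed

text \<open>The pointwise bound \<open>\<bar>F\<bar> \<le> 1 + \<bar>F\<bar>\<^sup>p\<close> on the set \<open>\<Omega>\<close> of finite measure.\<close>

lemma Lp_bounded_domain_imp_integrable: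
  fixes F :: "'a::euclidean_space \<Rightarrow> real"
  assumes "1 \<le> p" "F \<in> borel_measurable borel" "bounded \<Omega>" "\<Omega> \<in> sets borel" "\<And>x. x \<notin> \<Omega> \<Longrightarrow> F x = 0" "Lp_int p F < \<infinity>"
  shows "integrable lborel F"
proof (rule Bochner_Integration.integrable_bound)
  note assms(2,4)[measurable]
  have "emeasure lborel \<Omega> < \<infinity>"
    by (rule emeasure_bounded_finite[OF assms(3)])
  then have "integrable lborel (indicator \<Omega> :: 'a \<Rightarrow> real)"
    by (intro integrable_real_indicator) auto
  moreover have "integrable lborel (\<lambda>x. \<bar>F x\<bar> powr p)"
    using assms(6) by (simp add: integrable_iff_bounded Lp_int_def)
  ultimately show "integrable lborel (\<lambda>x. indicator \<Omega> x + \<bar>F x\<bar> powr p)"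
    by (rule Bochner_Integration.integrable_add)
  have "\<bar>F x\<bar> \<le> indicator \<Omega> x + \<bar>F x\<bar> powr p" for x
  proof (cases "\<bar>F x\<bar> \<le> 1")
    case True
    then show ?thesis
      using assms(5)[of x] by (cases "x \<in> \<Omega>") (auto intro: add_increasing2)
  next
    case False
    then have "\<bar>F x\<bar> powr 1 \<le> \<bar>F x\<bar> powr p"
      using assms(1) by (intro powr_mono) auto
    then show ?thesis
      using False by (simp add: add_increasing)
  qed
  then show "AE x in lborel. norm (F x) \<le> norm (indicator \<Omega> x + \<bar>F x\<bar> powr p)"
    by (auto intro: order_trans[OF _ abs_ge_self])
qed (use assms in auto)

section \<open>Weak derivatives\<close>

lemma integrable_locally_integrable_mult:
  fixes u G :: "real^'n::finite \<Rightarrow> real"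
  assumes u: "locally_integrable_on u \<Omega>" and G: "continuous_on UNIV G"
    and K: "compact K" "K \<subseteq> \<Omega>" "\<And>x. x \<notin> K \<Longrightarrow> G x = 0" and \<Omega>: "\<Omega> \<in> sets borel"
  shows "integrable (lebesgue_on \<Omega>) (\<lambda>x. u x * G x)"
proof -
  have [measurable]: "K \<in> sets borel" "G \<in> borel_measurable borel"
    using K G by (auto intro: borel_measurable_continuous_onI borel_closed[OF compact_imp_closed])
  have uK: "integrable (lebesgue_on K) u"
    using u K by (auto simp: locally_integrable_on_def)
  obtain U where U: "borel_version K u U"
    using borel_version_exists[of u K] uK by auto
  note [measurable] = borel_versionD(1)[OF U]
  have iU: "integrable lborel U"
    using borel_version_mult(2)[OF U _, of "\<lambda>_. 1"] uK by auto
  obtain B where B: "\<And>x. x \<in> K \<Longrightarrow> \<bar>G x\<bar> \<le> B"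
    using compact_imp_bounded[OF compact_continuous_image[OF continuous_on_subset[OF G] K(1)]]
    unfolding bounded_iff by (metis imageI real_norm_def subset_UNIV)
  have "integrable lborel (\<lambda>x. U x * G x)"
  proof (rule Bochner_Integration.integrable_bound)
    show "integrable lborel (\<lambda>x. B * U x)"
      using iU by simp
    have "\<bar>U x * G x\<bar> \<le> \<bar>B * U x\<bar>" for x
      using B[of x] K(3)[of x] by (cases "x \<in> K") (auto simp: abs_mult mult.commute intro!: mult_right_mono)
    then show "AE x in lborel. norm (U x * G x) \<le> norm (B * U x)"
      by simp
  qed measurable
  moreover have "AE x in lborel. x \<in> \<Omega> \<longrightarrow> u x * G x = U x * G x"
    using borel_versionD(3)[OF U] by (rule AE_mp) (use K(3) in auto)
  ultimately show ?thesis
    using integral_lebesgue_on_eq_lborel(2)[of \<Omega> "\<lambda>x. U x * G x" "\<lambda>x. u x * G x"] \<Omega> K by auto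
qed

lemma test_functionsD:
  assumes "\<psi> \<in> test_functions \<Omega>"
  shows "smooth_on UNIV \<psi>"
    and "\<exists>K R. compact K \<and> K \<subseteq> \<Omega> \<and> K \<subseteq> cball 0 R \<and> (\<forall>js x. x \<notin> K \<longrightarrow> iterated_partial js \<psi> x = 0)"
proof -
  let ?K = "closure {x. \<psi> x \<noteq> 0}"
  show sm: "smooth_on UNIV \<psi>"
    using assms by (simp add: test_functions_def)
  have K: "compact ?K" "?K \<subseteq> \<Omega>"
    using assms by (auto simp: test_functions_def)
  obtain R where "\<forall>x\<in>?K. norm x \<le> R"
    using compact_imp_bounded[OF K(1)] unfolding bounded_iff by blast
  moreover have "iterated_partial js \<psi> x = 0" if "x \<notin> ?K" for js x
  proof (rule iterated_partial_eq_0_outside)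
    show "\<psi> y = 0" if "y \<notin> ?K" for y
      using that closure_subset[of "{x. \<psi> x \<noteq> 0}"] by blast
  qed (use that in auto)
  ultimately show "\<exists>K R. compact K \<and> K \<subseteq> \<Omega> \<and> K \<subseteq> cball 0 R \<and> (\<forall>js x. x \<notin> K \<longrightarrow> iterated_partial js \<psi> x = 0)"
    using K by (intro exI[of _ ?K] exI[of _ R]) auto
qed

lemma continuous_imp_locally_integrable:
  assumes "continuous_on UNIV f"
  shows "locally_integrable_on f \<Omega>"
  unfolding locally_integrable_on_def
proof (intro allI impI)
  fix K assume K: "compact K \<and> K \<subseteq> \<Omega>"
  have [measurable]: "K \<in> sets borel" "f \<in> borel_measurable borel"
    using K assms by (auto intro: borel_measurable_continuous_onI borel_closed[OF compact_imp_closed])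
  have "integrable lborel (\<lambda>x. indicator K x *\<^sub>R f x)"
    using borel_integrable_compact[of K f] K continuous_on_subset[OF assms] by simp
  then show "integrable (lebesgue_on K) f"
    using integral_lebesgue_on_eq_lborel(2)[of K "\<lambda>x. indicator K x *\<^sub>R f x" f] by auto
qed

text \<open>The list is reversed because integration by parts moves the outermost derivative of the test
  function to \<open>\<phi>\<close> first.\<close>

lemma smooth_is_weak_deriv:
  fixes \<phi> :: "real^'n::finite \<Rightarrow> real"
  assumes \<phi>: "smooth_on UNIV \<phi>" and \<Omega>: "open \<Omega>"
  shows "is_weak_deriv \<Omega> \<nu> \<phi> (iterated_partial (rev (mi_list \<nu>)) \<phi>)"
  unfolding is_weak_deriv_def
proof (intro conjI ballI)
  show "locally_integrable_on \<phi> \<Omega>" "locally_integrable_on (iterated_partial (rev (mi_list \<nu>)) \<phi>) \<Omega>"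
    by (intro continuous_imp_locally_integrable continuous_on_iterated_partial smooth_on_UNIV_imp_continuous_on \<phi>)+
  fix \<psi> assume \<psi>: "\<psi> \<in> test_functions \<Omega>"
  obtain K R where K: "K \<subseteq> \<Omega>" "K \<subseteq> cball 0 R" "\<And>js x. x \<notin> K \<Longrightarrow> iterated_partial js \<psi> x = 0"
    using test_functionsD(2)[OF \<psi>] by blast
  have sm: "smooth_on UNIV \<psi>"
    using test_functionsD(1)[OF \<psi>] .
  have \<psi>0: "\<psi> x = 0" if "x \<notin> K" for x
    using K(3)[OF that, of "[]"] by simp
  have eq: "integral\<^sup>L (lebesgue_on \<Omega>) g = integral\<^sup>L lborel g"
    if "continuous_on UNIV g" "\<And>x. x \<notin> \<Omega> \<Longrightarrow> g x = 0" for g :: "real^'n \<Rightarrow> real"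
    by (rule integral_lebesgue_on_eq_lborel(1)) (use that \<Omega> in \<open>auto intro: borel_measurable_continuous_onI\<close>)
  have "integral\<^sup>L (lebesgue_on \<Omega>) (\<lambda>x. \<phi> x * mi_deriv \<nu> \<psi> x) = (\<integral>x. \<phi> x * iterated_partial (mi_list \<nu>) \<psi> x \<partial>lborel)"
    unfolding mi_deriv_eq using K
    by (intro eq continuous_on_mult continuous_on_iterated_partial smooth_on_UNIV_imp_continuous_on sm \<phi>) auto
  also have "\<dots> = (-1) ^ mi_order \<nu> * (\<integral>x. iterated_partial (rev (mi_list \<nu>)) \<phi> x * \<psi> x \<partial>lborel)"
    using integral_by_parts_iterated_partial[OF sm _ \<phi>, of R "mi_list \<nu>"] \<psi>0 K(2)
    by (force simp: length_mi_list)
  also have "(\<integral>x. iterated_partial (rev (mi_list \<nu>)) \<phi> x * \<psi> x \<partial>lborel)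
      = integral\<^sup>L (lebesgue_on \<Omega>) (\<lambda>x. iterated_partial (rev (mi_list \<nu>)) \<phi> x * \<psi> x)"
    using K(1) \<psi>0 subsetD[OF K(1)]
    by (intro eq[symmetric] continuous_on_mult continuous_on_iterated_partial smooth_on_UNIV_imp_continuous_on sm \<phi>) force
  finally show "integral\<^sup>L (lebesgue_on \<Omega>) (\<lambda>x. \<phi> x * mi_deriv \<nu> \<psi> x) = (-1) ^ mi_order \<nu> *
     integral\<^sup>L (lebesgue_on \<Omega>) (\<lambda>x. iterated_partial (rev (mi_list \<nu>)) \<phi> x * \<psi> x)" .
qed

lemma integrable_mult_test_function:
  assumes "locally_integrable_on u \<Omega>" "\<psi> \<in> test_functions \<Omega>" "open \<Omega>"
  shows "integrable (lebesgue_on \<Omega>) (\<lambda>x. u x * iterated_partial js \<psi> x)"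
proof -
  obtain K where "compact K" "K \<subseteq> \<Omega>" "\<And>js x. x \<notin> K \<Longrightarrow> iterated_partial js \<psi> x = 0"
    using test_functionsD(2)[OF assms(2)] by blast
  then show ?thesis
    using assms by (intro integrable_locally_integrable_mult continuous_on_iterated_partial test_functionsD(1)) auto
qed

lemma locally_integrable_on_diff:
  "locally_integrable_on u \<Omega> \<Longrightarrow> locally_integrable_on v \<Omega> \<Longrightarrow> locally_integrable_on (\<lambda>x. u x - v x) \<Omega>"
  by (auto simp: locally_integrable_on_def)

lemma is_weak_deriv_diff:
  fixes u v w z :: "real^'n::finite \<Rightarrow> real"
  assumes "is_weak_deriv \<Omega> \<nu> u v" "is_weak_deriv \<Omega> \<nu> w z" "open \<Omega>"
  shows "is_weak_deriv \<Omega> \<nu> (\<lambda>x. u x - w x) (\<lambda>x. v x - z x)"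
  unfolding is_weak_deriv_def
proof (intro conjI ballI)
  note u = assms(1)[unfolded is_weak_deriv_def] and w = assms(2)[unfolded is_weak_deriv_def]
  show "locally_integrable_on (\<lambda>x. u x - w x) \<Omega>" "locally_integrable_on (\<lambda>x. v x - z x) \<Omega>"
    using u w by (auto intro: locally_integrable_on_diff)
  fix \<psi> assume \<psi>: "\<psi> \<in> test_functions \<Omega>"
  have int: "integrable (lebesgue_on \<Omega>) (\<lambda>x. f x * mi_deriv \<nu> \<psi> x)"
    "integrable (lebesgue_on \<Omega>) (\<lambda>x. f x * \<psi> x)" if "locally_integrable_on f \<Omega>" for f
    using integrable_mult_test_function[OF that \<psi> assms(3), of "mi_list \<nu>"]
      integrable_mult_test_function[OF that \<psi> assms(3), of "[]"] by (simp_all add: mi_deriv_eq)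
  show "integral\<^sup>L (lebesgue_on \<Omega>) (\<lambda>x. (u x - w x) * mi_deriv \<nu> \<psi> x) =
     (-1) ^ mi_order \<nu> * integral\<^sup>L (lebesgue_on \<Omega>) (\<lambda>x. (v x - z x) * \<psi> x)"
    using u w \<psi> int by (simp add: left_diff_distrib right_diff_distrib)
qed

section \<open>Mollification and weak derivatives\<close>

lemma mollifier_translate_support:
  fixes y :: "real^'n::finite"
  assumes "0 < t" "mollifier t e \<nu> (y - x) \<noteq> 0"
  shows "y \<in> cball (x + t *\<^sub>R e) (t * real CARD('n))"
  using mollifier_support[OF assms] by (simp add: dist_norm norm_minus_commute algebra_simps)

text \<open>This is where the shift matters: a point \<open>x\<close> close to the boundary still gives a test function on
  \<open>\<Omega>\<close> when the ball around \<open>x + t e\<close> is contained in \<open>\<Omega>\<close>.\<close>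

lemma mollifier_translate_test_function:
  fixes x :: "real^'n::finite"
  assumes t: "0 < t" and sub: "cball (x + t *\<^sub>R e) (t * real CARD('n)) \<subseteq> \<Omega>"
  shows "(\<lambda>y. mollifier t e (\<lambda>_. 0) (y - x)) \<in> test_functions \<Omega>"
proof -
  let ?S = "{y. mollifier t e (\<lambda>_. 0) (y - x) \<noteq> 0}"
  have "?S \<subseteq> cball (x + t *\<^sub>R e) (t * real CARD('n))"
    using mollifier_translate_support[OF t] by blast
  then have cl: "closure ?S \<subseteq> cball (x + t *\<^sub>R e) (t * real CARD('n))"
    by (rule closure_minimal) simp
  then have "compact (closure ?S)"
    using compact_eq_bounded_closed bounded_subset[OF bounded_cball] by blast
  moreover have "smooth_on UNIV (\<lambda>y. mollifier t e (\<lambda>_. 0) (y - x))"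
    unfolding smooth_on_def iterated_partial_mollifier_translate(1)[OF t]
    using iterated_partial_mollifier_translate(2)[OF t] by blast
  ultimately show ?thesis
    using cl sub by (auto simp: test_functions_def)
qed

text \<open>The derivatives of the mollification fall on the mollifier, which as a function of the
  integration variable is a test function. The definition of the weak derivative moves them to \<open>u\<close>,
  and the two signs cancel.\<close>

lemma iterated_partial_mollify_weak:
  fixes u v :: "real^'n::finite \<Rightarrow> real"
  assumes wd: "is_weak_deriv \<Omega> (count_list js) u v" and U: "borel_version \<Omega> u U" "integrable lborel U"
    and V: "borel_version \<Omega> v V"
    and t: "0 < t" and sub: "cball (x + t *\<^sub>R e) (t * real CARD('n)) \<subseteq> \<Omega>" and \<Omega>: "open \<Omega>"
  shows "iterated_partial js (mollify t e (\<lambda>_. 0) U) x = mollify t e (\<lambda>_. 0) V x"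
proof -
  let ?\<psi> = "\<lambda>y. mollifier t e (\<lambda>_. 0) (y - x)"
  note borel_measurable_mollifier[OF t, measurable]
  have \<Omega>': "\<Omega> \<in> sets lebesgue"
    using \<Omega> by auto
  have mi: "mi_deriv (count_list js) ?\<psi> = (\<lambda>y. mollifier t e (count_list js) (y - x))"
    unfolding mi_deriv_eq iterated_partial_mollifier_translate(1)[OF t] by (simp add: count_list_mi_list)
  have "mollify t e (count_list js) U x = integral\<^sup>L (lebesgue_on \<Omega>) (\<lambda>y. u y * mi_deriv (count_list js) ?\<psi> y)"
    unfolding mi mollify_def by (rule borel_version_mult(1)[OF U(1) \<Omega>', symmetric]) measurable
  also have "\<dots> = (-1) ^ length js * integral\<^sup>L (lebesgue_on \<Omega>) (\<lambda>y. v y * ?\<psi> y)"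
    using wd mollifier_translate_test_function[OF t sub] by (simp add: is_weak_deriv_def mi_order_count_list)
  also have "integral\<^sup>L (lebesgue_on \<Omega>) (\<lambda>y. v y * ?\<psi> y) = mollify t e (\<lambda>_. 0) V x"
    unfolding mollify_def by (rule borel_version_mult(1)[OF V \<Omega>']) measurable
  finally show ?thesis
    by (simp add: iterated_partial_mollify[OF t U(2)])
qed

text \<open>The mollifiers at scale \<open>t n\<close> form an approximate identity even though they are not centred at
  \<open>0\<close>, since their supports shrink to \<open>0\<close>.\<close>

lemma mollify_tendsto_Lp:
  fixes F :: "real^'n::finite \<Rightarrow> real"
  assumes p: "1 \<le> p" and F: "integrable lborel F" "Lp_int p F < \<infinity>"
    and t: "\<And>n. 0 < t n" "t \<longlonglongrightarrow> 0"
  shows "(\<lambda>n. Lp_int p (\<lambda>x. mollify (t n) e (\<lambda>_. 0) F x - F x)) \<longlonglongrightarrow> 0"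
proof -
  have conv: "mollify (t n) e (\<lambda>_. 0) F x = (\<integral>y. F (x + y) * mollifier (t n) e (\<lambda>_. 0) y \<partial>lborel)" for n x
  proof -
    note borel_measurable_mollifier[OF t(1), measurable]
    have [measurable]: "F \<in> borel_measurable borel"
      using F(1) by auto
    have "mollify (t n) e (\<lambda>_. 0) F x = (\<integral>y. F y * mollifier (t n) e (\<lambda>_. 0) (y - x) \<partial>distr lborel borel ((+) x))"
      unfolding mollify_def lborel_distr_plus ..
    also have "\<dots> = (\<integral>y. F (x + y) * mollifier (t n) e (\<lambda>_. 0) (x + y - x) \<partial>lborel)"
      by (rule integral_distr) measurable
    finally show ?thesis by simp
  qed
  have "\<forall>n. \<exists>C. \<forall>y. \<bar>mollifier (t n) e (\<lambda>_. 0) y\<bar> \<le> C"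
    using mollifier_bounded t(1) by blast
  then obtain C where C: "\<And>n y. \<bar>mollifier (t n) e (\<lambda>_. 0) y\<bar> \<le> C n"
    by metis
  show ?thesis
    unfolding conv
  proof (rule approximate_identity_tendsto_Lp[OF p F])
    show "mollifier (t n) e (\<lambda>_. 0) y \<le> C n" for n y
      using C[of n y] by simp
    show "norm y \<le> t n * (real CARD('n) + norm e)" if "mollifier (t n) e (\<lambda>_. 0) y \<noteq> 0" for n y
      using mollifier_support[OF t(1) that] norm_triangle_ineq[of "y - t n *\<^sub>R e" "t n *\<^sub>R e"] t(1)[of n]
      by (simp add: algebra_simps)
    show "(\<lambda>n. t n * (real CARD('n) + norm e)) \<longlonglongrightarrow> 0"
      using t(2) by (rule tendsto_mult_left_zero)
  qed (use t in \<open>auto simp: mollifier_nonneg integrable_mollifier integral_mollifier\<close>)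
qed

lemma Lp_int_eq_0_imp_AE:
  fixes f :: "'a::euclidean_space \<Rightarrow> real"
  assumes "Lp_int p f = 0" "f \<in> borel_measurable borel"
  shows "AE x in lborel. f x = 0"
proof -
  note assms(2)[measurable]
  have "AE x in lborel. ennreal (\<bar>f x\<bar> powr p) = 0"
    using assms(1) unfolding Lp_int_def by (subst (asm) nn_integral_0_iff_AE) auto
  then show ?thesis
    by (rule AE_mp) auto
qed

text \<open>The fundamental lemma of the calculus of variations. On a small ball the mollifications of \<open>w\<close>
  at small scales vanish, because they are integrals against test functions; on the other hand they converge to \<open>w\<close>
  in \<open>L\<^sup>1\<close>.\<close>

lemma locally_integrable_eq_0_of_test_functions:
  fixes w :: "real^'n::finite \<Rightarrow> real"
  assumes \<Omega>: "open \<Omega>" and w: "locally_integrable_on w \<Omega>"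
    and zero: "\<And>\<psi>. \<psi> \<in> test_functions \<Omega> \<Longrightarrow> integral\<^sup>L (lebesgue_on \<Omega>) (\<lambda>x. w x * \<psi> x) = 0"
  shows "AE x in lebesgue. x \<in> \<Omega> \<longrightarrow> w x = 0"
proof -
  define t where "t = (\<lambda>n. 1 / real (Suc n))"
  have t: "0 < t n" "t \<longlonglongrightarrow> 0" for n
    unfolding t_def using LIMSEQ_inverse_real_of_nat by (auto simp: inverse_eq_divide)
  have "negligible {x \<in> \<Omega>. w x \<noteq> 0}"
  proof (subst locally_negligible_alt, intro ballI)
    fix x0 assume "x0 \<in> {x \<in> \<Omega>. w x \<noteq> 0}"
    then obtain \<rho>' where \<rho>': "0 < \<rho>'" "cball x0 \<rho>' \<subseteq> \<Omega>"
      using \<Omega> open_contains_cball by blast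
    define \<rho> where "\<rho> = \<rho>' / 2"
    have \<rho>: "0 < \<rho>" "cball x0 (2 * \<rho>) \<subseteq> \<Omega>"
      using \<rho>' by (auto simp: \<rho>_def)
    let ?K = "cball x0 (2 * \<rho>)"
    have wK: "integrable (lebesgue_on ?K) w"
      using w \<rho> by (auto simp: locally_integrable_on_def)
    then obtain F where F: "borel_version ?K w F"
      using borel_version_exists[of w ?K] by auto
    note [measurable] = borel_versionD(1)[OF F]
    have iF: "integrable lborel F"
      using borel_version_mult(2)[OF F _, of "\<lambda>_. 1"] wK by auto
    then have "Lp_int 1 F < \<infinity>"
      by (simp add: Lp_int_def integrable_iff_bounded)
    note lim = mollify_tendsto_Lp[OF order_refl iF this t, of 0]
    have "\<forall>\<^sub>F n in sequentially. t n * real CARD('n) < \<rho>"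
      using tendsto_mult_left_zero[OF t(2)] \<rho>(1) by (rule order_tendstoD)
    then have ev: "\<forall>\<^sub>F n in sequentially. Lp_int 1 (\<lambda>x. indicator (ball x0 \<rho>) x * F x)
        \<le> Lp_int 1 (\<lambda>x. mollify (t n) 0 (\<lambda>_. 0) F x - F x)"
    proof (rule eventually_mono)
      fix n assume n: "t n * real CARD('n) < \<rho>"
      have m0: "mollify (t n) 0 (\<lambda>_. 0) F x = 0" if x: "x \<in> ball x0 \<rho>" for x
      proof -
        let ?\<psi> = "\<lambda>y. mollifier (t n) 0 (\<lambda>_. 0) (y - x)"
        have sub: "cball (x + t n *\<^sub>R 0) (t n * real CARD('n)) \<subseteq> ?K"
        proof
          fix y assume "y \<in> cball (x + t n *\<^sub>R 0) (t n * real CARD('n))"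
          then have "dist x y \<le> \<rho>" using n by simp
          then show "y \<in> ?K" using x dist_triangle[of x0 y x] by simp
        qed
        then have \<psi>: "?\<psi> \<in> test_functions \<Omega>"
          using \<rho>(2) by (intro mollifier_translate_test_function t) blast
        note [measurable] = borel_measurable_mollifier[OF t(1)[of n]]
        have "0 = integral\<^sup>L (lebesgue_on \<Omega>) (\<lambda>y. w y * ?\<psi> y)"
          using zero[OF \<psi>] by simp
        also have "\<dots> = (\<integral>y. F y * ?\<psi> y \<partial>lborel)"
        proof (rule integral_lebesgue_on_eq_lborel(1))
          have "?\<psi> y = 0" if "y \<notin> ?K" for y
            using mollifier_translate_support[OF t(1)] sub that by blast
          then show "AE y in lborel. y \<in> \<Omega> \<longrightarrow> w y * ?\<psi> y = F y * ?\<psi> y"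
            using borel_versionD(3)[OF F] by (auto elim: AE_mp)
          show "F y * ?\<psi> y = 0" if "y \<notin> \<Omega>" for y
          proof -
            have "y \<notin> ?K" using \<rho>(2) that by blast
            from borel_versionD(2)[OF F this] show ?thesis by simp
          qed
        qed (use \<Omega> in auto)
        finally show ?thesis
          by (simp add: mollify_def)
      qed
      show "Lp_int 1 (\<lambda>x. indicator (ball x0 \<rho>) x * F x) \<le> Lp_int 1 (\<lambda>x. mollify (t n) 0 (\<lambda>_. 0) F x - F x)"
        unfolding Lp_int_def by (intro nn_integral_mono) (use m0 in \<open>auto simp: indicator_def\<close>)
    qed
    have "Lp_int 1 (\<lambda>x. indicator (ball x0 \<rho>) x * F x) \<le> 0"
      using lim ev by (intro tendsto_le[OF _ lim tendsto_const]) auto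
    then have "AE x in lborel. indicator (ball x0 \<rho>) x * F x = 0"
      by (intro Lp_int_eq_0_imp_AE[of 1] borel_measurable_times borel_measurable_indicator) auto
    then have "AE x in lborel. \<not> (x \<in> ball x0 \<rho> \<and> w x \<noteq> 0)"
      using borel_versionD(3)[OF F]
    proof eventually_elim
      case (elim x)
      then show ?case using \<rho>(1) by (auto simp: indicator_def)
    qed
    then have "AE x in lebesgue. \<not> (x \<in> ball x0 \<rho> \<and> w x \<noteq> 0)"
      by (rule AE_completion)
    then obtain N where N: "negligible N" "{x \<in> space lebesgue. \<not> \<not> (x \<in> ball x0 \<rho> \<and> w x \<noteq> 0)} \<subseteq> N"
      unfolding eventually_ae_filter negligible_iff_null_sets by blast
    have neg: "negligible {x. x \<in> ball x0 \<rho> \<and> w x \<noteq> 0}"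
      by (rule negligible_subset[OF N(1)]) (use N(2) in auto)
    show "\<exists>U. openin (top_of_set {x \<in> \<Omega>. w x \<noteq> 0}) U \<and> x0 \<in> U \<and> negligible U"
    proof (intro exI conjI)
      show "openin (top_of_set {x \<in> \<Omega>. w x \<noteq> 0}) ({x \<in> \<Omega>. w x \<noteq> 0} \<inter> ball x0 \<rho>)"
        by auto
      show "x0 \<in> {x \<in> \<Omega>. w x \<noteq> 0} \<inter> ball x0 \<rho>"
        using \<open>x0 \<in> {x \<in> \<Omega>. w x \<noteq> 0}\<close> \<rho> by auto
      show "negligible ({x \<in> \<Omega>. w x \<noteq> 0} \<inter> ball x0 \<rho>)"
        by (rule negligible_subset[OF neg]) auto
    qed
  qed
  then show ?thesis
    by (auto simp: negligible_iff_null_sets elim!: AE_mp[OF AE_not_in])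
qed

lemma is_weak_deriv_unique:
  fixes u v z :: "real^'n::finite \<Rightarrow> real"
  assumes "is_weak_deriv \<Omega> \<nu> u v" "is_weak_deriv \<Omega> \<nu> u z" "open \<Omega>"
  shows "AE x in lebesgue. x \<in> \<Omega> \<longrightarrow> v x = z x"
proof -
  have "is_weak_deriv \<Omega> \<nu> (\<lambda>x. u x - u x) (\<lambda>x. v x - z x)"
    by (rule is_weak_deriv_diff[OF assms])
  then have "AE x in lebesgue. x \<in> \<Omega> \<longrightarrow> v x - z x = 0"
    using assms(3) by (intro locally_integrable_eq_0_of_test_functions) (auto simp: is_weak_deriv_def)
  then show ?thesis by simp
qed

section \<open>Shift directions at Lipschitz boundaries\<close>

text \<open>The direction \<open>e\<close> points downwards with length \<open>L + 1\<close>. Moving by \<open>t e\<close> and then by at most \<open>t\<close>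
  lowers the last coordinate by at least \<open>L t\<close>, while the remaining coordinates move by at most \<open>t\<close>, so
  that the graph drops by at most \<open>L t\<close>.\<close>

lemma lipschitz_subgraph_cone:
  fixes G U :: "(real^'n::finite) set"
  assumes "lipschitz_subgraph_in L G U"
  shows "\<exists>e. \<forall>x\<in>U. \<forall>y\<in>U. \<forall>t. x \<in> G \<longrightarrow> norm (y - (x + t *\<^sub>R e)) \<le> t \<longrightarrow> y \<in> G"
proof -
  obtain T :: "real^'n \<Rightarrow> real^'n" and a k \<phi> where T: "orthogonal_transformation T"
    and lip: "L-lipschitz_on {y :: real^'n. y $ k = 0} \<phi>"
    and G: "G \<inter> U = {x \<in> U. T (x - a) $ k < \<phi> (\<chi> j. if j = k then 0 else T (x - a) $ j)}"
    using assms unfolding lipschitz_subgraph_in_def by blast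
  obtain w where w: "T w = axis k 1"
    using orthogonal_transformation_surj[OF T] by (metis surjD)
  have lin: "linear T"
    using T by (rule orthogonal_transformation_linear)
  define P :: "real^'n \<Rightarrow> real^'n" where "P = (\<lambda>v. \<chi> j. if j = k then 0 else v $ j)"
  have L: "0 \<le> L"
    using lip by (rule lipschitz_on_nonneg)
  have "y \<in> G" if x: "x \<in> U" and y: "y \<in> U" and xG: "x \<in> G" and le: "norm (y - (x + t *\<^sub>R (- (L + 1) *\<^sub>R w))) \<le> t" for x y t
  proof -
    define z where "z = y - (x + t *\<^sub>R (- (L + 1) *\<^sub>R w))"
    have z: "norm (T z) \<le> t"
      using le orthogonal_transformation_norm[OF T] by (simp add: z_def)
    have "y - a = (x - a) - (t * (L + 1)) *\<^sub>R w + z"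
      by (simp add: z_def algebra_simps)
    then have Ty: "T (y - a) = T (x - a) - (t * (L + 1)) *\<^sub>R axis k 1 + T z"
      by (simp add: linear_add[OF lin] linear_diff[OF lin] linear_scale[OF lin] w)
    then have Py: "P (T (y - a)) = P (T (x - a)) + P (T z)"
      by (simp add: P_def vec_eq_iff axis_def)
    have "norm (P (T z)) \<le> norm (T z)"
      by (rule norm_le_componentwise_cart) (simp add: P_def)
    then have "dist (P (T (y - a))) (P (T (x - a))) \<le> t"
      using z by (simp add: Py dist_norm)
    moreover have "dist (\<phi> (P (T (y - a)))) (\<phi> (P (T (x - a)))) \<le> L * dist (P (T (y - a))) (P (T (x - a)))"
      by (rule lipschitz_onD[OF lip]) (simp_all add: P_def)
    ultimately have "dist (\<phi> (P (T (y - a)))) (\<phi> (P (T (x - a)))) \<le> L * t"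
      using L by (meson mult_left_mono order_trans)
    then have 1: "\<phi> (P (T (x - a))) - L * t \<le> \<phi> (P (T (y - a)))"
      by (simp add: dist_real_def)
    have "(T z) $ k \<le> t"
      using z component_le_norm_cart[of "T z" k] by simp
    then have 2: "T (y - a) $ k \<le> T (x - a) $ k - L * t"
      by (simp add: Ty algebra_simps)
    have "T (x - a) $ k < \<phi> (P (T (x - a)))"
      using x xG G by (auto simp: P_def)
    with 1 2 have "T (y - a) $ k < \<phi> (P (T (y - a)))"
      by simp
    then have "y \<in> G \<inter> U"
      unfolding G using y by (simp add: P_def)
    then show ?thesis by blast
  qed
  then show ?thesis by blast
qed

text \<open>At the boundary of \<open>\<Omega>\<close> the cone direction of \<open>\<Omega>\<close> is used, at the boundary of \<open>D\<close> the
  negative of the cone direction of \<open>D\<close>: if it led from a point outside \<open>D\<close> into \<open>D\<close>, then the cone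
  direction would lead from there back into \<open>D\<close>. The closure of \<open>D\<close> lies inside \<open>\<Omega>\<close>, so the two
  cases do not interfere.\<close>

lemma local_shift_direction:
  fixes \<Omega> D :: "(real^'n::finite) set"
  assumes \<Omega>: "open \<Omega>" "lipschitz_boundary \<Omega>" and D: "open D" "closure D \<subseteq> \<Omega>" "lipschitz_boundary D"
    and x0: "x0 \<in> closure \<Omega>" and c: "0 \<le> c"
  shows "\<exists>e r t0. 0 < r \<and> 0 < t0 \<and> (\<forall>x\<in>ball x0 r. \<forall>t. 0 < t \<longrightarrow> t \<le> t0 \<longrightarrow>
    (x \<in> \<Omega> \<longrightarrow> cball (x + t *\<^sub>R e) (t * c) \<subseteq> \<Omega>) \<and>
    (x \<in> \<Omega> - D \<longrightarrow> cball (x + t *\<^sub>R e) (t * c) \<subseteq> \<Omega> - D))"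
proof -
  have "\<exists>e. \<exists>\<rho>>0. \<forall>x\<in>ball x0 \<rho>. \<forall>y\<in>ball x0 \<rho>. \<forall>t. norm (y - (x + t *\<^sub>R e)) \<le> t \<longrightarrow>
      (x \<in> \<Omega> \<longrightarrow> y \<in> \<Omega>) \<and> (x \<in> \<Omega> - D \<longrightarrow> y \<in> \<Omega> - D)"
  proof -
    consider "x0 \<in> frontier \<Omega>" | "x0 \<in> frontier D" | "x0 \<in> \<Omega>" "x0 \<in> D" | "x0 \<in> \<Omega>" "x0 \<notin> closure D"
      using x0 \<Omega>(1) D(1) by (auto simp: frontier_def interior_open)
    then show ?thesis
    proof cases
      case 1
      then have "x0 \<notin> closure D"
        using D(2) \<Omega>(1) by (auto simp: frontier_def interior_open)
      obtain U L where U: "open U" "x0 \<in> U" "lipschitz_subgraph_in L \<Omega> U"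
        using \<Omega>(2) 1 unfolding lipschitz_boundary_def by blast
      obtain e where e: "\<And>x y t. x \<in> U \<Longrightarrow> y \<in> U \<Longrightarrow> x \<in> \<Omega> \<Longrightarrow> norm (y - (x + t *\<^sub>R e)) \<le> t \<Longrightarrow> y \<in> \<Omega>"
        using lipschitz_subgraph_cone[OF U(3)] by blast
      have "open (U - closure D)"
        using U(1) by (intro open_Diff) auto
      then obtain \<rho> where "0 < \<rho>" "ball x0 \<rho> \<subseteq> U - closure D"
        using U(2) \<open>x0 \<notin> closure D\<close> open_contains_ball by blast
      then show ?thesis
        using e closure_subset[of D] by (intro exI[of _ e] exI[of _ \<rho>]) blast
    next
      case 2
      then obtain U L where U: "open U" "x0 \<in> U" "lipschitz_subgraph_in L D U"
        using D(3) unfolding lipschitz_boundary_def by blast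
      obtain e where e: "\<And>x y t. x \<in> U \<Longrightarrow> y \<in> U \<Longrightarrow> x \<in> D \<Longrightarrow> norm (y - (x + t *\<^sub>R e)) \<le> t \<Longrightarrow> y \<in> D"
        using lipschitz_subgraph_cone[OF U(3)] by blast
      have "x0 \<in> \<Omega>"
        using 2 D(2) by (auto simp: frontier_def)
      then obtain \<rho> where \<rho>: "0 < \<rho>" "ball x0 \<rho> \<subseteq> U \<inter> \<Omega>"
        using U open_contains_ball[of "U \<inter> \<Omega>"] open_Int[OF U(1) \<Omega>(1)] by blast
      have "y \<notin> D" if "x \<in> U" "y \<in> U" "x \<notin> D" "norm (y - (x + t *\<^sub>R (- e))) \<le> t" for x y t
      proof
        assume "y \<in> D"
        moreover have "norm (x - (y + t *\<^sub>R e)) \<le> t"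
          using that(4) norm_minus_commute[of "x - t *\<^sub>R e" y] by (simp add: algebra_simps)
        ultimately show False
          using e[OF that(2,1)] that(3) by blast
      qed
      then show ?thesis
        using \<rho> by (intro exI[of _ "- e"] exI[of _ \<rho>]) blast
    next
      case 3
      then obtain \<rho> where "0 < \<rho>" "ball x0 \<rho> \<subseteq> D"
        using D(1) open_contains_ball by blast
      then show ?thesis
        using D(2) closure_subset[of D] by (intro exI[of _ 0] exI[of _ \<rho>]) blast
    next
      case 4
      have "open (\<Omega> - closure D)"
        using \<Omega>(1) by (intro open_Diff) auto
      then obtain \<rho> where "0 < \<rho>" "ball x0 \<rho> \<subseteq> \<Omega> - closure D"
        using 4 open_contains_ball by blast
      then show ?thesis
        using closure_subset[of D] by (intro exI[of _ 0] exI[of _ \<rho>]) blast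
    qed
  qed
  then obtain e \<rho> where \<rho>: "0 < \<rho>"
    and e: "\<And>x y t. x \<in> ball x0 \<rho> \<Longrightarrow> y \<in> ball x0 \<rho> \<Longrightarrow> norm (y - (x + t *\<^sub>R e)) \<le> t \<Longrightarrow>
      (x \<in> \<Omega> \<longrightarrow> y \<in> \<Omega>) \<and> (x \<in> \<Omega> - D \<longrightarrow> y \<in> \<Omega> - D)"
    by blast
  define N where "N = norm (c *\<^sub>R e) + c"
  have N: "0 \<le> N" using c by (simp add: N_def)
  \<comment> \<open>A displacement by \<open>t (c e)\<close> and a radius \<open>t c\<close> move a point by at most \<open>t N\<close>. For \<open>t \<le> t0\<close> this
    is less than \<open>\<rho> / 2\<close>, so points of the ball of radius \<open>\<rho> / 2\<close> stay in the ball of radius \<open>\<rho>\<close>.\<close>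
  define t0 where "t0 = \<rho> / 2 / (N + 1)"
  have t0: "0 < t0" "t0 * N < \<rho> / 2"
    using \<rho> N by (auto simp: t0_def field_simps)
  have y: "(x \<in> \<Omega> \<longrightarrow> y \<in> \<Omega>) \<and> (x \<in> \<Omega> - D \<longrightarrow> y \<in> \<Omega> - D)"
    if x: "x \<in> ball x0 (\<rho> / 2)" and t: "0 < t" "t \<le> t0" and y: "y \<in> cball (x + t *\<^sub>R (c *\<^sub>R e)) (t * c)" for x t y
  proof (rule e)
    show "x \<in> ball x0 \<rho>" using x \<rho> by auto
    show le: "norm (y - (x + (t * c) *\<^sub>R e)) \<le> t * c"
      using y by (simp add: dist_norm norm_minus_commute)
    have "norm (y - x) \<le> norm (y - (x + (t * c) *\<^sub>R e)) + norm ((t * c) *\<^sub>R e)"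
      using norm_triangle_ineq[of "y - (x + (t * c) *\<^sub>R e)" "(t * c) *\<^sub>R e"] by simp
    also have "\<dots> \<le> t * N"
      using le t c by (simp add: N_def abs_mult distrib_left mult.assoc)
    also have "\<dots> \<le> t0 * N"
      using t N by (intro mult_right_mono) auto
    finally have "dist x y < \<rho> / 2"
      using t0 by (simp add: dist_norm norm_minus_commute)
    then show "y \<in> ball x0 \<rho>"
      using x dist_triangle[of x0 y x] by simp
  qed
  show ?thesis
    using \<rho> t0(1) y by (intro exI[of _ "c *\<^sub>R e"] exI[of _ "\<rho> / 2"] exI[of _ t0]) (auto 0 3)
qed

section \<open>Smooth partitions of unity\<close>

text \<open>Disjointness of the sets \<open>A a\<close> is expressed by the sum of their indicator functions, which is
  the form in which it is mollified.\<close>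

lemma measurable_partition_of_cover:
  assumes "finite X" "\<And>a. a \<in> X \<Longrightarrow> B a \<in> sets M"
  shows "\<exists>A. (\<forall>a\<in>X. A a \<in> sets M \<and> A a \<subseteq> B a) \<and>
    (\<forall>y. (\<Sum>a\<in>X. indicator (A a) y) = (indicator (\<Union>a\<in>X. B a) y :: real))"
  using assms
proof induction
  case (insert b X)
  then obtain A where A: "\<And>a. a \<in> X \<Longrightarrow> A a \<in> sets M \<and> A a \<subseteq> B a"
    "\<And>y. (\<Sum>a\<in>X. indicator (A a) y) = (indicator (\<Union>a\<in>X. B a) y :: real)"
    by auto
  let ?A = "A(b := B b - (\<Union>a\<in>X. B a))"
  have "?A a \<in> sets M \<and> ?A a \<subseteq> B a" if "a \<in> insert b X" for a
    using that A(1) insert(1,4) by (auto intro!: sets.Diff sets.finite_UN)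
  moreover have "(\<Sum>a\<in>insert b X. indicator (?A a) y) = (indicator (\<Union>a\<in>insert b X. B a) y :: real)" for y
  proof -
    have "(\<Sum>a\<in>X. indicator (?A a) y) = (\<Sum>a\<in>X. indicator (A a) y :: real)"
      using insert by (intro sum.cong) auto
    then have "(\<Sum>a\<in>insert b X. indicator (?A a) y)
        = indicator (B b - (\<Union>a\<in>X. B a)) y + (indicator (\<Union>a\<in>X. B a) y :: real)"
      using insert A(2) by simp
    then show ?thesis
      by (auto simp: indicator_def split: if_splits)
  qed
  ultimately show ?case by (intro exI[of _ ?A]) auto
qed auto

text \<open>Mollify the indicator functions of a measurable partition. As the indicator functions
  add up to \<open>1\<close> on a neighbourhood of \<open>S\<close>, so do their mollifications on \<open>S\<close>.\<close>

lemma smooth_partition_of_unity: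
  fixes S :: "(real^'n::finite) set"
  assumes S: "compact S" and r: "\<And>a. a \<in> S \<Longrightarrow> 0 < r a"
  obtains X \<zeta> where "finite X" "X \<subseteq> S" "\<And>a. smooth_on UNIV (\<zeta> a)"
    "\<And>a js. \<exists>B. \<forall>x. \<bar>iterated_partial js (\<zeta> a) x\<bar> \<le> B"
    "\<And>a js x. a \<in> X \<Longrightarrow> x \<notin> ball a (r a) \<Longrightarrow> iterated_partial js (\<zeta> a) x = 0"
    "\<And>x. x \<in> S \<Longrightarrow> (\<Sum>a\<in>X. \<zeta> a x) = 1"
proof -
  let ?n = "real CARD('n)"
  let ?B = "\<lambda>a. ball a (r a / 2)"
  have "S \<subseteq> (\<Union>a\<in>S. ?B a)"
    using r by force
  then obtain X where X: "X \<subseteq> S" "finite X" "S \<subseteq> (\<Union>a\<in>X. ?B a)"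
    using compactE_image[OF S, of S ?B] by auto
  define W where "W = (\<Union>a\<in>X. ?B a)"
  have W: "open W" "S \<subseteq> W"
    using X by (auto simp: W_def)
  obtain \<epsilon> where "0 < \<epsilon>" "(\<Union>x\<in>S. cball x \<epsilon>) \<subseteq> W"
    using compact_subset_open_imp_cball_epsilon_subset[OF S W] by auto
  then have \<epsilon>: "0 < \<epsilon>" "\<And>x. x \<in> S \<Longrightarrow> cball x \<epsilon> \<subseteq> W"
    by blast+
  \<comment> \<open>A mollifier whose support has radius \<open>d\<close> sees only \<open>W\<close> from points of \<open>S\<close>, and it enlarges the
    pieces of the partition, which lie in balls of radius \<open>r a / 2\<close>, by at most \<open>r a / 4\<close>.\<close>
  define d where "d = Min (insert \<epsilon> ((\<lambda>a. r a / 4) ` X))"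
  have "d \<le> r a / 4" if "a \<in> X" for a
    unfolding d_def using X(2) that by (intro Min_le) auto
  moreover have "0 < d" "d \<le> \<epsilon>"
    using X \<epsilon> r by (auto simp: d_def)
  ultimately have d: "0 < d" "d \<le> \<epsilon>" "\<And>a. a \<in> X \<Longrightarrow> d \<le> r a / 4"
    by blast+
  define \<delta> where "\<delta> = d / ?n"
  have \<delta>: "0 < \<delta>" "\<delta> * ?n = d"
    using d by (auto simp: \<delta>_def)
  note borel_measurable_mollifier[OF \<delta>(1), measurable]
  obtain A where A: "\<And>a. a \<in> X \<Longrightarrow> A a \<in> sets borel" "\<And>a. a \<in> X \<Longrightarrow> A a \<subseteq> ?B a"
    "\<And>y. (\<Sum>a\<in>X. indicator (A a) y) = (indicator W y :: real)"
    using measurable_partition_of_cover[OF X(2), of ?B borel] by (auto simp: W_def)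
  define F where "F = (\<lambda>a. if a \<in> X then indicator (A a) else (\<lambda>_. 0) :: real^'n \<Rightarrow> real)"
  have F: "integrable lborel (F a)" for a
  proof (cases "a \<in> X")
    case True
    have "emeasure lborel (A a) < \<infinity>"
      by (rule emeasure_bounded_finite[OF bounded_subset[OF bounded_ball A(2)[OF True]]])
    then show ?thesis
      using True A(1) by (simp add: F_def)
  qed (simp add: F_def)
  define \<zeta> where "\<zeta> = (\<lambda>a. mollify \<delta> 0 (\<lambda>_. 0) (F a))"
  show thesis
  proof (rule that[of X \<zeta>])
    show "smooth_on UNIV (\<zeta> a)" for a
      unfolding \<zeta>_def by (rule smooth_on_mollify[OF \<delta>(1) F])
    show "\<exists>B. \<forall>x. \<bar>iterated_partial js (\<zeta> a) x\<bar> \<le> B" for a js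
      using mollify_bounded[OF \<delta>(1) F]
      by (simp add: \<zeta>_def iterated_partial_mollify[OF \<delta>(1) F] abs_mult power_abs)
    show "iterated_partial js (\<zeta> a) x = 0" if a: "a \<in> X" and x: "x \<notin> ball a (r a)" for a js x
    proof (rule iterated_partial_eq_0_outside[of "cball a (3 / 4 * r a)"])
      fix z assume z: "z \<notin> cball a (3 / 4 * r a)"
      have "F a y * mollifier \<delta> 0 (\<lambda>_. 0) (y - z) = 0" for y
      proof (rule ccontr)
        assume *: "F a y * mollifier \<delta> 0 (\<lambda>_. 0) (y - z) \<noteq> 0"
        then have "y \<in> A a"
          using a by (auto simp: F_def indicator_def split: if_splits)
        then have "dist a y < r a / 2"
          using A(2)[OF a] by auto
        moreover have "y \<in> cball (z + \<delta> *\<^sub>R 0) (\<delta> * ?n)"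
          using * by (intro mollifier_translate_support[OF \<delta>(1)]) auto
        then have "dist z y \<le> r a / 4"
          using d(3)[OF a] \<delta> by simp
        ultimately show False
          using z dist_triangle[of a z y] by (simp add: dist_commute)
      qed
      then have "(\<lambda>y. F a y * mollifier \<delta> 0 (\<lambda>_. 0) (y - z)) = (\<lambda>y. 0)"
        by (intro ext)
      then show "\<zeta> a z = 0"
        by (simp only: \<zeta>_def mollify_def integral_zero)
    next
      have "0 < r a" using a X r by auto
      then show "x \<notin> cball a (3 / 4 * r a)" using x by auto
    qed simp
    show "(\<Sum>a\<in>X. \<zeta> a x) = 1" if x: "x \<in> S" for x
    proof -
      have int: "integrable lborel (\<lambda>y. F a y * mollifier \<delta> 0 (\<lambda>_. 0) (y - x))" for a
      proof -
        obtain C where C: "\<And>y :: real^'n. \<bar>mollifier \<delta> 0 (\<lambda>_. 0) y\<bar> \<le> C"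
          using mollifier_bounded[OF \<delta>(1)] by blast
        show ?thesis
        proof (rule Bochner_Integration.integrable_bound)
          show "integrable lborel (\<lambda>y. C * F a y)"
            using F by simp
          have [measurable]: "F a \<in> borel_measurable borel"
            using F[of a] by auto
          show "(\<lambda>y. F a y * mollifier \<delta> 0 (\<lambda>_. 0) (y - x)) \<in> borel_measurable lborel"
            by measurable
          have "\<bar>F a y * mollifier \<delta> 0 (\<lambda>_. 0) (y - x)\<bar> \<le> \<bar>C * F a y\<bar>" for y
            using mult_right_mono[OF order_trans[OF C[of "y - x"] abs_ge_self], of "\<bar>F a y\<bar>"]
            by (simp add: abs_mult mult.commute)
          then show "AE y in lborel. norm (F a y * mollifier \<delta> 0 (\<lambda>_. 0) (y - x)) \<le> norm (C * F a y)"
            by simp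
        qed
      qed
      have "(\<Sum>a\<in>X. \<zeta> a x) = (\<integral>y. (\<Sum>a\<in>X. F a y * mollifier \<delta> 0 (\<lambda>_. 0) (y - x)) \<partial>lborel)"
        unfolding \<zeta>_def mollify_def using int by (simp add: Bochner_Integration.integral_sum)
      also have "(\<lambda>y. \<Sum>a\<in>X. F a y * mollifier \<delta> 0 (\<lambda>_. 0) (y - x)) = (\<lambda>y. mollifier \<delta> 0 (\<lambda>_. 0) (y + - x))"
      proof
        fix y
        have "(\<Sum>a\<in>X. F a y * mollifier \<delta> 0 (\<lambda>_. 0) (y - x)) = indicator W y * mollifier \<delta> 0 (\<lambda>_. 0) (y - x)"
          using A(3)[of y] by (simp add: F_def flip: sum_distrib_right)
        also have "\<dots> = mollifier \<delta> 0 (\<lambda>_. 0) (y - x)"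
        proof (cases "mollifier \<delta> 0 (\<lambda>_. 0) (y - x) = 0")
          case False
          then have "y \<in> cball x \<epsilon>"
            using mollifier_translate_support[OF \<delta>(1) False] d(2) \<delta> by simp
          then show ?thesis
            using \<epsilon>(2)[OF x] by auto
        qed simp
        finally show "(\<Sum>a\<in>X. F a y * mollifier \<delta> 0 (\<lambda>_. 0) (y - x)) = mollifier \<delta> 0 (\<lambda>_. 0) (y + - x)"
          by simp
      qed
      also have "(\<integral>y. mollifier \<delta> 0 (\<lambda>_. 0) (y + - x) \<partial>lborel) = 1"
        using integrable_lborel_translate(2)[OF integrable_mollifier[OF \<delta>(1)], of 0 "\<lambda>_. 0" "- x"] integral_mollifier[OF \<delta>(1)]
        by simp
      finally show ?thesis .
    qed
  qed (use X in auto)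
qed

section \<open>Null sequences in \<open>L\<^sup>p\<close>\<close>

definition Lp_null :: "real \<Rightarrow> (nat \<Rightarrow> 'a::euclidean_space \<Rightarrow> real) \<Rightarrow> bool" where
  "Lp_null p f \<longleftrightarrow> (\<forall>k. f k \<in> borel_measurable borel) \<and> (\<lambda>k. Lp_int p (f k)) \<longlonglongrightarrow> 0"

lemma Lp_null_zero: "Lp_null p (\<lambda>k x. 0)"
  by (simp add: Lp_null_def Lp_int_def)

text \<open>The bound is required for large \<open>k\<close> only, because the balls seen by shifted mollifiers stay
  inside a domain only when the scale is small.\<close>

lemma Lp_null_dominated:
  assumes "Lp_null p f" "0 \<le> p" "0 \<le> B"
    and g: "\<And>k. g k \<in> borel_measurable borel" and le: "\<forall>\<^sub>F k in sequentially. \<forall>x. \<bar>g k x\<bar> \<le> B * \<bar>f k x\<bar>"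
  shows "Lp_null p g"
proof -
  have "(\<lambda>k. ennreal (B powr p) * Lp_int p (f k)) \<longlonglongrightarrow> ennreal (B powr p) * 0"
    using assms(1) by (intro ennreal_tendsto_cmult) (auto simp: Lp_null_def)
  then have lim: "(\<lambda>k. ennreal (B powr p) * Lp_int p (f k)) \<longlonglongrightarrow> 0"
    by simp
  have "\<forall>\<^sub>F k in sequentially. Lp_int p (g k) \<le> ennreal (B powr p) * Lp_int p (f k)"
    using le by (rule eventually_mono) (use assms in \<open>auto intro!: Lp_int_mult_le simp: Lp_null_def\<close>)
  then have "(\<lambda>k. Lp_int p (g k)) \<longlonglongrightarrow> 0"
    using lim by (intro tendsto_sandwich[OF _ _ tendsto_const lim]) auto
  with g show ?thesis
    by (simp add: Lp_null_def)
qed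

lemma Lp_null_add:
  assumes p: "1 \<le> p" and f: "Lp_null p f" and g: "Lp_null p g"
  shows "Lp_null p (\<lambda>k x. f k x + g k x)"
proof -
  have [measurable]: "f k \<in> borel_measurable borel" "g k \<in> borel_measurable borel" for k
    using f g by (auto simp: Lp_null_def)
  have "(\<lambda>k. ennreal (2 powr p) * (Lp_int p (f k) + Lp_int p (g k))) \<longlonglongrightarrow> ennreal (2 powr p) * (0 + 0)"
    using f g by (intro ennreal_tendsto_cmult tendsto_add) (auto simp: Lp_null_def)
  then have lim: "(\<lambda>k. ennreal (2 powr p) * (Lp_int p (f k) + Lp_int p (g k))) \<longlonglongrightarrow> 0"
    by simp
  have "(\<lambda>k. Lp_int p (\<lambda>x. f k x + g k x)) \<longlonglongrightarrow> 0"
    by (rule tendsto_sandwich[OF _ _ tendsto_const lim]) (auto intro!: always_eventually Lp_int_add_le p)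
  then show ?thesis
    by (simp add: Lp_null_def)
qed

lemma Lp_null_sum:
  assumes p: "1 \<le> p" and "\<And>a. a \<in> I \<Longrightarrow> Lp_null p (f a)"
  shows "Lp_null p (\<lambda>k x. \<Sum>a\<in>I. f a k x)"
  using assms(2)
proof (induction I rule: infinite_finite_induct)
  case (insert a I)
  then show ?case
    using Lp_null_add[OF p, of "f a" "\<lambda>k x. \<Sum>a\<in>I. f a k x"] by simp
qed (simp_all add: Lp_null_zero)

lemma Lp_null_sum_list:
  assumes p: "1 \<le> p" and "\<And>s. s \<in> set xs \<Longrightarrow> Lp_null p (f s)"
  shows "Lp_null p (\<lambda>k x. \<Sum>s\<leftarrow>xs. f s k x)"
  using assms(2)
proof (induction xs)
  case (Cons s xs)
  then show ?case
    using Lp_null_add[OF p, of "f s" "\<lambda>k x. \<Sum>s\<leftarrow>xs. f s k x"] by simp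
qed (simp add: Lp_null_zero)

lemma Lp_null_imp_Lp_norm_tendsto_0:
  assumes p: "0 < p" and null: "Lp_null p G" and G: "\<And>k. borel_version A (g k) (G k)" and A: "A \<in> sets lebesgue"
  shows "(\<lambda>k. Lp_norm p A (g k)) \<longlonglongrightarrow> 0"
proof -
  have "(\<lambda>k. enn2real (Lp_int p (G k))) \<longlonglongrightarrow> enn2real 0"
    using null by (intro tendsto_enn2real) (auto simp: Lp_null_def)
  then have "(\<lambda>k. enn2real (Lp_int p (G k)) powr (1 / p)) \<longlonglongrightarrow> 0 powr (1 / p)"
    using p by (intro tendsto_powr' tendsto_const) auto
  then show ?thesis
    using borel_version_Lp(2)[OF G A] by simp
qed

lemma Lp_null_mollify:
  fixes F :: "real^'n::finite \<Rightarrow> real"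
  assumes "1 \<le> p" "integrable lborel F" "Lp_int p F < \<infinity>" "\<And>n. 0 < t n" "t \<longlonglongrightarrow> 0"
  shows "Lp_null p (\<lambda>n x. F x - mollify (t n) e (\<lambda>_. 0) F x)"
proof -
  have "F \<in> borel_measurable borel"
    using assms(2) by auto
  moreover have "mollify (t n) e (\<lambda>_. 0) F \<in> borel_measurable borel" for n
    by (rule borel_measurable_continuous_onI[OF smooth_on_UNIV_imp_continuous_on[OF smooth_on_mollify[OF assms(4,2)]]])
  moreover have "Lp_int p (\<lambda>x. F x - mollify (t n) e (\<lambda>_. 0) F x) = Lp_int p (\<lambda>x. mollify (t n) e (\<lambda>_. 0) F x - F x)" for n
    by (simp add: Lp_int_def abs_minus_commute)
  ultimately show ?thesis
    using mollify_tendsto_Lp[OF assms] by (auto simp: Lp_null_def)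
qed

lemma Lp_null_bounded_mult:
  assumes p: "0 \<le> p" and f: "Lp_null p f" and g: "g \<in> borel_measurable borel" "\<And>x. \<bar>g x\<bar> \<le> B"
  shows "Lp_null p (\<lambda>k x. g x * f k x)"
proof (rule Lp_null_dominated[OF f p, of "\<bar>B\<bar>"])
  show "(\<lambda>x. g x * f k x) \<in> borel_measurable borel" for k
    using f g(1) by (intro borel_measurable_times) (auto simp: Lp_null_def)
  have "\<bar>g x\<bar> \<le> \<bar>B\<bar>" for x
    using g(2) order_trans[OF _ abs_ge_self] by blast
  then show "\<forall>\<^sub>F k in sequentially. \<forall>x. \<bar>g x * f k x\<bar> \<le> \<bar>B\<bar> * \<bar>f k x\<bar>"
    by (simp add: abs_mult mult_right_mono)
qed simp

section \<open>Approximation by smooth functions\<close>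

lemma smooth_imp_smooth_closure:
  assumes "smooth_on UNIV f"
  shows "f \<in> smooth_closure \<Omega>"
proof -
  have "\<exists>g. continuous_on (closure \<Omega>) g \<and> (\<forall>x\<in>\<Omega>. g x = mi_deriv \<nu> f x)" for \<nu>
    using continuous_on_iterated_partial[OF assms] by (intro exI[of _ "mi_deriv \<nu> f"]) (simp add: mi_deriv_eq)
  then show ?thesis
    using assms smooth_on_UNIV_imp_continuous_on[OF assms] by (auto simp: smooth_closure_def smooth_on_def)
qed

lemma mollify_cong:
  fixes F G :: "real^'n::finite \<Rightarrow> real"
  assumes "0 < t" "\<And>y. y \<in> cball (x + t *\<^sub>R e) (t * real CARD('n)) \<Longrightarrow> F y = G y"
  shows "mollify t e \<nu> F x = mollify t e \<nu> G x"
proof -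
  have "F y * mollifier t e \<nu> (y - x) = G y * mollifier t e \<nu> (y - x)" for y
    using mollifier_translate_support[OF assms(1), of e \<nu> y x] assms(2)[of y] by force
  then show ?thesis
    unfolding mollify_def by (simp only:)
qed

lemma sum_sum_list_swap:
  fixes f :: "'a \<Rightarrow> 'b \<Rightarrow> real"
  shows "(\<Sum>a\<in>X. \<Sum>s\<leftarrow>xs. f a s) = (\<Sum>s\<leftarrow>xs. \<Sum>a\<in>X. f a s)"
  by (induction xs) (simp_all add: sum.distrib)

text \<open>All pieces of the partition of unity use the same scale \<open>t k = 1 / (k + 1)\<close>; from some \<open>k\<close> on it is
  below each of the finitely many bounds up to which the shifts stay inside \<open>\<Omega>\<close> and \<open>\<Omega> - D\<close>. For
  both norms the error is then a finite sum of bounded functions times mollification errors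
  \<open>F - J F\<close>.\<close>

lemma sobolev_Lp_approximation:
  fixes \<Omega> D :: "(real^'n::finite) set" and u :: "real^'n \<Rightarrow> real"
  assumes p: "1 \<le> p" and q: "1 \<le> q"
    and \<Omega>: "open \<Omega>" "bounded \<Omega>" "lipschitz_boundary \<Omega>"
    and D: "open D" "closure D \<subseteq> \<Omega>" "lipschitz_boundary D"
    and u: "u \<in> sobolev_space m p \<Omega>" "u \<in> Lp_space q (\<Omega> - D)"
  shows "\<exists>\<phi> :: nat \<Rightarrow> real ^ 'n \<Rightarrow> real. (\<forall>k. \<phi> k \<in> smooth_closure \<Omega>) \<and>
    (\<lambda>k. sobolev_norm m p \<Omega> (\<lambda>x. u x - \<phi> k x) + Lp_norm q (\<Omega> - D) (\<lambda>x. u x - \<phi> k x)) \<longlonglongrightarrow> 0"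
proof -
  let ?n = "real CARD('n)"
  have \<Omega>b[measurable]: "\<Omega> \<in> sets borel" and Db[measurable]: "D \<in> sets borel"
    using \<Omega> D by auto
  have \<Omega>l: "\<Omega> \<in> sets lebesgue" "\<Omega> - D \<in> sets lebesgue"
    by auto
  have "\<forall>x0\<in>closure \<Omega>. \<exists>e r t0. 0 < r \<and> 0 < t0 \<and> (\<forall>x\<in>ball x0 r. \<forall>t. 0 < t \<longrightarrow> t \<le> t0 \<longrightarrow>
    (x \<in> \<Omega> \<longrightarrow> cball (x + t *\<^sub>R e) (t * ?n) \<subseteq> \<Omega>) \<and>
    (x \<in> \<Omega> - D \<longrightarrow> cball (x + t *\<^sub>R e) (t * ?n) \<subseteq> \<Omega> - D))"
    using local_shift_direction[OF \<Omega>(1,3) D] by simp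
  then obtain e r t0 where r: "\<And>a. a \<in> closure \<Omega> \<Longrightarrow> 0 < r a" and t0: "\<And>a. a \<in> closure \<Omega> \<Longrightarrow> 0 < t0 a"
    and shift: "\<And>a x t. a \<in> closure \<Omega> \<Longrightarrow> x \<in> ball a (r a) \<Longrightarrow> 0 < t \<Longrightarrow> t \<le> t0 a \<Longrightarrow> x \<in> \<Omega> \<Longrightarrow>
      cball (x + t *\<^sub>R e a) (t * ?n) \<subseteq> \<Omega>"
    and shiftD: "\<And>a x t. a \<in> closure \<Omega> \<Longrightarrow> x \<in> ball a (r a) \<Longrightarrow> 0 < t \<Longrightarrow> t \<le> t0 a \<Longrightarrow> x \<in> \<Omega> - D \<Longrightarrow>
      cball (x + t *\<^sub>R e a) (t * ?n) \<subseteq> \<Omega> - D"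
    unfolding bchoice_iff by blast
  obtain X \<zeta> where X: "finite X" "X \<subseteq> closure \<Omega>" and \<zeta>: "\<And>a. smooth_on UNIV (\<zeta> a)"
    and \<zeta>_bounded: "\<And>a js. \<exists>B. \<forall>x. \<bar>iterated_partial js (\<zeta> a) x\<bar> \<le> B"
    and \<zeta>0: "\<And>a js x. a \<in> X \<Longrightarrow> x \<notin> ball a (r a) \<Longrightarrow> iterated_partial js (\<zeta> a) x = 0"
    and \<zeta>1: "\<And>x. x \<in> closure \<Omega> \<Longrightarrow> (\<Sum>a\<in>X. \<zeta> a x) = 1"
    using smooth_partition_of_unity[of "closure \<Omega>" r] \<Omega>(2) r by (auto simp: compact_closure)
  have \<zeta>m: "iterated_partial js (\<zeta> a) \<in> borel_measurable borel" for js a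
    by (rule borel_measurable_continuous_onI[OF continuous_on_iterated_partial[OF \<zeta>]])
  have \<zeta>sum: "(\<Sum>a\<in>X. iterated_partial js (\<zeta> a) x) = (if js = [] then 1 else 0)" if x: "x \<in> \<Omega>" for js x
  proof -
    have "(\<Sum>a\<in>X. iterated_partial js (\<zeta> a) x) = iterated_partial js (\<lambda>x. \<Sum>a\<in>X. \<zeta> a x) x"
      by (subst iterated_partial_sum[OF X(1) \<zeta>]) simp
    also have "\<dots> = iterated_partial js (\<lambda>x. 1) x"
      by (rule iterated_partial_local[OF \<Omega>(1) _ x]) (rule \<zeta>1[OF subsetD[OF closure_subset]])
    also have "\<dots> = (if js = [] then 1 else 0)"
      by (simp add: iterated_partial_const)
    finally show ?thesis .
  qed
  define t where "t = (\<lambda>n. 1 / real (Suc n))"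
  have t: "0 < t n" "t \<longlonglongrightarrow> 0" for n
    unfolding t_def using LIMSEQ_inverse_real_of_nat by (auto simp: inverse_eq_divide)
  have small: "\<forall>\<^sub>F k in sequentially. \<forall>a\<in>X. t k \<le> t0 a"
  proof (intro eventually_ball_finite ballI X)
    fix a assume "a \<in> X"
    then have "0 < t0 a" using X t0 by blast
    from order_tendstoD(2)[OF t(2) this] show "\<forall>\<^sub>F k in sequentially. t k \<le> t0 a"
      by (rule eventually_mono) simp
  qed
  obtain U where U: "borel_version \<Omega> u U"
    using borel_version_exists[OF _ \<Omega>b, of u] u(1) by (auto simp: sobolev_space_def Lp_space_def)
  have Um[measurable]: "U \<in> borel_measurable borel"
    by (rule borel_versionD(1)[OF U])
  have Lp_version: "Lp_int s F < \<infinity>" "integrable lborel F"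
    if "1 \<le> s" "A \<in> sets borel" "bounded A" "f \<in> Lp_space s A" "borel_version A f F" for s f F A
  proof -
    have "A \<in> sets lebesgue" using that(2) by auto
    then show "Lp_int s F < \<infinity>"
      using borel_version_Lp(1)[OF that(5)] that(4) by (auto simp: Lp_space_def)
    then show "integrable lborel F"
      using Lp_bounded_domain_imp_integrable[OF that(1) borel_versionD(1)[OF that(5)] that(3,2)] borel_versionD(2)[OF that(5)]
      by blast
  qed
  have Ui: "integrable lborel U"
    using Lp_version(2)[OF p \<Omega>b \<Omega>(2) _ U] u(1) by (auto simp: sobolev_space_def)
  define J where "J = (\<lambda>a k. mollify (t k) (e a) (\<lambda>_. 0))"
  define \<phi> where "\<phi> = (\<lambda>k x. \<Sum>a\<in>X. \<zeta> a x * J a k U x)"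
  have Js: "smooth_on UNIV (J a k U)" for a k
    unfolding J_def by (rule smooth_on_mollify[OF t(1) Ui])
  have \<phi>s: "smooth_on UNIV (\<phi> k)" for k
    unfolding \<phi>_def by (intro smooth_on_sum X smooth_on_mult \<zeta> Js)
  have \<phi>_iter: "iterated_partial js (\<phi> k) x =
      (\<Sum>a\<in>X. \<Sum>(as, bs)\<leftarrow>splits js. iterated_partial as (\<zeta> a) x * iterated_partial bs (J a k U) x)" for js k x
    unfolding \<phi>_def
    by (subst iterated_partial_sum) (auto intro: smooth_on_mult \<zeta> Js X simp: iterated_partial_mult[OF \<zeta> Js])

  have norm_p: "(\<lambda>k. Lp_norm p \<Omega> (weak_deriv \<Omega> \<nu> (\<lambda>x. u x - \<phi> k x))) \<longlonglongrightarrow> 0" if \<nu>: "mi_order \<nu> \<le> m" for \<nu>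
  proof -
    have "\<forall>\<mu>. \<exists>v. mi_order \<mu> \<le> m \<longrightarrow> v \<in> Lp_space p \<Omega> \<and> is_weak_deriv \<Omega> \<mu> u v"
      using u(1) by (auto simp: sobolev_space_def)
    then obtain v where v: "\<And>\<mu>. mi_order \<mu> \<le> m \<Longrightarrow> v \<mu> \<in> Lp_space p \<Omega>"
      "\<And>\<mu>. mi_order \<mu> \<le> m \<Longrightarrow> is_weak_deriv \<Omega> \<mu> u (v \<mu>)"
      by metis
    have "\<forall>\<mu>. \<exists>V. mi_order \<mu> \<le> m \<longrightarrow> borel_version \<Omega> (v \<mu>) V"
      using v(1) borel_version_exists[OF _ \<Omega>b] by (auto simp: Lp_space_def)
    then obtain V' where V': "\<And>\<mu>. mi_order \<mu> \<le> m \<Longrightarrow> borel_version \<Omega> (v \<mu>) (V' \<mu>)"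
      by metis
    \<comment> \<open>\<open>V bs\<close> is the weak derivative of \<open>u\<close> in the directions \<open>bs\<close>, extended by \<open>0\<close> outside \<open>\<Omega>\<close>.\<close>
    define V where "V = (\<lambda>bs. V' (count_list bs))"
    have V: "borel_version \<Omega> (v (count_list bs)) (V bs)" "Lp_int p (V bs) < \<infinity>" "integrable lborel (V bs)"
      if "length bs \<le> m" for bs
    proof -
      have "mi_order (count_list bs) \<le> m"
        using that by (simp add: mi_order_count_list)
      then show "borel_version \<Omega> (v (count_list bs)) (V bs)" "Lp_int p (V bs) < \<infinity>" "integrable lborel (V bs)"
        unfolding V_def using V' v Lp_version[OF p \<Omega>b \<Omega>(2)] by blast+
    qed
    define js where "js = rev (mi_list \<nu>)"
    have js: "count_list js = \<nu>" "length js \<le> m"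
      using \<nu> by (auto simp: js_def length_mi_list count_list_rev count_list_mi_list fun_eq_iff)
    define G where "G = (\<lambda>k x. indicator \<Omega> x * (V js x - iterated_partial js (\<phi> k) x))"
    have bs_le: "length (snd s) \<le> m" if "s \<in> set (splits js)" for s
      using that splits_length[of "fst s" "snd s" js] js(2) by simp
    have "Lp_null p (\<lambda>k x. \<Sum>s\<leftarrow>splits js. \<Sum>a\<in>X. iterated_partial (fst s) (\<zeta> a) x * (V (snd s) x - J a k (V (snd s)) x))"
    proof (intro Lp_null_sum_list Lp_null_sum p)
      fix s a assume s: "s \<in> set (splits js)"
      obtain B where B: "\<And>x. \<bar>iterated_partial (fst s) (\<zeta> a) x\<bar> \<le> B"
        using \<zeta>_bounded by blast
      have "Lp_null p (\<lambda>k x. V (snd s) x - J a k (V (snd s)) x)"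
        unfolding J_def using V[OF bs_le[OF s]] by (intro Lp_null_mollify p t)
      then show "Lp_null p (\<lambda>k x. iterated_partial (fst s) (\<zeta> a) x * (V (snd s) x - J a k (V (snd s)) x))"
        using p B by (intro Lp_null_bounded_mult \<zeta>m) auto
    qed
    moreover have Gm: "G k \<in> borel_measurable borel" for k
    proof -
      have [measurable]: "V js \<in> borel_measurable borel"
        using V(1)[OF js(2)] by (rule borel_versionD)
      have [measurable]: "iterated_partial js (\<phi> k) \<in> borel_measurable borel"
        by (rule borel_measurable_continuous_onI[OF continuous_on_iterated_partial[OF \<phi>s]])
      show ?thesis
        unfolding G_def by measurable
    qed
    moreover have "\<forall>\<^sub>F k in sequentially. \<forall>x. \<bar>G k x\<bar> \<le> 1 * \<bar>\<Sum>s\<leftarrow>splits js. \<Sum>a\<in>X.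
        iterated_partial (fst s) (\<zeta> a) x * (V (snd s) x - J a k (V (snd s)) x)\<bar>"
      using small
    proof (rule eventually_mono, intro allI)
      fix k x assume k: "\<forall>a\<in>X. t k \<le> t0 a"
      show "\<bar>G k x\<bar> \<le> 1 * \<bar>\<Sum>s\<leftarrow>splits js. \<Sum>a\<in>X.
        iterated_partial (fst s) (\<zeta> a) x * (V (snd s) x - J a k (V (snd s)) x)\<bar>"
      proof (cases "x \<in> \<Omega>")
        case True
        have summand: "iterated_partial (fst s) (\<zeta> a) x * iterated_partial (snd s) (J a k U) x
            = iterated_partial (fst s) (\<zeta> a) x * J a k (V (snd s)) x" if "a \<in> X" "s \<in> set (splits js)" for a s
        proof (cases "x \<in> ball a (r a)")
          case in_ball: True
          have "cball (x + t k *\<^sub>R e a) (t k * ?n) \<subseteq> \<Omega>"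
            using that(1) X(2) k True by (intro shift[OF _ in_ball t(1)]) auto
          moreover have "is_weak_deriv \<Omega> (count_list (snd s)) u (v (count_list (snd s)))"
            using bs_le[OF that(2)] by (intro v) (simp add: mi_order_count_list)
          ultimately have "iterated_partial (snd s) (J a k U) x = J a k (V (snd s)) x"
            unfolding J_def
            using U Ui V(1)[OF bs_le[OF that(2)]] t(1) \<Omega>(1) by (intro iterated_partial_mollify_weak) auto
          then show ?thesis by simp
        next
          case False
          then show ?thesis using \<zeta>0[OF that(1) False] by simp
        qed
        have "iterated_partial js (\<phi> k) x = (\<Sum>a\<in>X. \<Sum>s\<leftarrow>splits js. iterated_partial (fst s) (\<zeta> a) x * J a k (V (snd s)) x)"
          unfolding \<phi>_iter case_prod_unfold
          by (intro sum.cong refl arg_cong[where f = sum_list] map_cong) (use summand in auto)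
        also have "\<dots> = (\<Sum>s\<leftarrow>splits js. \<Sum>a\<in>X. iterated_partial (fst s) (\<zeta> a) x * J a k (V (snd s)) x)"
          by (rule sum_sum_list_swap)
        finally have 1: "iterated_partial js (\<phi> k) x = (\<Sum>s\<leftarrow>splits js. \<Sum>a\<in>X. iterated_partial (fst s) (\<zeta> a) x * J a k (V (snd s)) x)" .
        \<comment> \<open>The same expansion for \<open>V js\<close>: differentiating the constant sum of the \<open>\<zeta> a\<close> removes all
          terms in which some derivative falls on the partition of unity.\<close>
        have "V js x = (\<Sum>(as, bs)\<leftarrow>splits js. if as = [] then V bs x else 0)"
          by (rule sum_splits_Nil[symmetric])
        also have "\<dots> = (\<Sum>s\<leftarrow>splits js. \<Sum>a\<in>X. iterated_partial (fst s) (\<zeta> a) x * V (snd s) x)"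
          using \<zeta>sum[OF True]
          by (intro arg_cong[where f = sum_list] map_cong refl) (simp add: case_prod_unfold flip: sum_distrib_right)
        finally have 2: "V js x = (\<Sum>s\<leftarrow>splits js. \<Sum>a\<in>X. iterated_partial (fst s) (\<zeta> a) x * V (snd s) x)" .
        have "V js x - iterated_partial js (\<phi> k) x = (\<Sum>s\<leftarrow>splits js. \<Sum>a\<in>X. iterated_partial (fst s) (\<zeta> a) x * (V (snd s) x - J a k (V (snd s)) x))"
          unfolding 1 2 by (simp add: sum_list_subtractf[symmetric] sum_subtractf[symmetric] right_diff_distrib)
        then show ?thesis
          using True by (simp add: G_def)
      qed (simp add: G_def)
    qed
    ultimately have "Lp_null p G"
      using p by (intro Lp_null_dominated[where B = 1 and g = G]) auto
    moreover have "borel_version \<Omega> (weak_deriv \<Omega> \<nu> (\<lambda>x. u x - \<phi> k x)) (G k)" for k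
    proof -
      have wd: "is_weak_deriv \<Omega> \<nu> (\<lambda>x. u x - \<phi> k x) (\<lambda>x. v \<nu> x - iterated_partial js (\<phi> k) x)"
        unfolding js_def by (intro is_weak_deriv_diff v \<nu> smooth_is_weak_deriv \<phi>s \<Omega>(1))
      then have "is_weak_deriv \<Omega> \<nu> (\<lambda>x. u x - \<phi> k x) (weak_deriv \<Omega> \<nu> (\<lambda>x. u x - \<phi> k x))"
        unfolding weak_deriv_def by (rule someI[of "is_weak_deriv \<Omega> \<nu> (\<lambda>x. u x - \<phi> k x)"])
      from is_weak_deriv_unique[OF this wd \<Omega>(1)]
      have "AE x in lborel. x \<in> \<Omega> \<longrightarrow> weak_deriv \<Omega> \<nu> (\<lambda>x. u x - \<phi> k x) x = v \<nu> x - iterated_partial js (\<phi> k) x"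
        by (simp add: AE_completion_iff)
      moreover have "AE x in lborel. x \<in> \<Omega> \<longrightarrow> v \<nu> x = V js x"
        using borel_versionD(3)[OF V(1)[OF js(2)]] by (simp add: js(1))
      ultimately have "AE x in lborel. x \<in> \<Omega> \<longrightarrow> weak_deriv \<Omega> \<nu> (\<lambda>x. u x - \<phi> k x) x = G k x"
        by eventually_elim (auto simp: G_def)
      then show ?thesis
        using Gm by (auto simp: borel_version_def G_def)
    qed
    ultimately show ?thesis
      using p \<Omega>l by (intro Lp_null_imp_Lp_norm_tendsto_0) auto
  qed

  have norm_q: "(\<lambda>k. Lp_norm q (\<Omega> - D) (\<lambda>x. u x - \<phi> k x)) \<longlonglongrightarrow> 0"
  proof -
    define W where "W = (\<lambda>x. indicator (\<Omega> - D) x * U x)"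
    have W: "borel_version (\<Omega> - D) u W"
      using borel_versionD[OF U] unfolding borel_version_def W_def
      by (auto elim!: AE_mp)
    have "bounded (\<Omega> - D)"
      using \<Omega>(2) by (rule bounded_subset) auto
    then have Wq: "Lp_int q W < \<infinity>" "integrable lborel W"
      using Lp_version[OF q _ _ u(2) W] by auto
    define H where "H = (\<lambda>k x. indicator (\<Omega> - D) x * (U x - \<phi> k x))"
    have Hm: "H k \<in> borel_measurable borel" for k
    proof -
      have [measurable]: "\<phi> k \<in> borel_measurable borel"
        by (rule borel_measurable_continuous_onI[OF smooth_on_UNIV_imp_continuous_on[OF \<phi>s]])
      show ?thesis
        unfolding H_def by measurable
    qed
    have "Lp_null q (\<lambda>k x. \<Sum>a\<in>X. iterated_partial [] (\<zeta> a) x * (W x - J a k W x))"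
    proof (intro Lp_null_sum q)
      fix a
      obtain B where B: "\<And>x. \<bar>iterated_partial [] (\<zeta> a) x\<bar> \<le> B"
        using \<zeta>_bounded by blast
      have "Lp_null q (\<lambda>k x. W x - J a k W x)"
        unfolding J_def by (intro Lp_null_mollify q t Wq)
      then show "Lp_null q (\<lambda>k x. iterated_partial [] (\<zeta> a) x * (W x - J a k W x))"
        using q B by (intro Lp_null_bounded_mult \<zeta>m) auto
    qed
    moreover have "\<forall>\<^sub>F k in sequentially. \<forall>x. \<bar>H k x\<bar> \<le> 1 * \<bar>\<Sum>a\<in>X. iterated_partial [] (\<zeta> a) x * (W x - J a k W x)\<bar>"
      using small
    proof (rule eventually_mono, intro allI)
      fix k x assume k: "\<forall>a\<in>X. t k \<le> t0 a"
      show "\<bar>H k x\<bar> \<le> 1 * \<bar>\<Sum>a\<in>X. iterated_partial [] (\<zeta> a) x * (W x - J a k W x)\<bar>"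
      proof (cases "x \<in> \<Omega> - D")
        case True
        have "\<zeta> a x * J a k U x = \<zeta> a x * J a k W x" if "a \<in> X" for a
        proof (cases "x \<in> ball a (r a)")
          case in_ball: True
          have "cball (x + t k *\<^sub>R e a) (t k * ?n) \<subseteq> \<Omega> - D"
            using that X(2) k True by (intro shiftD[OF _ in_ball t(1)]) auto
          \<comment> \<open>From a point outside \<open>D\<close> the shifted mollifier does not see the values of \<open>u\<close> in \<open>D\<close>.\<close>
          then have "J a k U x = J a k W x"
            unfolding J_def by (intro mollify_cong t) (auto simp: W_def)
          then show ?thesis by simp
        next
          case False
          then show ?thesis using \<zeta>0[OF that False, of "[]"] by simp
        qed
        then have "\<phi> k x = (\<Sum>a\<in>X. \<zeta> a x * J a k W x)"
          unfolding \<phi>_def by (rule sum.cong[OF refl])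
        moreover have "U x = (\<Sum>a\<in>X. \<zeta> a x * W x)"
          using \<zeta>sum[of x "[]"] True by (simp add: W_def flip: sum_distrib_right)
        ultimately show ?thesis
          using True by (simp add: H_def right_diff_distrib sum_subtractf)
      qed (simp add: H_def)
    qed
    ultimately have "Lp_null q H"
      using q Hm by (intro Lp_null_dominated[where B = 1 and g = H]) auto
    moreover have "borel_version (\<Omega> - D) (\<lambda>x. u x - \<phi> k x) (H k)" for k
      using borel_versionD[OF U] Hm unfolding borel_version_def
      by (auto elim!: AE_mp simp: H_def)
    ultimately show ?thesis
      using q \<Omega>l by (intro Lp_null_imp_Lp_norm_tendsto_0) auto
  qed

  have "(\<lambda>k. sobolev_norm m p \<Omega> (\<lambda>x. u x - \<phi> k x) + Lp_norm q (\<Omega> - D) (\<lambda>x. u x - \<phi> k x)) \<longlonglongrightarrow> 0 + 0"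
    unfolding sobolev_norm_def
    by (intro tendsto_add norm_q tendsto_null_sum) (use norm_p in auto)
  then show ?thesis
    using smooth_imp_smooth_closure[OF \<phi>s] by (intro exI[of _ \<phi>]) simp
qed

lemma minimally_smooth_imp_lipschitz_boundary:
  assumes "minimally_smooth_boundary G"
  shows "lipschitz_boundary G"
proof -
  obtain U :: "nat \<Rightarrow> (real^'a) set" and L where
    U: "\<And>i. open (U i)" "frontier G \<subseteq> (\<Union>i. U i)" "\<And>i. lipschitz_subgraph_in L G (U i)"
    using assms unfolding minimally_smooth_boundary_def by blast
  show ?thesis
    unfolding lipschitz_boundary_def
  proof
    fix x assume "x \<in> frontier G"
    then obtain i where "x \<in> U i"
      using U(2) by blast
    with U(1,3) show "\<exists>U L. open U \<and> x \<in> U \<and> lipschitz_subgraph_in L G U"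
      by (intro exI[of _ "U i"] exI[of _ L]) simp
  qed
qed

theorem theorem1p2:
  fixes \<Omega> D :: "(real ^ 'n::finite) set"
    and u :: "real ^ 'n \<Rightarrow> real"
    and m :: nat and p q :: real
  assumes "1 \<le> m" and "1 \<le> p" and "real m * p < real CARD('n)"
    and "real CARD('n) * p / (real CARD('n) - real m * p) < q"
    and "open \<Omega>" and "bounded \<Omega>" and "lipschitz_boundary \<Omega>"
    and "open D" and "D \<Subset> \<Omega>" and "minimally_smooth_boundary D"
    and "u \<in> sobolev_space m p \<Omega> \<inter> Lp_space q (\<Omega> - D)"
  shows "\<exists>\<phi> :: nat \<Rightarrow> real ^ 'n \<Rightarrow> real.
    (\<forall>k. \<phi> k \<in> smooth_closure \<Omega>) \<and>
    (\<lambda>k. sobolev_norm m p \<Omega> (\<lambda>x. u x - \<phi> k x) + Lp_norm q (\<Omega> - D) (\<lambda>x. u x - \<phi> k x))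
      \<longlonglongrightarrow> 0"
proof (rule sobolev_Lp_approximation)
  have "real CARD('n) - real m * p \<le> real CARD('n) * p"
  proof -
    have "real CARD('n) * 1 \<le> real CARD('n) * p"
      using assms(2) by (intro mult_left_mono) auto
    moreover have "0 \<le> real m * p"
      using assms(2) by simp
    ultimately show ?thesis by linarith
  qed
  then have "1 \<le> real CARD('n) * p / (real CARD('n) - real m * p)"
    using assms(3) by (subst le_divide_eq_1_pos) auto
  then show "1 \<le> q"
    using assms(4) by simp
  show "lipschitz_boundary D"
    using assms(10) by (rule minimally_smooth_imp_lipschitz_boundary)
qed (use assms in \<open>auto simp: compactly_contained_def\<close>)

end
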